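(* Assume the following hypothesis: for every fixed $\epsilon>0$, $$\sum_{d\le x^{1-\epsilon}}\left|\pi(x;d,1)-\frac{\pi(x)}{\phi(d)}\right| = o(\pi(x)) \quad\text{as } x\to\infty.$$ Fix $U>1$ and an integer $k\ge 0$. If $y=x^{1/u}$ where $1\le u\le U$, then $$\Phi_k(x,y)\sim x\,\sigma_k(u)\quad\text{as } x\to\infty.$$ Moreover, for every $k\ge1$, $$\sigma_k(u)=\left(\frac{1+o(1)}{\log_k(u)\log_{k+1}(u)}\right)^u\quad\text{as } u\to\infty.$$
   Context: $\phi$ is Euler's function, $\phi_0(n)=n$ and $\phi_{k+1}(n)=\phi(\phi_k(n))$. $\pi(x)$ is the number of primes $\le x$ and $\pi(x;d,1)$ the number of primes $p\le x$ with $p\equiv1\pmod d$. Define $\Phi_k(x,y)=\#\{n\le x:\ p\mid\phi_k(n)\Rightarrow p\le y\}$ ($p$ prime). $\rho$ is the Dickman function: the unique continuous solution of $u\rho'(u)=-\rho(u-1)$ for $u\ge1$ with $\rho(u)=1$ for $0\le u\le1$; it satisfies $\rho(u)=((e+o(1))/(u\log u))^u$. The functions $\sigma_k$ are defined by $\sigma_0=\rho$, and for $k\ge0$, $\sigma_{k+1}(u)=1$ for $0\le u\le1$ and $u\sigma_{k+1}(u)=\int_0^u\sigma_{k+1}(u-t)\sigma_k(t)\,dt$ for $u\ge1$. $\log_k$ denotes the $k$-fold iterated logarithm $\log(\log(\cdots\log(u)\cdots))$. *)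

theory Defs
  imports "HOL-Analysis.Analysis" "HOL-Number_Theory.Number_Theory" "HOL-Library.Landau_Symbols"
begin

definition phi_iter :: "nat \<Rightarrow> nat \<Rightarrow> nat" where
  "phi_iter k n = (totient ^^ k) n"

definition prime_pi :: "real \<Rightarrow> nat" where
  "prime_pi x = card {p :: nat. prime p \<and> real p \<le> x}"

definition prime_pi_ap1 :: "real \<Rightarrow> nat \<Rightarrow> nat" where
  "prime_pi_ap1 x d = card {p :: nat. prime p \<and> real p \<le> x \<and> [p = 1] (mod d)}"

definition Phi_count :: "nat \<Rightarrow> real \<Rightarrow> real \<Rightarrow> nat" where
  "Phi_count k x y = card {n :: nat. 1 \<le> n \<and> real n \<le> x \<and>
      (\<forall>p. prime p \<and> p dvd phi_iter k n \<longrightarrow> real p \<le> y)}"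

text \<open>Dickman function: the unique continuous solution on [0,\<infinity>) of
  u rho'(u) = - rho(u-1) for u \<ge> 1 with rho = 1 on [0,1]
  (normalised to 0 on negative arguments so that it is unique as a total function).\<close>
definition dickman_rho :: "real \<Rightarrow> real" where
  "dickman_rho = (THE f. (\<forall>u<0. f u = 0) \<and> continuous_on {0..} f \<and>
      (\<forall>u\<in>{0..1}. f u = 1) \<and>
      (\<forall>u\<ge>1. (f has_real_derivative (- f (u - 1) / u)) (at u within {1..})))"

fun sigma_fun :: "nat \<Rightarrow> real \<Rightarrow> real" where
  "sigma_fun 0 = dickman_rho"
| "sigma_fun (Suc k) = (THE f. (\<forall>u<0. f u = 0) \<and> continuous_on {0..} f \<and>
      (\<forall>u\<in>{0..1}. f u = 1) \<and>
      (\<forall>u\<ge>1. u * f u = integral {0..u} (\<lambda>t. f (u - t) * sigma_fun k t)))"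

definition iter_log :: "nat \<Rightarrow> real \<Rightarrow> real" where
  "iter_log k = ln ^^ k"

end

theory Submission
  imports Defs "HOL-Real_Asymp.Real_Asymp"
begin

text \<open>
  Existence, uniqueness and all bounds for the functions \<open>\<sigma>\<^sub>k\<close> come from a comparison principle for the
  Volterra equation \<open>u f(u) = \<integral>\<^sub>0\<^sup>u f(u - t) \<kappa>(t) dt\<close>: with the trial functions \<open>exp(K - s u)\<close> it
  yields \<open>\<sigma>\<^sub>k(u) \<le> exp(- s u + E\<^sub>k(s))\<close>, where \<open>E\<^sub>k\<close> is the \<open>k\<close>-fold iterated exponential of
  \<open>(1 + o(1)) exp(s) / s\<close>, and \<open>\<sigma>\<^sub>k(u) \<ge> exp(- s u)\<close> as long as \<open>u\<close> is at most the same iterated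
  exponential with a slightly smaller constant. Choosing \<open>s\<close> near
  \<open>log(log\<^sub>k u log\<^sub>k\<^sub>+\<^sub>1 u)\<close> gives the asymptotics.

  For the counting function, up to \<open>o(x)\<close> exceptions \<open>\<phi>\<^sub>k(n)\<close> is \<open>y\<close>-smooth iff every prime \<open>p | n\<close> is
  such that \<open>p - 1\<close> has the corresponding property at level \<open>k - 1\<close>; the exceptions involve a square of a
  prime above \<open>y\<close> and are controlled by second moments. The property at level \<open>k - 1\<close> says that no prime
  factor belongs to a certain set \<open>Q\<close> of primes above \<open>y\<close>, and the hypothesis on primes in progressions
  shows, by inclusion-exclusion over divisors up to \<open>x\<^sup>1\<^sup>-\<^sup>\<epsilon>\<close>, that shifted primes avoid \<open>Q\<close> with the same
  frequency as integers do. Hence the admissible primes have relative density \<open>\<sigma>\<^sub>k\<^sub>-\<^sub>1(log p / log y)\<close>.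
  Writing \<open>log n\<close> as a sum over the primes dividing \<open>n\<close> turns the count of integers composed of such
  primes into an approximate solution of the equation of \<open>\<sigma>\<^sub>k\<close>, and a Gronwall argument concludes. Only
  the estimates of Chebyshev and Mertens are needed about primes.
\<close>

section \<open>Volterra equations\<close>

text \<open>Dividing the right side of the Volterra equation for \<open>exp (K - s * u)\<close> by
  this function itself leaves X(u), the integral of \<open>exp (s * t) * \<kappa> t\<close> over
  [0, u]. So the trial function is a supersolution where X(u) \<le> u and a subsolution where X(u)
  \<ge> u. For the indicator kernel X(u) = (exp s - 1) / s once u \<ge> 1; for a kernel below
  \<open>exp (E - (s + d) * t)\<close> it is at most exp(E) / d. Hence every level exponentiates the
  previous bound. The sets of primes that occur at level k are irregular and vary with y. The
  induction works because the hypothesis on progressions does not mention them: the transfer to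
  shifted primes is uniform over all sets of primes above a fixed power of t, and the passage from
  primes to integers is uniform over all sets with the right weights. Densities are measured against
  \<pi>(t) itself and enter only through the weights log p / p, whose partial sums Mertens' estimate
  gives up to O(1), negligible after division by log y. So \<pi>(t) never has to be evaluated
  asymptotically.\<close>

lemma has_integral_exp_scaled:
  fixes c :: real
  assumes "c \<noteq> 0" "0 \<le> u"
  shows "((\<lambda>r. exp (c * r)) has_integral (exp (c * u) - 1) / c) {0..u}"
proof -
  have "((\<lambda>r. exp (c * r)) has_integral exp (c * u) / c - exp (c * 0) / c) {0..u}"
    by (rule fundamental_theorem_of_calculus[OF \<open>0 \<le> u\<close>])
       (use assms in \<open>auto intro!: derivative_eq_intros simp flip: has_real_derivative_iff_has_vector_derivative\<close>)
  then show ?thesis by (simp add: diff_divide_distrib)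
qed

lemma has_integral_flip:
  fixes f :: "real \<Rightarrow> real"
  assumes "(f has_integral i) {0..u}"
  shows "((\<lambda>t. f (u - t)) has_integral i) {0..u}"
proof -
  have "((\<lambda>x. f (- 1 *\<^sub>R x + u)) has_integral (1 / (\<bar>- 1\<bar> ^ DIM(real))) *\<^sub>R i)
        ((\<lambda>x. (1 / (- 1)) *\<^sub>R x + - ((1 / (- 1)) *\<^sub>R u)) ` cbox 0 u)"
    using assms by (intro has_integral_affinity) auto
  moreover have "(\<lambda>x. (1 / (- 1)) *\<^sub>R x + - ((1 / (- 1)) *\<^sub>R u)) ` cbox 0 u = {0..u}"
    by (force simp: image_iff intro: bexI[of _ "u - _"])
  ultimately show ?thesis by simp
qed

lemma integral_flip:
  fixes f :: "real \<Rightarrow> real"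
  assumes "f integrable_on {0..u}"
  shows "integral {0..u} (\<lambda>t. f (u - t)) = integral {0..u} f"
  using has_integral_flip[OF integrable_integral[OF assms]] by (rule integral_unique)

text \<open>In the sup norm weighted by \<open>exp (- (2 * c * u))\<close> the operator on the right
  has norm at most 1/2, so a nonnegative function below its own image vanishes.\<close>

lemma gronwall_zero:
  fixes w :: "real \<Rightarrow> real"
  assumes cont: "continuous_on {0..T} w" and nonneg: "\<And>u. u \<in> {0..T} \<Longrightarrow> 0 \<le> w u"
    and le: "\<And>u. u \<in> {0..T} \<Longrightarrow> w u \<le> c * integral {0..u} w" and "c > 0" and u: "u \<in> {0..T}"
  shows "w u = 0"
proof -
  have T: "0 \<le> T" using u by auto
  have "continuous_on {0..T} (\<lambda>u. w u * exp (- (2 * c * u)))"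
    by (intro continuous_intros cont)
  then obtain m where m: "m \<in> {0..T}"
    and mx: "\<And>u. u \<in> {0..T} \<Longrightarrow> w u * exp (- (2 * c * u)) \<le> w m * exp (- (2 * c * m))"
    using continuous_attains_sup[of "{0..T}" "\<lambda>u. w u * exp (- (2 * c * u))"] T by auto
  define M where "M = w m * exp (- (2 * c * m))"
  have M0: "M \<ge> 0" using nonneg[OF m] by (simp add: M_def)
  have wle: "w u \<le> M * exp (2 * c * u)" if "u \<in> {0..T}" for u
    using mx[OF that] by (simp add: M_def exp_minus field_simps)
  have "w integrable_on {0..m}"
    by (rule integrable_continuous_real, rule continuous_on_subset[OF cont]) (use m in auto)
  then have "integral {0..m} w \<le> M * ((exp (2 * c * m) - 1) / (2 * c))"
    by (rule has_integral_le[OF integrable_integral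
          has_integral_mult_right[OF has_integral_exp_scaled[of "2 * c" m], of M]])
       (use m \<open>c > 0\<close> wle in auto)
  then have "w m \<le> c * (M * ((exp (2 * c * m) - 1) / (2 * c)))"
    using le[OF m] \<open>c > 0\<close> mult_left_mono[of _ _ c] by (meson order_less_imp_le order_trans)
  also have "\<dots> \<le> M * exp (2 * c * m) / 2"
    using \<open>c > 0\<close> M0 by (simp add: field_simps)
  also have "\<dots> = w m / 2" by (simp add: M_def exp_minus)
  finally have "w m \<le> 0" by simp
  then have "M \<le> 0" by (simp add: M_def mult_le_0_iff)
  with M0 have "M = 0" by simp
  with wle[OF u] nonneg[OF u] show ?thesis by simp
qed

section \<open>Kernels, solutions and the comparison principle\<close>

definition vkernel :: "(real \<Rightarrow> real) \<Rightarrow> bool" where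
  "vkernel \<kappa> \<longleftrightarrow> (\<forall>t. 0 \<le> \<kappa> t \<and> \<kappa> t \<le> 1) \<and> (\<forall>t\<in>{0..1}. \<kappa> t = 1) \<and>
     (\<forall>u f. continuous_on {0..u} f \<longrightarrow> (\<lambda>t. f t * \<kappa> t :: real) integrable_on {0..u})"

definition vsol :: "(real \<Rightarrow> real) \<Rightarrow> (real \<Rightarrow> real) \<Rightarrow> bool" where
  "vsol \<kappa> f \<longleftrightarrow> continuous_on {0..} f \<and> (\<forall>u\<in>{0..1}. f u = 1) \<and>
     (\<forall>u\<ge>1. u * f u = integral {0..u} (\<lambda>t. f (u - t) * \<kappa> t))"

lemma continuous_on_flip:
  fixes f :: "real \<Rightarrow> real"
  assumes "continuous_on {0..T} f" "u \<le> T"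
  shows "continuous_on {0..u} (\<lambda>t. f (u - t))"
  by (rule continuous_on_compose2[OF assms(1)]) (use assms in \<open>auto intro!: continuous_intros\<close>)

lemma vkernelD:
  assumes "vkernel \<kappa>"
  shows "0 \<le> \<kappa> t" "\<kappa> t \<le> 1" "t \<in> {0..1} \<Longrightarrow> \<kappa> t = 1"
    "continuous_on {0..u} f \<Longrightarrow> (\<lambda>t. f t * \<kappa> t) integrable_on {0..u}"
  using assms by (auto simp: vkernel_def)

lemma vkernel_integrable:
  assumes "vkernel \<kappa>" "0 \<le> a"
  shows "\<kappa> integrable_on {a..u}"
proof -
  have "\<kappa> integrable_on {0..u}"
    using vkernelD(4)[OF assms(1), of u "\<lambda>_. 1"] by simp
  then show ?thesis
    by (rule integrable_on_subinterval) (use assms in auto)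
qed

lemma vkernel_conv_integrable:
  assumes "vkernel \<kappa>" "continuous_on {0..T} f" "u \<le> T"
  shows "(\<lambda>t. f (u - t) * \<kappa> t) integrable_on {0..u}"
  by (rule vkernelD(4)[OF assms(1) continuous_on_flip[OF assms(2,3)]])

text \<open>Where D is positive, the inequality and 0 \<le> \<kappa> \<le> 1 bound a times the
  positive part of D by its own integral, so Gronwall applies to the positive part.\<close>

lemma volterra_comparison:
  assumes ker: "vkernel \<kappa>" and cont: "continuous_on {0..T} D" and "a > 0"
    and init: "\<And>u. u \<in> {0..a} \<Longrightarrow> u \<le> T \<Longrightarrow> D u \<le> 0"
    and le: "\<And>u. a \<le> u \<Longrightarrow> u \<le> T \<Longrightarrow> u * D u \<le> integral {0..u} (\<lambda>t. D (u - t) * \<kappa> t)"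
    and u: "u \<in> {0..T}"
  shows "D u \<le> 0"
proof -
  define w where "w u = max 0 (D u)" for u
  have wcont: "continuous_on {0..T} w"
    unfolding w_def by (intro continuous_intros cont)
  have "w u = 0"
  proof (rule gronwall_zero[OF wcont _ _ _ u, of "1 / a"])
    fix v assume v: "v \<in> {0..T}"
    show "0 \<le> w v" by (simp add: w_def)
    have wi: "w integrable_on {0..v}"
      by (rule integrable_continuous_real, rule continuous_on_subset[OF wcont]) (use v in auto)
    have I0: "0 \<le> integral {0..v} w"
      by (rule integral_nonneg[OF wi]) (auto simp: w_def)
    show "w v \<le> 1 / a * integral {0..v} w"
    proof (cases "D v \<le> 0")
      case True
      then show ?thesis using I0 \<open>a > 0\<close> by (simp add: w_def)
    next
      case False
      then have av: "a \<le> v" using init[of v] v by fastforce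
      have "a * w v \<le> v * D v" using False av by (simp add: w_def)
      also have "\<dots> \<le> integral {0..v} (\<lambda>t. D (v - t) * \<kappa> t)" using le av v by auto
      also have "\<dots> \<le> integral {0..v} (\<lambda>t. w (v - t))"
      proof (rule integral_le)
        show "(\<lambda>t. D (v - t) * \<kappa> t) integrable_on {0..v}"
          by (rule vkernel_conv_integrable[OF ker cont]) (use v in auto)
        show "(\<lambda>t. w (v - t)) integrable_on {0..v}"
          by (rule integrable_continuous_real, rule continuous_on_flip[OF wcont]) (use v in auto)
        fix t
        have "D (v - t) * \<kappa> t \<le> w (v - t) * \<kappa> t"
          using vkernelD(1)[OF ker] by (intro mult_right_mono) (auto simp: w_def)
        also have "\<dots> \<le> w (v - t) * 1"
          using vkernelD(2)[OF ker] by (intro mult_left_mono) (auto simp: w_def)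
        finally show "D (v - t) * \<kappa> t \<le> w (v - t)" by simp
      qed
      also have "\<dots> = integral {0..v} w" by (rule integral_flip[OF wi])
      finally show ?thesis using \<open>a > 0\<close> by (simp add: field_simps)
    qed
  qed (use \<open>a > 0\<close> in auto)
  then show ?thesis by (simp add: w_def split: if_splits)
qed

lemma vsolD:
  assumes "vsol \<kappa> f"
  shows "continuous_on {0..} f" "continuous_on {0..T} f" "u \<in> {0..1} \<Longrightarrow> f u = 1"
    "u \<ge> 1 \<Longrightarrow> u * f u = integral {0..u} (\<lambda>t. f (u - t) * \<kappa> t)"
  using assms by (auto simp: vsol_def elim: continuous_on_subset)

text \<open>The starting point \<open>a\<close> is left free because the exponential trial functions
  are supersolutions only from a large point on; on [0, a] a cruder bound has to be
  supplied.\<close>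

lemma vsol_le_super:
  assumes ker: "vkernel \<kappa>" and sol: "vsol \<kappa> f" and g: "continuous_on {0..T} g" and a: "a \<ge> 1"
    and init: "\<And>u. u \<in> {0..a} \<Longrightarrow> u \<le> T \<Longrightarrow> f u \<le> g u"
    and super: "\<And>u. a \<le> u \<Longrightarrow> u \<le> T \<Longrightarrow> integral {0..u} (\<lambda>t. g (u - t) * \<kappa> t) \<le> u * g u"
    and u: "u \<in> {0..T}"
  shows "f u \<le> g u"
proof -
  have "f u - g u \<le> 0"
  proof (rule volterra_comparison[OF ker, of T "\<lambda>u. f u - g u" a])
    fix v assume v: "a \<le> v" "v \<le> T"
    have "v * (f v - g v) \<le> integral {0..v} (\<lambda>t. f (v - t) * \<kappa> t) - integral {0..v} (\<lambda>t. g (v - t) * \<kappa> t)"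
      using super[OF v] vsolD(4)[OF sol, of v] v a by (simp add: algebra_simps)
    also have "\<dots> = integral {0..v} (\<lambda>t. f (v - t) * \<kappa> t - g (v - t) * \<kappa> t)"
      by (rule Henstock_Kurzweil_Integration.integral_diff[symmetric];
          rule vkernel_conv_integrable[OF ker _ v(2)]) (use g vsolD(2)[OF sol] in auto)
    finally show "v * (f v - g v) \<le> integral {0..v} (\<lambda>t. (f (v - t) - g (v - t)) * \<kappa> t)"
      by (simp add: algebra_simps)
  qed (use a init u g vsolD(2)[OF sol] in \<open>auto intro!: continuous_intros\<close>)
  then show ?thesis by simp
qed

lemma vsol_ge_sub:
  assumes ker: "vkernel \<kappa>" and sol: "vsol \<kappa> f" and g: "continuous_on {0..T} g" and a: "a \<ge> 1"
    and init: "\<And>u. u \<in> {0..a} \<Longrightarrow> u \<le> T \<Longrightarrow> g u \<le> f u"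
    and sub: "\<And>u. a \<le> u \<Longrightarrow> u \<le> T \<Longrightarrow> u * g u \<le> integral {0..u} (\<lambda>t. g (u - t) * \<kappa> t)"
    and u: "u \<in> {0..T}"
  shows "g u \<le> f u"
proof -
  have "g u - f u \<le> 0"
  proof (rule volterra_comparison[OF ker, of T "\<lambda>u. g u - f u" a])
    fix v assume v: "a \<le> v" "v \<le> T"
    have "v * (g v - f v) \<le> integral {0..v} (\<lambda>t. g (v - t) * \<kappa> t) - integral {0..v} (\<lambda>t. f (v - t) * \<kappa> t)"
      using sub[OF v] vsolD(4)[OF sol, of v] v a by (simp add: algebra_simps)
    also have "\<dots> = integral {0..v} (\<lambda>t. g (v - t) * \<kappa> t - f (v - t) * \<kappa> t)"
      by (rule Henstock_Kurzweil_Integration.integral_diff[symmetric];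
          rule vkernel_conv_integrable[OF ker _ v(2)]) (use g vsolD(2)[OF sol] in auto)
    finally show "v * (g v - f v) \<le> integral {0..v} (\<lambda>t. (g (v - t) - f (v - t)) * \<kappa> t)"
      by (simp add: algebra_simps)
  qed (use a init u g vsolD(2)[OF sol] in \<open>auto intro!: continuous_intros\<close>)
  then show ?thesis by simp
qed

lemma vsol_unique:
  assumes "vkernel \<kappa>" "vsol \<kappa> f" "vsol \<kappa> g" "u \<ge> 0"
  shows "f u = g u"
proof (rule antisym)
  show "f u \<le> g u"
    by (rule vsol_le_super[OF assms(1,2) vsolD(2)[OF assms(3), of u], of 1])
       (use assms vsolD(3,4)[OF assms(2)] vsolD(3,4)[OF assms(3)] in auto)
  show "g u \<le> f u"
    by (rule vsol_le_super[OF assms(1,3) vsolD(2)[OF assms(2), of u], of 1])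
       (use assms vsolD(3,4)[OF assms(2)] vsolD(3,4)[OF assms(3)] in auto)
qed

lemma vsol_bounds:
  assumes ker: "vkernel \<kappa>" and sol: "vsol \<kappa> f" and u: "u \<ge> 0"
  shows "0 \<le> f u" "f u \<le> 1"
proof -
  show "0 \<le> f u"
    by (rule vsol_ge_sub[OF ker sol, of u "\<lambda>_. 0" 1]) (use u vsolD(3)[OF sol] in auto)
  show "f u \<le> 1"
  proof (rule vsol_le_super[OF ker sol, of u "\<lambda>_. 1" 1])
    fix v :: real assume "1 \<le> v"
    have "integral {0..v} \<kappa> \<le> integral {0..v} (\<lambda>_. 1 :: real)"
      by (rule integral_le[OF vkernel_integrable[OF ker]]) (use vkernelD(2)[OF ker] in auto)
    then show "integral {0..v} (\<lambda>t. 1 * \<kappa> t) \<le> v * 1" using \<open>1 \<le> v\<close> by simp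
  qed (use u vsolD(3)[OF sol] in auto)
qed

section \<open>Existence by successive approximation\<close>

lemma continuous_on_half_line:
  fixes f :: "real \<Rightarrow> real"
  assumes "\<And>T. a \<le> T \<Longrightarrow> continuous_on {a..T} f"
  shows "continuous_on {a..} f"
  unfolding continuous_on_eq_continuous_within
proof
  fix x :: real assume x: "x \<in> {a..}"
  have "continuous (at x within {a..x+1}) f"
    using assms[of "x + 1"] x by (auto simp: continuous_on_eq_continuous_within)
  moreover have "at x within {a..} = at x within {a..x+1}"
    by (rule at_within_nhd[of _ "{..<x+1}"]) auto
  ultimately show "continuous (at x within {a..}) f" by simp
qed

text \<open>Picard iteration from zero. The weight \<open>exp (2 * u)\<close> makes each iteration
  gain a factor 1/2 on the whole of [0, T], so the telescoping series converges uniformly without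
  cutting the interval into short pieces.\<close>

lemma volterra_fixpoint_exists:
  fixes K :: "(real \<Rightarrow> real) \<Rightarrow> real \<Rightarrow> real"
  assumes cont: "\<And>f. continuous_on {0..} f \<Longrightarrow> continuous_on {0..} (K f)"
    and lip: "\<And>f g u. continuous_on {0..} f \<Longrightarrow> continuous_on {0..} g \<Longrightarrow> 0 \<le> u \<Longrightarrow>
        \<bar>K f u - K g u\<bar> \<le> integral {0..u} (\<lambda>r. \<bar>f r - g r\<bar>)"
  shows "\<exists>f. continuous_on {0..} f \<and> (\<forall>u\<ge>0. f u = K f u)"
proof -
  define F where "F n = (K ^^ n) (\<lambda>_. 0)" for n
  have F0: "F 0 = (\<lambda>_. 0)" and FS: "F (Suc n) = K (F n)" for n by (simp_all add: F_def)
  have Fcont: "continuous_on {0..} (F n)" for n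
    by (induction n) (auto simp: F0 FS cont)
  have absint: "(\<lambda>r. \<bar>f r - g r\<bar>) integrable_on {0..u}"
    if "continuous_on {0..} f" "continuous_on {0..} g" for f g :: "real \<Rightarrow> real" and u
    by (rule integrable_continuous_real)
       (intro continuous_intros; rule continuous_on_subset[of "{0..}"]; use that in auto)
  define f where "f u = (\<Sum>n. F (Suc n) u - F n u)" for u
  have tele: "(\<Sum>i<n. F (Suc i) u - F i u) = F n u" for n u
    by (simp add: sum_lessThan_telescope[of "\<lambda>i. F i u"] F0)
  have unif: "uniform_limit {0..T} F f sequentially" if T: "0 \<le> T" for T
  proof -
    have "compact ((\<lambda>u. \<bar>F 1 u\<bar>) ` {0..T})"
      by (intro compact_continuous_image continuous_intros)
         (use continuous_on_subset[OF Fcont[of 1]] in auto)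
    then obtain M0 where M0: "\<And>u. u \<in> {0..T} \<Longrightarrow> \<bar>F 1 u\<bar> \<le> M0"
      by (force dest!: compact_imp_bounded simp: bounded_iff)
    define M where "M = max M0 0"
    have bnd: "\<bar>F (Suc n) u - F n u\<bar> \<le> M * exp (2 * u) / 2 ^ n" if "u \<in> {0..T}" for n u
      using that
    proof (induction n arbitrary: u)
      case 0
      have "\<bar>F 1 u\<bar> \<le> M * 1" using M0[OF 0] by (simp add: M_def)
      also have "\<dots> \<le> M * exp (2 * u)" using 0 by (intro mult_left_mono) (auto simp: M_def)
      finally show ?case by (simp add: F0)
    next
      case (Suc n)
      have "\<bar>F (Suc (Suc n)) u - F (Suc n) u\<bar> \<le> integral {0..u} (\<lambda>r. \<bar>F (Suc n) r - F n r\<bar>)"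
        using lip[OF Fcont[of "Suc n"] Fcont[of n], of u] Suc.prems by (simp add: FS)
      also have "\<dots> \<le> M / 2 ^ n * ((exp (2 * u) - 1) / 2)"
        by (rule has_integral_le[OF integrable_integral[OF absint[OF Fcont Fcont]]
              has_integral_mult_right[OF has_integral_exp_scaled[of 2 u], of "M / 2 ^ n"]])
           (use Suc in auto)
      also have "\<dots> \<le> M * exp (2 * u) / 2 ^ Suc n"
        by (simp add: M_def field_simps)
      finally show ?case .
    qed
    have "uniform_limit {0..T} (\<lambda>n x. \<Sum>i<n. F (Suc i) x - F i x) (\<lambda>x. \<Sum>n. F (Suc n) x - F n x) sequentially"
    proof (rule Weierstrass_m_test)
      fix n x assume x: "x \<in> {0..T}"
      have "\<bar>F (Suc n) x - F n x\<bar> \<le> M * exp (2 * x) / 2 ^ n" by (rule bnd[OF x])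
      also have "\<dots> \<le> M * exp (2 * T) / 2 ^ n"
        using x by (intro divide_right_mono mult_left_mono) (auto simp: M_def)
      finally show "norm (F (Suc n) x - F n x) \<le> M * exp (2 * T) * (1 / 2) ^ n"
        by (simp add: power_one_over field_simps)
    next
      show "summable (\<lambda>n. M * exp (2 * T) * (1 / 2) ^ n)"
        by (intro summable_mult summable_geometric) auto
    qed
    then show ?thesis by (simp add: tele f_def[abs_def])
  qed
  have fcontT: "continuous_on {0..T} f" if "0 \<le> T" for T
    by (rule uniform_limit_theorem[OF _ unif[OF that]])
       (auto intro!: always_eventually continuous_on_subset[OF Fcont])
  have fcont: "continuous_on {0..} f"
    by (rule continuous_on_half_line[OF fcontT])
  have "f u = K f u" if u: "u \<ge> 0" for u
  proof (rule LIMSEQ_unique)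
    show "(\<lambda>n. F (Suc n) u) \<longlonglongrightarrow> f u"
      using tendsto_uniform_limitI[OF unif[OF u], of u] u by (subst filterlim_sequentially_Suc) auto
    have "(\<lambda>n. F (Suc n) u - K f u) \<longlonglongrightarrow> 0"
    proof (rule LIMSEQ_I)
      fix e :: real assume e: "e > 0"
      have "\<forall>\<^sub>F n in sequentially. \<forall>x\<in>{0..u}. dist (F n x) (f x) < e / (2 * (u + 1))"
        by (rule uniform_limitD[OF unif[OF u]]) (use e u in auto)
      then obtain N where N: "\<And>n x. n \<ge> N \<Longrightarrow> x \<in> {0..u} \<Longrightarrow> \<bar>F n x - f x\<bar> < e / (2 * (u + 1))"
        unfolding eventually_sequentially dist_real_def by blast
      have "\<bar>F (Suc n) u - K f u\<bar> < e" if "n \<ge> N" for n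
      proof -
        have "\<bar>F (Suc n) u - K f u\<bar> \<le> integral {0..u} (\<lambda>r. \<bar>F n r - f r\<bar>)"
          using lip[OF Fcont fcont u] by (simp add: FS)
        also have "\<dots> \<le> integral {0..u} (\<lambda>r. e / (2 * (u + 1)))"
          by (rule integral_le[OF absint[OF Fcont fcont]]) (use N[OF that] in \<open>auto intro: less_imp_le\<close>)
        also have "\<dots> < e"
        proof -
          have "u * e < 2 * (u + 1) * e"
            by (rule mult_strict_right_mono) (use u e in auto)
          then show ?thesis using u e by (simp add: field_simps)
        qed
        finally show ?thesis .
      qed
      then show "\<exists>no. \<forall>n\<ge>no. norm (F (Suc n) u - K f u - 0) < e" by auto
    qed
    then show "(\<lambda>n. F (Suc n) u) \<longlonglongrightarrow> K f u"
      by (simp add: LIM_zero_iff)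
  qed
  with fcont show ?thesis by blast
qed


text \<open>After the substitution r = u - t the convolution splits at r = 1 into a known part,
  where f = 1, and an unknown one. The clamp \<open>max u 1\<close> makes the operator constant on
  [0, 1], so that division by u is harmless and the Lipschitz constant is at most 1. Continuity of
  the kernel on the half line excludes the indicator; rho is therefore constructed from its own
  delay equation.\<close>

lemma vsol_exists:
  assumes ker: "vkernel \<kappa>" and kc: "continuous_on {0..} \<kappa>"
  shows "\<exists>f. vsol \<kappa> f"
proof -
  define J where "J f v = (integral {0..1} (\<lambda>r. \<kappa> (v - r)) + integral {1..v} (\<lambda>r. f r * \<kappa> (v - r))) / v"
    for f and v :: real
  define K where "K f u = J f (max u 1)" for f u
  have k0: "\<kappa> 0 = 1" using vkernelD(3)[OF ker] by simp
  have int: "(\<lambda>r. f r * \<kappa> (v - r)) integrable_on {a..b}"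
    if "continuous_on {0..} f" "0 \<le> a" "b \<le> v" for f a b v
    by (rule integrable_continuous_real, intro continuous_intros)
       (use that in \<open>auto intro!: continuous_on_subset[OF that(1)] continuous_on_compose2[OF kc] continuous_intros\<close>)
  have Jcont: "continuous_on {1..} (J f)" if fc: "continuous_on {0..} f" for f
    unfolding J_def
  proof (intro continuous_intros)
    have "continuous_on {1..} (\<lambda>v. integral (cbox 0 1) (\<lambda>r. \<kappa> (v - r)))"
      by (rule integral_continuous_on_param)
         (auto simp: split_beta intro!: continuous_on_compose2[OF kc] continuous_intros)
    then show "continuous_on {1..} (\<lambda>v. integral {0..1} (\<lambda>r. \<kappa> (v - r)))" by simp
    show "continuous_on {1..} (\<lambda>v. integral {1..v} (\<lambda>r. f r * \<kappa> (v - r)))"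
    proof (rule continuous_on_half_line)
      fix T :: real assume T: "1 \<le> T"
      have fT: "f integrable_on {1..T}"
        by (rule integrable_continuous_real, rule continuous_on_subset[OF fc]) auto
      \<comment> \<open>The clamp \<open>max 0 (v - r)\<close> gives the integral a domain
        independent of v; on the surplus [v, T] the kernel takes the value \<kappa> 0 = 1, so the
        excess is just the integral of f there.\<close>
      have "continuous_on {1..T} (\<lambda>v. integral (cbox 1 T) (\<lambda>r. f r * \<kappa> (max 0 (v - r))))"
        by (rule integral_continuous_on_param)
           (auto simp: split_beta intro!: continuous_on_compose2[OF kc] continuous_on_compose2[OF fc] continuous_intros)
      then have "continuous_on {1..T} (\<lambda>v. integral {1..T} (\<lambda>r. f r * \<kappa> (max 0 (v - r))) - integral {v..T} f)"
        by (intro continuous_intros indefinite_integral_continuous_1'[OF fT]) simp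
      moreover have "integral {1..T} (\<lambda>r. f r * \<kappa> (max 0 (v - r))) - integral {v..T} f
          = integral {1..v} (\<lambda>r. f r * \<kappa> (v - r))" if v: "v \<in> {1..T}" for v
      proof -
        have "(\<lambda>r. f r * \<kappa> (max 0 (v - r))) integrable_on {1..T}"
          by (rule integrable_continuous_real)
             (auto intro!: continuous_intros continuous_on_subset[OF fc] continuous_on_compose2[OF kc])
        then have "integral {1..T} (\<lambda>r. f r * \<kappa> (max 0 (v - r))) =
            integral {1..v} (\<lambda>r. f r * \<kappa> (max 0 (v - r))) + integral {v..T} (\<lambda>r. f r * \<kappa> (max 0 (v - r)))"
          using v by (subst Henstock_Kurzweil_Integration.integral_combine) auto
        also have "integral {1..v} (\<lambda>r. f r * \<kappa> (max 0 (v - r))) = integral {1..v} (\<lambda>r. f r * \<kappa> (v - r))"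
          by (rule integral_cong) (auto simp: max_def)
        also have "integral {v..T} (\<lambda>r. f r * \<kappa> (max 0 (v - r))) = integral {v..T} f"
          by (rule integral_cong) (auto simp: max_def k0)
        finally show ?thesis by simp
      qed
      ultimately show "continuous_on {1..T} (\<lambda>v. integral {1..v} (\<lambda>r. f r * \<kappa> (v - r)))"
        by (rule continuous_on_eq) auto
    qed
  qed auto
  have "\<exists>f. continuous_on {0..} f \<and> (\<forall>u\<ge>0. f u = K f u)"
  proof (rule volterra_fixpoint_exists)
    fix f :: "real \<Rightarrow> real" assume "continuous_on {0..} f"
    then show "continuous_on {0..} (K f)"
      unfolding K_def[abs_def]
      by (intro continuous_on_compose2[OF Jcont]) (auto intro!: continuous_intros)
  next
    fix f g :: "real \<Rightarrow> real" and u :: real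
    assume fg: "continuous_on {0..} f" "continuous_on {0..} g" and u: "0 \<le> u"
    have absint: "(\<lambda>r. \<bar>f r - g r\<bar>) integrable_on {a..u}" if "a \<ge> 0" for a
      by (rule integrable_continuous_real)
         (intro continuous_intros; rule continuous_on_subset[of "{0..}"]; use fg that in auto)
    have I0: "0 \<le> integral {0..u} (\<lambda>r. \<bar>f r - g r\<bar>)"
      by (rule integral_nonneg[OF absint]) auto
    show "\<bar>K f u - K g u\<bar> \<le> integral {0..u} (\<lambda>r. \<bar>f r - g r\<bar>)"
    proof (cases "u \<le> 1")
      case True
      then show ?thesis using I0 by (simp add: K_def J_def)
    next
      case False
      then have "\<bar>K f u - K g u\<bar> = \<bar>integral {1..u} (\<lambda>r. f r * \<kappa> (u - r)) - integral {1..u} (\<lambda>r. g r * \<kappa> (u - r))\<bar> / u"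
        by (simp add: K_def J_def flip: diff_divide_distrib)
      also have "\<dots> \<le> \<bar>integral {1..u} (\<lambda>r. f r * \<kappa> (u - r)) - integral {1..u} (\<lambda>r. g r * \<kappa> (u - r))\<bar> / 1"
        using False by (intro divide_left_mono) auto
      also have "\<dots> = \<bar>integral {1..u} (\<lambda>r. f r * \<kappa> (u - r) - g r * \<kappa> (u - r))\<bar>"
        by (subst Henstock_Kurzweil_Integration.integral_diff) (use fg in \<open>auto intro: int\<close>)
      also have "\<dots> \<le> integral {1..u} (\<lambda>r. \<bar>f r - g r\<bar>)"
        unfolding real_norm_def[symmetric]
      proof (rule integral_norm_bound_integral)
        show "(\<lambda>r. f r * \<kappa> (u - r) - g r * \<kappa> (u - r)) integrable_on {1..u}"
          using fg by (intro Henstock_Kurzweil_Integration.integrable_diff int) auto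
        fix r
        have "\<bar>f r - g r\<bar> * \<kappa> (u - r) \<le> \<bar>f r - g r\<bar> * 1"
          by (rule mult_left_mono) (use vkernelD(2)[OF ker] in auto)
        then show "norm (f r * \<kappa> (u - r) - g r * \<kappa> (u - r)) \<le> norm (f r - g r)"
          using vkernelD(1)[OF ker] by (simp add: abs_mult flip: left_diff_distrib)
      qed (use absint[of 1] in auto)
      also have "\<dots> \<le> integral {0..u} (\<lambda>r. \<bar>f r - g r\<bar>)"
        by (rule integral_subset_le) (use absint[of 0] absint[of 1] in auto)
      finally show ?thesis .
    qed
  qed
  then obtain f where fc: "continuous_on {0..} f" and fK: "\<And>u. u \<ge> 0 \<Longrightarrow> f u = K f u" by auto
  have f1: "f u = 1" if "u \<in> {0..1}" for u
  proof -
    have "integral {0..1} (\<lambda>r. \<kappa> (1 - r)) = integral {0..1} (\<lambda>r::real. 1 :: real)"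
      by (rule integral_cong) (use vkernelD(3)[OF ker] in auto)
    then show ?thesis using fK[of u] that by (simp add: K_def J_def max_def)
  qed
  have "u * f u = integral {0..u} (\<lambda>t. f (u - t) * \<kappa> t)" if u: "1 \<le> u" for u
  proof -
    have "u * f u = integral {0..1} (\<lambda>r. \<kappa> (u - r)) + integral {1..u} (\<lambda>r. f r * \<kappa> (u - r))"
      using fK[of u] u by (simp add: K_def J_def max_def)
    also have "integral {0..1} (\<lambda>r. \<kappa> (u - r)) = integral {0..1} (\<lambda>r. f r * \<kappa> (u - r))"
      by (rule integral_cong) (simp add: f1)
    also have "\<dots> + integral {1..u} (\<lambda>r. f r * \<kappa> (u - r)) = integral {0..u} (\<lambda>r. f r * \<kappa> (u - r))"
      using u by (subst Henstock_Kurzweil_Integration.integral_combine) (auto intro: int[OF fc])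
    also have "\<dots> = integral {0..u} (\<lambda>t. f (u - t) * \<kappa> t)"
      using integral_flip[OF int[OF fc, of 0 u u]] by simp
    finally show ?thesis .
  qed
  with fc f1 have "vsol \<kappa> f" by (auto simp: vsol_def)
  then show ?thesis by blast
qed

lemma vsol_extend:
  assumes "vsol \<kappa> f"
  shows "vsol \<kappa> (\<lambda>u. if u < 0 then 0 else f u)"
proof -
  have "continuous_on {0..} (\<lambda>u. if u < 0 then 0 else f u)"
    by (rule continuous_on_eq[OF vsolD(1)[OF assms]]) auto
  moreover have "integral {0..u} (\<lambda>t. (if u - t < 0 then 0 else f (u - t)) * \<kappa> t)
      = integral {0..u} (\<lambda>t. f (u - t) * \<kappa> t)" for u
    by (rule integral_cong) auto
  ultimately show ?thesis using assms by (auto simp: vsol_def)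
qed

lemma vkernel_vsol:
  assumes ker: "vkernel \<kappa>" and sol: "vsol \<kappa> f" and neg: "\<And>u. u < 0 \<Longrightarrow> f u = 0"
  shows "vkernel f"
proof -
  have "0 \<le> f t \<and> f t \<le> 1" for t
    using vsol_bounds[OF ker sol, of t] neg[of t] by (cases "t < 0") auto
  moreover have "(\<lambda>t. g t * f t) integrable_on {0..u}" if "continuous_on {0..u} g" for g u
    by (rule integrable_continuous_real) (intro continuous_intros that vsolD(2)[OF sol])
  ultimately show ?thesis using vsolD(3)[OF sol] by (auto simp: vkernel_def)
qed

text \<open>This discontinuous kernel is the reason why \<open>vkernel\<close> asks for
  integrability against continuous functions and not for continuity.\<close>

lemma vkernel_indicator: "vkernel (indicator {0..1})"
proof -
  have "(\<lambda>t. f t * indicator {0..1} t) integrable_on {0..u}" if f: "continuous_on {0..u} f"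
    for u and f :: "real \<Rightarrow> real"
  proof -
    have "f integrable_on {0..min u 1}"
      by (rule integrable_continuous_real, rule continuous_on_subset[OF f]) auto
    moreover have "{0..u} \<inter> {0..1} = {0..min u 1}" by auto
    ultimately have "(\<lambda>t. if t \<in> {0..1} then f t else 0) integrable_on {0..u}"
      by (subst integrable_restrict_Int) (simp only: Int_commute)
    moreover have "(\<lambda>t. if t \<in> {0..1} then f t else 0) = (\<lambda>t. f t * indicator {0..1} t)"
      by (auto simp: indicator_def)
    ultimately show ?thesis by simp
  qed
  then show ?thesis by (auto simp: vkernel_def indicator_def)
qed

section \<open>The Dickman function and the sequence of solutions built on it\<close>

definition dickman_spec :: "(real \<Rightarrow> real) \<Rightarrow> bool" where
  "dickman_spec f \<longleftrightarrow> (\<forall>u<0. f u = 0) \<and> continuous_on {0..} f \<and>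
      (\<forall>u\<in>{0..1}. f u = 1) \<and>
      (\<forall>u\<ge>1. (f has_real_derivative (- f (u - 1) / u)) (at u within {1..}))"

lemma integral_has_real_derivative_half_line:
  assumes "continuous_on {a..} g" "a \<le> (x::real)"
  shows "((\<lambda>u. integral {a..u} g) has_real_derivative g x) (at x within {a..})"
proof -
  have "((\<lambda>u. integral {a..u} g) has_real_derivative g x) (at x within {a..x+1})"
    by (rule integral_has_real_derivative) (use assms in \<open>auto elim: continuous_on_subset\<close>)
  moreover have "at x within {a..} = at x within {a..x+1}"
    by (rule at_within_nhd[of _ "{..<x+1}"]) auto
  ultimately show ?thesis by simp
qed

lemma dickman_spec_exists: "\<exists>f. dickman_spec f"
proof -
  \<comment> \<open>The delay equation integrated from 1 to u, with the variable shifted by 1; the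
    clamp at 0 produces f = 1 on [0, 1].\<close>
  define K where "K f u = 1 - integral {0..max 0 (u - 1)} (\<lambda>r. f r / (r + 1))" for f :: "real \<Rightarrow> real" and u
  have cint: "continuous_on {0..} (\<lambda>r. f r / (r + 1))" if "continuous_on {0..} f" for f :: "real \<Rightarrow> real"
    by (intro continuous_intros that) auto
  have fint: "(\<lambda>r. f r / (r + 1)) integrable_on {0..u}" if "continuous_on {0..} f" for f :: "real \<Rightarrow> real" and u
    by (rule integrable_continuous_real, rule continuous_on_subset[OF cint[OF that]]) auto
  have "\<exists>f. continuous_on {0..} f \<and> (\<forall>u\<ge>0. f u = K f u)"
  proof (rule volterra_fixpoint_exists)
    fix f :: "real \<Rightarrow> real" assume f: "continuous_on {0..} f"
    have "continuous_on {0..} (\<lambda>v. integral {0..v} (\<lambda>r. f r / (r + 1)))"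
      by (rule continuous_on_half_line, rule indefinite_integral_continuous_1[OF fint[OF f]])
    then show "continuous_on {0..} (K f)"
      unfolding K_def[abs_def]
      by (intro continuous_intros) (rule continuous_on_compose2, auto intro!: continuous_intros)
  next
    fix f g :: "real \<Rightarrow> real" and u :: real
    assume fg: "continuous_on {0..} f" "continuous_on {0..} g" and u: "0 \<le> u"
    let ?v = "max 0 (u - 1)"
    have absint: "(\<lambda>r. \<bar>f r - g r\<bar>) integrable_on {0..u}" for u
      by (rule integrable_continuous_real)
         (intro continuous_intros; rule continuous_on_subset[of "{0..}"]; use fg in auto)
    have "\<bar>K f u - K g u\<bar> = \<bar>integral {0..?v} (\<lambda>r. f r / (r + 1) - g r / (r + 1))\<bar>"
      unfolding K_def by (subst Henstock_Kurzweil_Integration.integral_diff) (use fint fg in auto)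
    also have "\<dots> \<le> integral {0..?v} (\<lambda>r. \<bar>f r - g r\<bar>)"
      unfolding real_norm_def[symmetric]
    proof (rule integral_norm_bound_integral)
      fix r assume r: "r \<in> {0..?v}"
      have "\<bar>f r - g r\<bar> / (r + 1) \<le> \<bar>f r - g r\<bar> / 1"
        by (rule divide_left_mono) (use r in auto)
      then show "norm (f r / (r + 1) - g r / (r + 1)) \<le> norm (f r - g r)"
        using r by (simp flip: diff_divide_distrib)
    qed (use absint fg fint in \<open>auto intro!: Henstock_Kurzweil_Integration.integrable_diff\<close>)
    also have "\<dots> \<le> integral {0..u} (\<lambda>r. \<bar>f r - g r\<bar>)"
      by (rule integral_subset_le) (use absint u in auto)
    finally show "\<bar>K f u - K g u\<bar> \<le> integral {0..u} (\<lambda>r. \<bar>f r - g r\<bar>)" .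
  qed
  then obtain f where fc: "continuous_on {0..} f" and fK: "\<And>u. u \<ge> 0 \<Longrightarrow> f u = K f u" by auto
  define h where "h u = (if u < 0 then 0 else f u)" for u
  have "continuous_on {0..} h"
    by (rule continuous_on_eq[OF fc]) (auto simp: h_def)
  moreover have "h u = 1" if "u \<in> {0..1}" for u
    using fK[of u] that by (simp add: h_def K_def)
  moreover have "(h has_real_derivative (- h (u - 1) / u)) (at u within {1..})" if u: "u \<ge> 1" for u
  proof -
    have "((\<lambda>v. integral {0..v} (\<lambda>r. f r / (r + 1))) has_real_derivative f (u - 1) / (u - 1 + 1)) (at (u - 1) within {0..})"
      by (rule integral_has_real_derivative_half_line[OF cint[OF fc]]) (use u in auto)
    then have "((\<lambda>v. integral {0..v} (\<lambda>r. f r / (r + 1))) has_real_derivative f (u - 1) / u) (at (u - 1) within (\<lambda>x. x - 1) ` {1..})"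
      by (auto elim!: DERIV_subset)
    then have "((\<lambda>x. integral {0..x - 1} (\<lambda>r. f r / (r + 1))) has_real_derivative f (u - 1) / u * 1) (at u within {1..})"
      by (rule DERIV_image_chain[where g = "\<lambda>x. x - 1", unfolded o_def]) (auto intro!: derivative_eq_intros)
    then have "((\<lambda>x. 1 - integral {0..x - 1} (\<lambda>r. f r / (r + 1))) has_real_derivative 0 - f (u - 1) / u * 1) (at u within {1..})"
      by (intro DERIV_diff DERIV_const)
    then have "(h has_real_derivative 0 - f (u - 1) / u * 1) (at u within {1..})"
      by (rule has_field_derivative_transform_within[of _ _ _ _ 1]) (use u fK in \<open>auto simp: h_def K_def max_def\<close>)
    then show ?thesis using u by (simp add: h_def)
  qed
  ultimately have "dickman_spec h" by (auto simp: dickman_spec_def h_def)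
  then show ?thesis by blast
qed

text \<open>By the delay equation, \<open>Z u\<close>, which is u f(u) minus the integral of f over
  [u - 1, u], has derivative 0 on the half line from 1, and it vanishes at 1. The integral over the
  window is the convolution of f with the indicator of [0, 1].\<close>

lemma dickman_spec_vsol:
  assumes "dickman_spec f"
  shows "vsol (indicator {0..1}) f"
proof -
  have fc: "continuous_on {0..} f" and f1: "\<And>u. u \<in> {0..1} \<Longrightarrow> f u = 1"
    and der: "\<And>u. u \<ge> 1 \<Longrightarrow> (f has_real_derivative (- f (u - 1) / u)) (at u within {1..})"
    using assms by (auto simp: dickman_spec_def)
  define I where "I v = integral {0..v} f" for v
  define Z where "Z u = u * f u - I u + I (u - 1)" for u
  have I: "(I has_real_derivative f u) (at u within {0..})" if "u \<ge> 0" for u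
    unfolding I_def by (rule integral_has_real_derivative_half_line[OF fc that])
  have "(Z has_real_derivative 0) (at u within {1..})" if u: "u \<ge> 1" for u
  proof -
    have 1: "(I has_real_derivative f u) (at u within {1..})"
      using I[of u] u by (auto elim: DERIV_subset)
    have "(I has_real_derivative f (u - 1)) (at (u - 1) within (\<lambda>x. x - 1) ` {1..})"
      using I[of "u - 1"] u by (auto elim!: DERIV_subset)
    then have 2: "((\<lambda>x. I (x - 1)) has_real_derivative f (u - 1) * 1) (at u within {1..})"
      by (rule DERIV_image_chain[where g = "\<lambda>x. x - 1", unfolded o_def]) (auto intro!: derivative_eq_intros)
    have "((\<lambda>u. u * f u - I u + I (u - 1)) has_real_derivative
        (1 * f u + (- f (u - 1) / u) * u) - f u + f (u - 1) * 1) (at u within {1..})"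
      by (rule derivative_eq_intros 1 2 der[OF u] refl)+
    then show ?thesis using u by (simp add: Z_def[abs_def])
  qed
  then have "\<exists>c. \<forall>x\<in>{1..}. Z x = c"
    by (intro has_field_derivative_zero_constant) auto
  moreover have "Z 1 = 0"
  proof -
    have "I 1 = integral {0..1} (\<lambda>_::real. 1 :: real)" unfolding I_def by (rule integral_cong) (simp add: f1)
    then show ?thesis using f1[of 1] by (simp add: Z_def I_def)
  qed
  ultimately have Z0: "Z u = 0" if "u \<ge> 1" for u using that by auto
  have "u * f u = integral {0..u} (\<lambda>t. f (u - t) * indicator {0..1} t)" if u: "u \<ge> 1" for u
  proof -
    have int: "(\<lambda>t. f (u - t) * indicator {0..1} t) integrable_on {0..u}"
      by (rule vkernel_conv_integrable[OF vkernel_indicator, of u]) (auto intro: continuous_on_subset[OF fc])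
    have "integral {0..u} (\<lambda>t. f (u - t) * indicator {0..1} t)
        = integral {0..u} (\<lambda>r. f r * indicator {0..1} (u - r))"
      using integral_flip[OF int] by simp
    also have "\<dots> = integral {0..u} (\<lambda>r. if r \<in> {u-1..u} then f r else 0)"
      by (rule integral_cong) (auto simp: indicator_def)
    also have "\<dots> = integral {u-1..u} f"
      using u by (subst integral_restrict_Int) (simp add: Int_absorb2)
    also have "\<dots> = I u - I (u - 1)"
      unfolding I_def
      using Henstock_Kurzweil_Integration.integral_combine[of 0 "u - 1" u f] u
        integrable_continuous_real[OF continuous_on_subset[OF fc, of "{0..u}"]] by auto
    also have "\<dots> = u * f u" using Z0[OF u] by (simp add: Z_def)
    finally show ?thesis by simp
  qed
  with fc f1 show ?thesis by (auto simp: vsol_def)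
qed

text \<open>With the indicator of \<open>[0, 1]\<close> in the role of \<open>\<sigma>\<close> at level \<open>-1\<close>, the Dickman function solves the
  same integral equation as the other \<open>\<sigma>\<^sub>k\<close>.\<close>

fun sigma_kernel :: "nat \<Rightarrow> real \<Rightarrow> real" where
  "sigma_kernel 0 = indicator {0..1}"
| "sigma_kernel (Suc k) = sigma_fun k"

lemma dickman_spec_rho: "dickman_spec dickman_rho"
proof -
  obtain f where f: "dickman_spec f" using dickman_spec_exists ..
  have "dickman_spec (THE f. dickman_spec f)"
  proof (rule theI[of dickman_spec, OF f])
    fix g assume g: "dickman_spec g"
    show "g = f"
    proof
      fix u show "g u = f u"
        using vsol_unique[OF vkernel_indicator dickman_spec_vsol[OF g] dickman_spec_vsol[OF f], of u] f g
        by (cases "u < 0") (auto simp: dickman_spec_def)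
    qed
  qed
  then show ?thesis by (simp add: dickman_rho_def dickman_spec_def[abs_def])
qed

text \<open>The three facts are carried together: the next level exists because the present function
  is a kernel, and it is one because it solves the previous equation and, as \<open>vkernel\<close>
  bounds all values, vanishes at negative arguments.\<close>

lemma sigma_fun_vsol_aux:
  "vkernel (sigma_kernel k) \<and> vsol (sigma_kernel k) (sigma_fun k) \<and> (\<forall>u<0. sigma_fun k u = 0)"
proof (induction k)
  case 0
  show ?case using dickman_spec_rho dickman_spec_vsol[OF dickman_spec_rho] vkernel_indicator
    by (auto simp: dickman_spec_def)
next
  case (Suc k)
  then have ker: "vkernel (sigma_fun k)" by (auto intro: vkernel_vsol)
  have kc: "continuous_on {0..} (sigma_fun k)" using Suc by (auto simp: vsol_def)
  obtain f0 where f0: "vsol (sigma_fun k) f0" using vsol_exists[OF ker kc] ..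
  define f where "f u = (if u < 0 then 0 else f0 u)" for u
  have f: "vsol (sigma_fun k) f" "\<forall>u<0. f u = 0"
    using vsol_extend[OF f0] by (auto simp: f_def[abs_def])
  have "(THE f. (\<forall>u<0. f u = 0) \<and> vsol (sigma_fun k) f) = f"
  proof (rule the_equality)
    fix g assume g: "(\<forall>u<0. g u = 0) \<and> vsol (sigma_fun k) g"
    show "g = f"
    proof
      fix u show "g u = f u"
        using vsol_unique[OF ker _ f(1), of g u] f g by (cases "u < 0") auto
    qed
  qed (use f in auto)
  then have "sigma_fun (Suc k) = f" by (simp add: vsol_def)
  then show ?case using ker f by simp
qed

lemmas vkernel_sigma_kernel = sigma_fun_vsol_aux[THEN conjunct1]
lemmas vsol_sigma_fun = sigma_fun_vsol_aux[THEN conjunct2, THEN conjunct1]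

lemma sigma_fun_bounds: "u \<ge> 0 \<Longrightarrow> 0 \<le> sigma_fun k u" "u \<ge> 0 \<Longrightarrow> sigma_fun k u \<le> 1"
  using vsol_bounds[OF vkernel_sigma_kernel vsol_sigma_fun] by auto

lemma vkernel_sigma_fun: "vkernel (sigma_fun k)"
  using vkernel_sigma_kernel[of "Suc k"] by simp

section \<open>Growth of the functions sigma\<close>

lemma integral_exp_conv:
  "integral {0..u} (\<lambda>t. exp (K - s * (u - t)) * \<kappa> t) = exp (K - s * u) * integral {0..u} (\<lambda>t. exp (s * t) * \<kappa> t)"
  for \<kappa> :: "real \<Rightarrow> real"
proof -
  have "(\<lambda>t. exp (K - s * (u - t)) * \<kappa> t) = (\<lambda>t. exp (K - s * u) * (exp (s * t) * \<kappa> t))"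
    by (auto simp: algebra_simps simp flip: exp_add)
  then show ?thesis by simp
qed

lemma exp_kernel_integrable:
  assumes "vkernel \<kappa>" "0 \<le> a"
  shows "(\<lambda>t. exp (s * t) * \<kappa> t) integrable_on {a..u}"
proof -
  have "(\<lambda>t. exp (s * t) * \<kappa> t) integrable_on {0..u}"
    by (rule vkernelD(4)[OF assms(1)]) (intro continuous_intros)
  then show ?thesis by (rule integrable_on_subinterval) (use assms in auto)
qed

lemma vsol_le_exp:
  assumes ker: "vkernel \<kappa>" and sol: "vsol \<kappa> f" and a: "a \<ge> 1"
    and X: "\<And>u. u \<ge> a \<Longrightarrow> integral {0..u} (\<lambda>t. exp (s * t) * \<kappa> t) \<le> a"
    and init: "\<And>u. u \<in> {0..a} \<Longrightarrow> f u \<le> exp (K - s * u)" and u: "u \<ge> 0"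
  shows "f u \<le> exp (K - s * u)"
proof (rule vsol_le_super[OF ker sol, of u _ a])
  fix v assume v: "a \<le> v"
  have "integral {0..v} (\<lambda>t. exp (s * t) * \<kappa> t) \<le> v" using X[OF v] v by simp
  then show "integral {0..v} (\<lambda>t. exp (K - s * (v - t)) * \<kappa> t) \<le> v * exp (K - s * v)"
    unfolding integral_exp_conv by (subst mult.commute) (rule mult_right_mono, auto)
qed (use a init u in \<open>auto intro!: continuous_intros\<close>)

lemma vsol_ge_exp:
  assumes ker: "vkernel \<kappa>" and sol: "vsol \<kappa> f" and s: "s \<ge> 0"
    and X: "\<And>v. 1 \<le> v \<Longrightarrow> v \<le> V \<Longrightarrow> v \<le> integral {0..v} (\<lambda>t. exp (s * t) * \<kappa> t)"
    and u: "u \<in> {0..V}"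
  shows "exp (- s * u) \<le> f u"
proof -
  have "exp (0 - s * u) \<le> f u"
  proof (rule vsol_ge_sub[OF ker sol, of V "\<lambda>u. exp (0 - s * u)" 1])
    fix v assume v: "1 \<le> v" "v \<le> V"
    then show "v * exp (0 - s * v) \<le> integral {0..v} (\<lambda>t. exp (0 - s * (v - t)) * \<kappa> t)"
      unfolding integral_exp_conv by (subst mult.commute) (rule mult_left_mono, auto intro: X)
  qed (use s u vsolD(3)[OF sol] in \<open>auto intro!: continuous_intros mult_nonneg_nonneg\<close>)
  then show ?thesis by simp
qed

lemma exp_kernel_integral_mono:
  assumes ker: "vkernel \<kappa>" and "0 \<le> a" "a \<le> b" "b \<le> v"
  shows "integral {a..b} (\<lambda>t. exp (s * t) * \<kappa> t) \<le> integral {0..v} (\<lambda>t. exp (s * t) * \<kappa> t)"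
  by (rule integral_subset_le) (use assms exp_kernel_integrable[OF ker] vkernelD(1)[OF ker] in auto)

lemma exp_kernel_integral_01:
  assumes ker: "vkernel \<kappa>" and "s \<noteq> 0"
  shows "integral {0..1} (\<lambda>t. exp (s * t) * \<kappa> t) = (exp s - 1) / s"
proof -
  have "integral {0..1} (\<lambda>t. exp (s * t) * \<kappa> t) = integral {0..1} (\<lambda>t. exp (s * t))"
    by (rule integral_cong) (use vkernelD(3)[OF ker] in auto)
  then show ?thesis using has_integral_exp_scaled[OF \<open>s \<noteq> 0\<close>, of 1] by (simp add: integral_unique)
qed

lemma exp_kernel_integral_ge:
  assumes ker: "vkernel \<kappa>" and "s \<noteq> 0" "v \<ge> 1"
  shows "(exp s - 1) / s \<le> integral {0..v} (\<lambda>t. exp (s * t) * \<kappa> t)"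
  using exp_kernel_integral_mono[OF ker, of 0 1 v s] exp_kernel_integral_01[OF ker \<open>s \<noteq> 0\<close>] assms by simp

lemma exp_indicator_integral:
  fixes v :: real
  assumes "s \<noteq> 0" "v \<ge> 1"
  shows "integral {0..v} (\<lambda>t. exp (s * t) * indicator {0..1} t) = (exp s - 1) / s"
proof -
  have "integral {0..v} (\<lambda>t. exp (s * t) * indicator {0..1} t) = integral {0..v} (\<lambda>t. if t \<in> {0..1} then exp (s * t) else 0)"
    by (rule integral_cong) (auto simp: indicator_def)
  also have "\<dots> = integral {0..1} (\<lambda>t. exp (s * t))"
  proof -
    have "{0..1} \<inter> {0..v} = {0..1::real}" using assms by auto
    then show ?thesis by (simp only: integral_restrict_Int)
  qed
  finally show ?thesis using has_integral_exp_scaled[OF \<open>s \<noteq> 0\<close>, of 1] by (simp add: integral_unique)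
qed

lemma vsol_pos:
  assumes ker: "vkernel \<kappa>" and sol: "vsol \<kappa> f" and u: "u \<ge> 0"
  shows "f u > 0"
proof -
  \<comment> \<open>By the quadratic Taylor bound (exp s - 1) / s \<ge> s / 2 \<ge> u, so the
    exponential lower bound is valid up to u.\<close>
  define s where "s = 2 * max 1 u"
  have s: "s > 0" by (simp add: s_def)
  have "exp s - 1 \<ge> s * (s / 2)"
    using exp_lower_Taylor_quadratic[of s] s by (simp add: power2_eq_square)
  then have "u \<le> (exp s - 1) / s"
    using s by (simp add: field_simps s_def)
  then have "exp (- s * u) \<le> f u"
    using exp_kernel_integral_ge[OF ker, of s] s u
    by (intro vsol_ge_exp[OF ker sol, of s u]) fastforce+
  then show ?thesis using exp_gt_zero[of "- s * u"] by linarith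
qed

section \<open>Exponential bounds for the Dickman function\<close>

abbreviation "expX s \<equiv> (exp s - 1) / (s :: real)"

lemma expX_mono:
  assumes "0 < s" "s \<le> s'"
  shows "expX s \<le> expX s'"
proof -
  have "((\<lambda>t. exp (s * t)) has_integral expX s) {0..1}" "((\<lambda>t. exp (s' * t)) has_integral expX s') {0..1}"
    using has_integral_exp_scaled[of s 1] has_integral_exp_scaled[of s' 1] assms by auto
  then show ?thesis
    by (rule has_integral_le) (use assms in \<open>auto intro: mult_right_mono\<close>)
qed

lemma expX_ge_1: "s > 0 \<Longrightarrow> expX s \<ge> 1"
  using exp_ge_add_one_self[of s] by (simp add: field_simps)

text \<open>Up to \<open>expX s\<close> the bound exceeds 1, beyond it the exponential is a
  supersolution. The constant s \<open>expX s\<close> = exp s - 1 is too large by a factor of about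
  s; moving s in small steps recovers this factor.\<close>

lemma rho_le_exp_base:
  assumes "s > 0" "u \<ge> 0"
  shows "dickman_rho u \<le> exp (s * expX s - s * u)"
proof (rule vsol_le_exp[OF vkernel_indicator dickman_spec_vsol[OF dickman_spec_rho], of "expX s"])
  fix u assume "u \<ge> expX s"
  then show "integral {0..u} (\<lambda>t. exp (s * t) * indicator {0..1} t) \<le> expX s"
    using exp_indicator_integral[of s u] expX_ge_1[of s] assms by linarith
next
  fix u assume u: "u \<in> {0..expX s}"
  have "dickman_rho u \<le> 1" using sigma_fun_bounds(2)[of u 0] u by simp
  also have "s * u \<le> s * expX s" using u assms by (intro mult_left_mono) auto
  then have "1 \<le> exp (s * expX s - s * u)" by simp
  finally show "dickman_rho u \<le> exp (s * expX s - s * u)" .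
qed (use assms expX_ge_1[of s] in auto)

text \<open>Envelope argument: \<open>\<rho>(u) exp(s u)\<close> is maximal at some \<open>u \<le> expX s\<close>, so the logarithm of its maximum
  grows in \<open>s\<close> at rate at most \<open>expX s\<close>, and it is therefore \<open>\<le> (1 + o(1)) exp(s) / s\<close>.\<close>

lemma rho_le_exp_step:
  assumes "s > 0" "h \<ge> 0" and IH: "\<And>u. u \<ge> 0 \<Longrightarrow> dickman_rho u \<le> exp (K - s * u)" and "u \<ge> 0"
  shows "dickman_rho u \<le> exp (K + h * expX (s + h) - (s + h) * u)"
proof (rule vsol_le_exp[OF vkernel_indicator dickman_spec_vsol[OF dickman_spec_rho], of "expX (s + h)"])
  fix u assume "u \<ge> expX (s + h)"
  then show "integral {0..u} (\<lambda>t. exp ((s + h) * t) * indicator {0..1} t) \<le> expX (s + h)"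
    using exp_indicator_integral[of "s + h" u] expX_ge_1[of "s + h"] assms by linarith
next
  fix u assume u: "u \<in> {0..expX (s + h)}"
  have "dickman_rho u \<le> exp (K - s * u)" using IH u by simp
  also have "h * u \<le> h * expX (s + h)" using u assms by (intro mult_left_mono) auto
  then have "exp (K - s * u) \<le> exp (K + h * expX (s + h) - (s + h) * u)" by (simp add: algebra_simps)
  finally show "dickman_rho u \<le> exp (K + h * expX (s + h) - (s + h) * u)" .
qed (use assms expX_ge_1[of "s + h"] in auto)

text \<open>The base has to cover a whole interval of length h, since steps from s0 alone do not
  reach every s.\<close>

lemma half_line_step_induct:
  fixes h :: real
  assumes "h > 0" and base: "\<And>s. s0 \<le> s \<Longrightarrow> s \<le> s0 + h \<Longrightarrow> P s"
    and step: "\<And>s. s0 \<le> s \<Longrightarrow> P s \<Longrightarrow> P (s + h)" and "s0 \<le> s"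
  shows "P s"
proof -
  have *: "P (s0 + r + real n * h)" if "0 \<le> r" "r \<le> h" for r n
  proof (induction n)
    case 0
    then show ?case using base that by simp
  next
    case (Suc n)
    have "P (s0 + r + real n * h + h)"
      by (rule step[OF _ Suc]) (use that assms in auto)
    then show ?case by (simp add: algebra_simps)
  qed
  define n where "n = nat \<lfloor>(s - s0) / h\<rfloor>"
  have n: "real n = of_int \<lfloor>(s - s0) / h\<rfloor>" using assms by (simp add: n_def)
  have "real n \<le> (s - s0) / h" "(s - s0) / h \<le> real n + 1" unfolding n by linarith+
  then have "real n * h \<le> s - s0" "s - s0 \<le> (real n + 1) * h" using \<open>h > 0\<close> by (simp_all add: field_simps)
  then have "P (s0 + (s - s0 - real n * h) + real n * h)"
    by (intro *) (auto simp: algebra_simps)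
  then show ?thesis by simp
qed

lemma filterlim_exp_div_self: "filterlim (\<lambda>s::real. exp s / s) at_top at_top"
  by real_asymp

lemma rho_le_exp:
  assumes eps: "\<epsilon> > 0"
  shows "\<forall>\<^sub>F s in at_top. \<forall>u\<ge>0. dickman_rho u \<le> exp ((1 + \<epsilon>) * (exp s / s) - s * u)"
proof -
  define e where "e = min 1 (\<epsilon> / 2)"
  define h where "h = e / 2"
  have e: "0 < e" "e \<le> 1" "e \<le> \<epsilon> / 2" and h: "h > 0" using eps by (auto simp: e_def h_def)
  \<comment> \<open>In units of exp(s + h) / (s + h) the main term of \<open>K\<close> grows over
    one step by (1 + e) (1 - exp(-h) (s + h) / s), while the envelope step costs at most h.
    \<open>g\<close> is the margin for s tending to infinity, and \<open>s0\<close> makes the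
    remaining correction of order h / s smaller than it.\<close>
  define g where "g = (1 + e) * (1 - exp (- h)) - h"
  have "1 \<le> (1 - h + h\<^sup>2 / 2) * (1 + h + h\<^sup>2 / 2)"
    using h by (simp add: algebra_simps power2_eq_square)
  also have "\<dots> \<le> (1 - h + h\<^sup>2 / 2) * exp h"
    using exp_lower_Taylor_quadratic[of h] h e
    by (intro mult_left_mono) (auto simp: h_def)
  finally have "exp (- h) \<le> 1 - h + h\<^sup>2 / 2"
    by (simp add: exp_minus field_simps)
  then have "(1 + e) * (h - h\<^sup>2 / 2) \<le> (1 + e) * (1 - exp (- h))"
    using e by (intro mult_left_mono) auto
  moreover have "(1 + e) * (h - h\<^sup>2 / 2) = h + h * (3 / 4 * e - e\<^sup>2 / 4)"
    by (simp add: h_def power2_eq_square field_simps)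
  moreover have "e\<^sup>2 \<le> e * 1" unfolding power2_eq_square using e by (intro mult_left_mono) auto
  then have "0 < h * (3 / 4 * e - e\<^sup>2 / 4)" using h e by (intro mult_pos_pos) auto
  ultimately have g: "g > 0" by (simp add: g_def)
  define s0 where "s0 = max 1 ((1 + e) * h / g)"
  have s0: "s0 \<ge> 1" "(1 + e) * h / g \<le> s0" by (auto simp: s0_def)
  \<comment> \<open>\<open>C\<close> makes the base case trivial, as s \<open>expX s\<close> \<le>
    exp s \<le> C on the first interval; being constant, it is absorbed by exp s / s in the
    end.\<close>
  define C where "C = exp (s0 + h)"
  define K where "K s = (1 + e) * (exp s / s) + C" for s
  have main: "\<forall>u\<ge>0. dickman_rho u \<le> exp (K s - s * u)" if "s0 \<le> s" for s
  proof (rule half_line_step_induct[OF h _ _ that])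
    fix s assume s: "s0 \<le> s" "s \<le> s0 + h"
    have "s * expX s \<le> exp s" using s s0 by simp
    also have "\<dots> \<le> C" using s by (simp add: C_def)
    also have "\<dots> \<le> K s" using s s0 e by (simp add: K_def)
    finally have "exp (s * expX s - s * u) \<le> exp (K s - s * u)" for u by simp
    then show "\<forall>u\<ge>0. dickman_rho u \<le> exp (K s - s * u)"
      using rho_le_exp_base[of s] s s0 order_trans by (smt (verit))
  next
    fix s assume s: "s0 \<le> s" and IH: "\<forall>u\<ge>0. dickman_rho u \<le> exp (K s - s * u)"
    have s1: "s \<ge> 1" using s s0 by simp
    have "(1 + e) * h / g \<le> s" using s s0 by linarith
    then have "(1 + e) * h \<le> g * s" using g by (simp add: field_simps)
    moreover have "exp (- h) * ((1 + e) * h) \<le> 1 * ((1 + e) * h)"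
      using h e by (intro mult_right_mono) auto
    ultimately have "exp (- h) * ((1 + e) * h) \<le> g * s" by simp
    then have "h * s \<le> (1 + e) * (s - exp (- h) * (s + h))"
      by (simp add: g_def algebra_simps)
    then have "h \<le> (1 + e) * (s - exp (- h) * (s + h)) / s"
      using s1 by (simp add: field_simps)
    then have "h * (exp (s + h) / (s + h)) \<le> (1 + e) * (s - exp (- h) * (s + h)) / s * (exp (s + h) / (s + h))"
      using s1 h by (intro mult_right_mono) auto
    also have "\<dots> = (1 + e) * (exp (s + h) / (s + h)) - (1 + e) * (exp s / s)"
    proof -
      have "(1 + e) * (s - c * t) / s * (a / t) = (1 + e) * (a / t) - (1 + e) * (c * a / s)"
        if "t \<noteq> 0" for a c t using that s1 by (simp add: field_simps)
      from this[of "s + h" "exp (- h)" "exp (s + h)"] show ?thesis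
        using s1 h by (simp flip: exp_add)
    qed
    finally have "h * (exp (s + h) / (s + h)) \<le> K (s + h) - K s" by (simp add: K_def)
    moreover have "h * expX (s + h) \<le> h * (exp (s + h) / (s + h))"
      using h s1 by (intro mult_left_mono divide_right_mono) auto
    ultimately have le: "K s + h * expX (s + h) \<le> K (s + h)" by simp
    show "\<forall>u\<ge>0. dickman_rho u \<le> exp (K (s + h) - (s + h) * u)"
    proof (intro allI impI)
      fix u :: real assume "u \<ge> 0"
      then have "dickman_rho u \<le> exp (K s + h * expX (s + h) - (s + h) * u)"
        using IH s1 h by (intro rho_le_exp_step) auto
      also have "\<dots> \<le> exp (K (s + h) - (s + h) * u)" using le by simp
      finally show "dickman_rho u \<le> exp (K (s + h) - (s + h) * u)" .
    qed
  qed
  have "\<forall>\<^sub>F s in at_top. exp s / s \<ge> C / e"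
    using filterlim_exp_div_self by (simp add: filterlim_at_top)
  then show ?thesis
    using eventually_ge_at_top[of s0]
  proof eventually_elim
    case (elim s)
    have "C \<le> e * (exp s / s)" using elim e by (simp add: pos_divide_le_eq mult.commute)
    then have "K s \<le> (1 + 2 * e) * (exp s / s)" unfolding K_def by argo
    also have "\<dots> \<le> (1 + \<epsilon>) * (exp s / s)"
      using elim e s0 by (intro mult_right_mono) auto
    finally have "exp (K s - s * u) \<le> exp ((1 + \<epsilon>) * (exp s / s) - s * u)" for u by simp
    then show ?case using main[OF elim(2)] order_trans by (smt (verit))
  qed
qed

text \<open>The surplus d in the decay of \<open>sigma_fun k\<close> makes the integral of
  \<open>exp (s * t) * sigma_fun k t\<close> converge, with value at most exp K / d. From this point
  on the trial function is a supersolution; before it the trivial bound 1 determines the new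
  constant.\<close>

lemma sigma_le_exp_Suc:
  assumes UB: "\<And>t. t \<ge> 0 \<Longrightarrow> sigma_fun k t \<le> exp (K - (s + d) * t)" and "d > 0" "s > 0" "exp K / d \<ge> 1" "u \<ge> 0"
  shows "sigma_fun (Suc k) u \<le> exp (s * (exp K / d) - s * u)"
proof (rule vsol_le_exp[OF vkernel_sigma_fun _ assms(4)])
  show "vsol (sigma_fun k) (sigma_fun (Suc k))" using vsol_sigma_fun[of "Suc k"] by simp
  fix v assume "v \<ge> exp K / d"
  then have v: "v \<ge> 0" using assms by linarith
  have "((\<lambda>t. exp K * exp (- d * t)) has_integral exp K * ((exp (- d * v) - 1) / (- d))) {0..v}"
    by (intro has_integral_mult_right has_integral_exp_scaled) (use assms v in auto)
  from _ this have "integral {0..v} (\<lambda>t. exp (s * t) * sigma_fun k t) \<le> exp K * ((exp (- d * v) - 1) / (- d))"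
  proof (rule has_integral_le)
    show "((\<lambda>t. exp (s * t) * sigma_fun k t) has_integral integral {0..v} (\<lambda>t. exp (s * t) * sigma_fun k t)) {0..v}"
      by (rule integrable_integral[OF exp_kernel_integrable[OF vkernel_sigma_fun]]) simp
    fix t assume "t \<in> {0..v}"
    then have "exp (s * t) * sigma_fun k t \<le> exp (s * t) * exp (K - (s + d) * t)"
      by (intro mult_left_mono UB) auto
    also have "\<dots> = exp K * exp (- d * t)" by (simp add: algebra_simps flip: exp_add)
    finally show "exp (s * t) * sigma_fun k t \<le> exp K * exp (- d * t)" .
  qed
  also have "\<dots> \<le> exp K / d" using \<open>d > 0\<close> by (simp add: field_simps)
  finally show "integral {0..v} (\<lambda>t. exp (s * t) * sigma_fun k t) \<le> exp K / d" .
next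
  fix u assume u: "u \<in> {0..exp K / d}"
  have "sigma_fun (Suc k) u \<le> 1" using sigma_fun_bounds(2)[of u "Suc k"] u by simp
  also have "s * u \<le> s * (exp K / d)" using u assms by (intro mult_left_mono) auto
  then have "1 \<le> exp (s * (exp K / d) - s * u)" by simp
  finally show "sigma_fun (Suc k) u \<le> exp (s * (exp K / d) - s * u)" .
qed (use assms in auto)

abbreviation "iter_exp k \<equiv> (exp ^^ k :: real \<Rightarrow> real)"

lemma iter_exp_mono: "x \<le> y \<Longrightarrow> iter_exp k x \<le> iter_exp k y"
  by (induction k) auto

lemma iter_exp_ge_1: "1 \<le> x \<Longrightarrow> 1 \<le> iter_exp k x"
proof (induction k)
  case (Suc k)
  then show ?case using exp_ge_add_one_self[of "iter_exp k x"] by simp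
qed simp

text \<open>A factor M enters an exponential as the summand ln M, and ln M \<le> (M - 1)
  \<open>iter_exp k x\<close> makes it a factor again.\<close>

lemma mult_iter_exp_le: "1 \<le> M \<Longrightarrow> 1 \<le> x \<Longrightarrow> M * iter_exp k x \<le> iter_exp k (M * x)"
proof (induction k)
  case (Suc k)
  have "ln M \<le> (M - 1) * 1" using ln_le_minus_one[of M] Suc.prems by simp
  also have "\<dots> \<le> (M - 1) * iter_exp k x" using Suc.prems iter_exp_ge_1[of x k] by (intro mult_left_mono) auto
  finally have "ln M + iter_exp k x \<le> M * iter_exp k x" by (simp add: algebra_simps)
  also have "\<dots> \<le> iter_exp k (M * x)" using Suc by simp
  finally have "exp (ln M + iter_exp k x) \<le> exp (iter_exp k (M * x))" by simp
  then show ?case using Suc.prems by (simp add: exp_add)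
qed simp

text \<open>Under at least one exponential a factor M costs only ln M in the innermost argument. In
  the applications ln M is below a small multiple of exp s / s.\<close>

lemma mult_iter_exp_le_add:
  assumes "1 \<le> M" "M \<le> exp w" "0 \<le> z"
  shows "M * iter_exp (Suc k) z \<le> iter_exp (Suc k) (z + w)"
proof -
  have "M * iter_exp (Suc k) z = M * iter_exp k (exp z)" by (simp add: funpow_swap1)
  also have "\<dots> \<le> iter_exp k (M * exp z)" using assms by (intro mult_iter_exp_le) auto
  also have "\<dots> \<le> iter_exp k (exp (z + w))"
    using assms by (intro iter_exp_mono) (simp add: exp_add mult.commute)
  finally show ?thesis by (simp add: funpow_swap1)
qed

lemma sigma_le_iter_exp:
  assumes "\<epsilon> > 0"
  shows "\<forall>\<^sub>F s in at_top. \<forall>u\<ge>0. sigma_fun k u \<le> exp (iter_exp k ((1 + \<epsilon>) * (exp s / s)) - s * u)"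
  using assms
proof (induction k arbitrary: \<epsilon>)
  case 0
  then show ?case using rho_le_exp by simp
next
  case (Suc k)
  define e where "e = \<epsilon> / 2"
  have e: "e > 0" using Suc.prems by (simp add: e_def)
  define e1 where "e1 = e / 2"
  \<comment> \<open>One half of \<epsilon> covers the evaluation at s + d instead of s, through (1 +
    e1) exp d \<le> 1 + e; the other half covers the factor s / d, which is eventually below exp(e
    exp(s) / s).\<close>
  define d where "d = min 1 (ln ((1 + e) / (1 + e1)))"
  have e1: "e1 > 0" using e by (simp add: e1_def)
  have d: "d > 0" "d \<le> 1" using e by (auto simp: d_def e1_def)
  have "exp d \<le> exp (ln ((1 + e) / (1 + e1)))" by (simp add: d_def)
  then have d3: "(1 + e1) * exp d \<le> 1 + e" using e e1 by (simp add: field_simps)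
  have "filterlim (\<lambda>s::real. s + d) at_top at_top" by real_asymp
  with Suc.IH[OF e1] have ev: "\<forall>\<^sub>F s in at_top. \<forall>u\<ge>0. sigma_fun k u \<le>
      exp (iter_exp k ((1 + e1) * (exp (s + d) / (s + d))) - (s + d) * u)"
    by (rule eventually_compose_filterlim)
  have "\<forall>\<^sub>F s in at_top. s / d \<le> exp (e * (exp s / s))" using e d by real_asymp
  with ev show ?case using eventually_ge_at_top[of 1]
  proof eventually_elim
    case (elim s)
    define b where "b = exp s / s"
    have b: "b \<ge> 0" using elim by (simp add: b_def)
    define a where "a = (1 + e1) * (exp (s + d) / (s + d))"
    have a0: "a \<ge> 0" using elim d e1 by (simp add: a_def)
    have "a = (1 + e1) * exp d * (exp s / (s + d))" by (simp add: a_def exp_add)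
    also have "\<dots> \<le> (1 + e) * b"
      unfolding b_def using d3 d elim e e1 by (intro mult_mono divide_left_mono) auto
    finally have ab: "a \<le> (1 + e) * b" .
    have pos: "exp (iter_exp k a) / d \<ge> 1"
    proof -
      have "exp (iter_exp k a) = iter_exp k (exp a)" by (simp add: funpow_swap1)
      also have "\<dots> \<ge> 1" using a0 by (intro iter_exp_ge_1) auto
      finally have "1 \<le> exp (iter_exp k a)" .
      with d show ?thesis by (intro le_divide_eq_1[THEN iffD2] disjI1) linarith
    qed
    show ?case
    proof (intro allI impI)
      fix u :: real assume u: "u \<ge> 0"
      have "sigma_fun (Suc k) u \<le> exp (s * (exp (iter_exp k a) / d) - s * u)"
        by (rule sigma_le_exp_Suc[OF _ d(1) _ pos u]) (use elim in \<open>auto simp: a_def\<close>)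
      also have "s * (exp (iter_exp k a) / d) = (s / d) * iter_exp (Suc k) a" by simp
      also have "(s / d) * iter_exp (Suc k) a \<le> iter_exp (Suc k) (a + e * b)"
        by (rule mult_iter_exp_le_add) (use elim d a0 in \<open>auto simp: field_simps b_def\<close>)
      also have "\<dots> \<le> iter_exp (Suc k) ((1 + \<epsilon>) * b)"
        using ab b by (intro iter_exp_mono) (simp add: e_def algebra_simps)
      finally show "sigma_fun (Suc k) u \<le> exp (iter_exp (Suc k) ((1 + \<epsilon>) * (exp s / s)) - s * u)"
        by (simp add: b_def)
    qed
  qed
qed


text \<open>The indicator kernel reaches back one unit only, so a lower bound on a window of length
  one propagates to the right while the exponential stays a subsolution, that is up to
  \<open>expX s\<close>. To the left of the window the trial function is cut down to rho, which
  keeps it continuous and is never seen from v \<ge> a.\<close>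

lemma rho_window_extend:
  assumes "a \<ge> 1" "s > 0" "T \<le> expX s"
    and init: "\<And>u. u \<in> {a - 1..a} \<Longrightarrow> exp (K - s * u) \<le> dickman_rho u"
    and u: "u \<in> {a - 1..T}"
  shows "exp (K - s * u) \<le> dickman_rho u"
proof (cases "u \<le> a")
  case True
  then show ?thesis using u init by auto
next
  case False
  define g where "g v = (if v \<le> a then min (dickman_rho v) (exp (K - s * v)) else exp (K - s * v))" for v
  have rc: "continuous_on {0..a} dickman_rho"
    by (rule vsolD(2)[OF dickman_spec_vsol[OF dickman_spec_rho]])
  have g_eq: "g v = exp (K - s * v)" if "a - 1 \<le> v" for v
    using init[of v] that by (auto simp: g_def min_def)
  have "continuous_on ({0..a} \<union> {a..T}) g"
    unfolding g_def
    by (rule continuous_on_cases) (use init[of a] in \<open>auto intro!: continuous_intros rc\<close>)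
  moreover have "{0..a} \<union> {a..T} = {0..T}" using assms False u by auto
  ultimately have gc: "continuous_on {0..T} g" by simp
  have "g u \<le> dickman_rho u"
  proof (rule vsol_ge_sub[OF vkernel_indicator dickman_spec_vsol[OF dickman_spec_rho] gc \<open>a \<ge> 1\<close>])
    fix v assume v: "a \<le> v" "v \<le> T"
    have "integral {0..v} (\<lambda>t. g (v - t) * indicator {0..1} t) = integral {0..v} (\<lambda>t. exp (K - s * (v - t)) * indicator {0..1} t)"
      by (rule integral_cong) (use v in \<open>auto simp: indicator_def g_eq\<close>)
    also have "\<dots> = exp (K - s * v) * expX s"
      using exp_indicator_integral[of s v] assms v by (simp add: integral_exp_conv)
    finally have "integral {0..v} (\<lambda>t. g (v - t) * indicator {0..1} t) = exp (K - s * v) * expX s" .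
    moreover have "v * exp (K - s * v) \<le> expX s * exp (K - s * v)"
      by (rule mult_right_mono) (use v assms in auto)
    ultimately show "v * g v \<le> integral {0..v} (\<lambda>t. g (v - t) * indicator {0..1} t)"
      using g_eq[of v] v by (simp add: mult.commute)
  qed (use assms u in \<open>auto simp: g_def\<close>)
  then show ?thesis using g_eq u by simp
qed

lemma rho_ge_exp_base:
  assumes "s > 0" "u \<in> {0..expX s}"
  shows "exp (- s * u) \<le> dickman_rho u"
  by (rule vsol_ge_exp[OF vkernel_indicator dickman_spec_vsol[OF dickman_spec_rho] _ _ assms(2)])
     (use assms exp_indicator_integral[of s] in auto)

text \<open>With a large constant the bound exceeds 1 at small u, so it is claimed only on the
  window of length one that ends at \<open>expX s\<close>. Passing from s to s + h gains h u \<ge> h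
  (\<open>expX s\<close> - 1) there; afterwards the window is moved up to
  \<open>expX (s + h)\<close>.\<close>

lemma rho_ge_exp:
  assumes eps: "0 < \<epsilon>" "\<epsilon> < 1"
  shows "\<forall>\<^sub>F s in at_top. \<forall>u\<in>{expX s - 1..expX s}. exp ((1 - \<epsilon>) * (exp s / s) - s * u) \<le> dickman_rho u"
proof -
  define e where "e = \<epsilon> / 2"
  have e: "0 < e" "e < 1" using eps by (auto simp: e_def)
  define h where "h = e"
  have h: "h > 0" "h \<le> 1" using e by (auto simp: h_def)
  \<comment> \<open>In units of exp s / s one step gains h, while the main term of \<open>K\<close>
    grows by at most (1 - e) (exp h - 1); \<open>g\<close> is the difference. The requirement exp s
    / s \<ge> 2 h / g pays for the terms -1 and -1/s in \<open>expX s - 1\<close>.\<close>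
  define g where "g = h - (1 - e) * (exp h - 1)"
  have "exp h \<le> 1 + h + h\<^sup>2" using exp_bound[of h] h by simp
  then have "(1 - e) * (exp h - 1) \<le> (1 - e) * (h + h\<^sup>2)" using e by (intro mult_left_mono) auto
  also have "\<dots> = h * (1 - h\<^sup>2)" by (simp add: h_def power2_eq_square algebra_simps)
  also have "\<dots> < h * 1" using h by (intro mult_strict_left_mono) auto
  finally have g: "g > 0" by (simp add: g_def)
  have "\<forall>\<^sub>F s in at_top. exp s / s \<ge> 2 * h / g"
    using filterlim_exp_div_self by (simp add: filterlim_at_top)
  then obtain s1 where s1: "\<And>s. s \<ge> s1 \<Longrightarrow> exp s / s \<ge> 2 * h / g"
    by (auto simp: eventually_at_top_linorder)
  define s0 where "s0 = max 1 s1"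
  have s0: "s0 \<ge> 1" "s1 \<le> s0" by (auto simp: s0_def)
  define C where "C = exp (s0 + h)"
  define K where "K s = (1 - e) * (exp s / s) - C" for s
  have main: "\<forall>u\<in>{expX s - 1..expX s}. exp (K s - s * u) \<le> dickman_rho u" if "s0 \<le> s" for s
  proof (rule half_line_step_induct[OF h(1) _ _ that])
    fix s assume s: "s0 \<le> s" "s \<le> s0 + h"
    have "(1 - e) * (exp s / s) \<le> 1 * (exp s / 1)"
      using s s0 e by (intro mult_mono divide_left_mono) auto
    also have "\<dots> \<le> C" using s by (simp add: C_def)
    finally have K: "K s \<le> 0" by (simp add: K_def)
    show "\<forall>u\<in>{expX s - 1..expX s}. exp (K s - s * u) \<le> dickman_rho u"
    proof
      fix u assume u: "u \<in> {expX s - 1..expX s}"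
      have "exp (K s - s * u) \<le> exp (- s * u)" using K by simp
      also have "\<dots> \<le> dickman_rho u"
      proof (rule rho_ge_exp_base)
        have "expX s \<ge> 1" using s s0 by (intro expX_ge_1) auto
        with u show "u \<in> {0..expX s}" unfolding atLeastAtMost_iff by linarith
      qed (use s s0 in auto)
      finally show "exp (K s - s * u) \<le> dickman_rho u" .
    qed
  next
    fix s assume s: "s0 \<le> s" and IH: "\<forall>u\<in>{expX s - 1..expX s}. exp (K s - s * u) \<le> dickman_rho u"
    have sge1: "s \<ge> 1" using s s0 by simp
    have "exp (s + h) / (s + h) \<le> exp (s + h) / s"
      using sge1 h by (intro divide_left_mono) auto
    then have "(1 - e) * (exp (s + h) / (s + h)) \<le> (1 - e) * (exp (s + h) / s)"
      using e by (intro mult_left_mono) auto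
    also have "exp (s + h) / s = exp h * (exp s / s)" by (simp add: exp_add)
    finally have "K (s + h) - K s \<le> (1 - e) * (exp h - 1) * (exp s / s)"
      unfolding K_def by argo
    also have "\<dots> = (h - g) * (exp s / s)" by (simp add: g_def)
    also have "g * (exp s / s) \<ge> 2 * h" using s1[of s] s s0 g by (simp add: field_simps)
    then have "(h - g) * (exp s / s) \<le> h * (exp s / s) - 2 * h" by argo
    also have "\<dots> \<le> h * (exp s / s) - h * (1 / s) - h"
      using mult_left_mono[of "1 / s" 1 h] sge1 h by simp
    also have "\<dots> = h * (expX s - 1)" by (simp add: algebra_simps diff_divide_distrib)
    finally have le: "K (s + h) \<le> K s + h * (expX s - 1)" by simp
    have mono: "expX s \<le> expX (s + h)" using sge1 h by (intro expX_mono) auto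
    show "\<forall>u\<in>{expX (s + h) - 1..expX (s + h)}. exp (K (s + h) - (s + h) * u) \<le> dickman_rho u"
    proof
      fix u assume u: "u \<in> {expX (s + h) - 1..expX (s + h)}"
      show "exp (K (s + h) - (s + h) * u) \<le> dickman_rho u"
      proof (rule rho_window_extend[of "expX s" "s + h" "expX (s + h)"])
        fix v assume v: "v \<in> {expX s - 1..expX s}"
        have "h * (expX s - 1) \<le> h * v" using v h by (intro mult_left_mono) auto
        with le have "exp (K (s + h) - (s + h) * v) \<le> exp (K s - s * v)" by (simp add: algebra_simps)
        also have "\<dots> \<le> dickman_rho v" using IH v by blast
        finally show "exp (K (s + h) - (s + h) * v) \<le> dickman_rho v" .
      qed (use u mono sge1 h expX_ge_1[of s] in auto)
    qed
  qed
  have "\<forall>\<^sub>F s in at_top. exp s / s \<ge> C / e"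
    using filterlim_exp_div_self by (simp add: filterlim_at_top)
  then show ?thesis
    using eventually_ge_at_top[of s0]
  proof eventually_elim
    case (elim s)
    have "C \<le> e * (exp s / s)" using elim e by (simp add: pos_divide_le_eq mult.commute)
    then have "(1 - \<epsilon>) * (exp s / s) \<le> K s" unfolding K_def e_def by argo
    then have "exp ((1 - \<epsilon>) * (exp s / s) - s * u) \<le> exp (K s - s * u)" for u by simp
    then show ?case using main[OF elim(2)] order_trans by blast
  qed
qed

text \<open>On the window of \<open>rho_ge_exp\<close>, which has length one,
  \<open>exp (s * t) * dickman_rho t\<close> is at least V, so the integral is at least V as soon as
  it covers the window. For smaller v the part of the integral over [0, 1], which is
  \<open>expX s\<close>, already suffices.\<close>

lemma sigma_ge_exp_1:
  assumes eps: "0 < \<epsilon>" "\<epsilon> < 1"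
  shows "\<forall>\<^sub>F s in at_top. \<forall>u\<in>{0..exp ((1 - \<epsilon>) * (exp s / s))}. exp (- s * u) \<le> sigma_fun 1 u"
  using rho_ge_exp[OF eps] eventually_ge_at_top[of 1]
proof eventually_elim
  case (elim s)
  note ker = vkernel_sigma_fun[of 0, simplified]
  define V where "V = exp ((1 - \<epsilon>) * (exp s / s))"
  have s: "s \<ge> 1" using elim by simp
  have X1: "expX s \<ge> 1" using expX_ge_1[of s] s by simp
  have V: "V \<le> integral {expX s - 1..expX s} (\<lambda>t. exp (s * t) * dickman_rho t)"
  proof -
    have "integral {expX s - 1..expX s} (\<lambda>t. V) \<le> integral {expX s - 1..expX s} (\<lambda>t. exp (s * t) * dickman_rho t)"
    proof (rule integral_le)
      show "(\<lambda>t. exp (s * t) * dickman_rho t) integrable_on {expX s - 1..expX s}"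
        by (rule exp_kernel_integrable[OF ker]) (use X1 in auto)
      fix t assume t: "t \<in> {expX s - 1..expX s}"
      have "V = exp (s * t) * exp ((1 - \<epsilon>) * (exp s / s) - s * t)" by (simp add: V_def flip: exp_add)
      also have "\<dots> \<le> exp (s * t) * dickman_rho t" using elim t by (intro mult_left_mono) auto
      finally show "V \<le> exp (s * t) * dickman_rho t" .
    qed auto
    then show ?thesis by simp
  qed
  have "exp (- s * u) \<le> sigma_fun 1 u" if u: "u \<in> {0..V}" for u
  proof (rule vsol_ge_exp[OF ker _ _ _ u])
    show "vsol dickman_rho (sigma_fun 1)" using vsol_sigma_fun[of 1] by simp
    fix v assume v: "1 \<le> v" "v \<le> V"
    show "v \<le> integral {0..v} (\<lambda>t. exp (s * t) * dickman_rho t)"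
    proof (cases "v \<le> expX s")
      case True
      then show ?thesis using exp_kernel_integral_ge[OF ker, of s v] v s by simp
    next
      case False
      then show ?thesis using exp_kernel_integral_mono[OF ker, of "expX s - 1" "expX s" v s] V v X1 by simp
    qed
  qed (use s in auto)
  then show ?case by (simp add: V_def)
qed

text \<open>Integrating exp(d t) up to V puts d V instead of V into the exponent. The loss is
  absorbed when V is itself an exponential, but would spoil the constant for V of order exp s / s;
  so the induction starts with \<open>sigma_fun 1\<close>, where the sharp bound on rho is
  used.\<close>

lemma sigma_ge_exp_Suc:
  assumes LB: "\<And>t. t \<in> {0..V} \<Longrightarrow> exp (- s * t) \<le> sigma_fun k t" and "d > 0" "s \<ge> 0" "V \<ge> 0"
    and u: "u \<in> {0..(exp (d * V) - 1) / d}"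
  shows "exp (- (s + d) * u) \<le> sigma_fun (Suc k) u"
proof (rule vsol_ge_exp[OF vkernel_sigma_fun _ _ _ u])
  show "vsol (sigma_fun k) (sigma_fun (Suc k))" using vsol_sigma_fun[of "Suc k"] by simp
  fix v assume v: "1 \<le> v" "v \<le> (exp (d * V) - 1) / d"
  let ?m = "min v V"
  have m: "0 \<le> ?m" using v assms by simp
  have "(exp (d * ?m) - 1) / d \<le> integral {0..?m} (\<lambda>t. exp ((s + d) * t) * sigma_fun k t)"
  proof (rule has_integral_le)
    show "((\<lambda>t. exp (d * t)) has_integral (exp (d * ?m) - 1) / d) {0..?m}"
      by (rule has_integral_exp_scaled) (use assms m in auto)
    show "((\<lambda>t. exp ((s + d) * t) * sigma_fun k t) has_integral integral {0..?m} (\<lambda>t. exp ((s + d) * t) * sigma_fun k t)) {0..?m}"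
      by (rule integrable_integral[OF exp_kernel_integrable[OF vkernel_sigma_fun]]) simp
    fix t assume t: "t \<in> {0..?m}"
    have "exp (d * t) = exp ((s + d) * t) * exp (- s * t)" by (simp add: algebra_simps flip: exp_add)
    also have "\<dots> \<le> exp ((s + d) * t) * sigma_fun k t" using t by (intro mult_left_mono LB) auto
    finally show "exp (d * t) \<le> exp ((s + d) * t) * sigma_fun k t" .
  qed
  also have "\<dots> \<le> integral {0..v} (\<lambda>t. exp ((s + d) * t) * sigma_fun k t)"
    using m by (intro exp_kernel_integral_mono vkernel_sigma_fun) auto
  finally have le: "(exp (d * ?m) - 1) / d \<le> integral {0..v} (\<lambda>t. exp ((s + d) * t) * sigma_fun k t)" .
  \<comment> \<open>If v \<le> V this is the required inequality, and otherwise the assumed upper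
    bound on v is.\<close>
  have "v \<le> (exp (d * v) - 1) / d" using exp_ge_add_one_self[of "d * v"] \<open>d > 0\<close> by (simp add: field_simps)
  then have "v \<le> (exp (d * ?m) - 1) / d" using v(2) by (simp add: min_def)
  with le show "v \<le> integral {0..v} (\<lambda>t. exp ((s + d) * t) * sigma_fun k t)" by linarith
qed (use assms in auto)

lemma sigma_ge_iter_exp:
  assumes "0 < \<epsilon>" "\<epsilon> < 1"
  shows "\<forall>\<^sub>F s in at_top. \<forall>u\<in>{0..iter_exp (Suc k) ((1 - \<epsilon>) * (exp s / s))}. exp (- s * u) \<le> sigma_fun (Suc k) u"
  using assms
proof (induction k arbitrary: \<epsilon>)
  case 0
  then show ?case using sigma_ge_exp_1[of \<epsilon>] by simp
next
  case (Suc k)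
  \<comment> \<open>Of the total loss \<epsilon> = 4 d, one d comes from the induction hypothesis,
    one from replacing s by s - d, and 2 d exp(s) / s is left to pay for the factor 2 / d.\<close>
  define d where "d = \<epsilon> / 4"
  have d: "0 < d" "d < 1" using Suc.prems by (auto simp: d_def)
  have "filterlim (\<lambda>s::real. s - d) at_top at_top" by real_asymp
  with Suc.IH[OF d] have ev: "\<forall>\<^sub>F s in at_top. \<forall>u\<in>{0..iter_exp (Suc k) ((1 - d) * (exp (s - d) / (s - d)))}.
      exp (- (s - d) * u) \<le> sigma_fun (Suc k) u"
    by (rule eventually_compose_filterlim)
  have "\<forall>\<^sub>F s in at_top. 2 / d \<le> exp (2 * d * (exp s / s))" using d by real_asymp
  with ev show ?case using eventually_ge_at_top[of 2]
  proof eventually_elim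
    case (elim s)
    define b where "b = exp s / s"
    have b: "b \<ge> 0" using elim by (simp add: b_def)
    define V where "V = iter_exp (Suc k) ((1 - d) * (exp (s - d) / (s - d)))"
    define z where "z = (1 - \<epsilon>) * b"
    have z: "z \<ge> 0" using b Suc.prems by (simp add: z_def)
    have "1 - \<epsilon> + 2 * d \<le> (1 - d) * (1 - d)" using d by (simp add: d_def algebra_simps)
    also have "\<dots> \<le> (1 - d) * exp (- d)"
      using d exp_ge_add_one_self[of "- d"] by (intro mult_left_mono) auto
    finally have "z + 2 * d * b \<le> (1 - d) * exp (- d) * b"
      unfolding z_def using b mult_right_mono[of _ _ b] by (simp add: distrib_right[symmetric])
    also have "\<dots> = (1 - d) * (exp (s - d) / s)" by (simp add: b_def exp_diff exp_minus field_simps)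
    also have "\<dots> \<le> (1 - d) * (exp (s - d) / (s - d))"
      using d elim by (intro mult_left_mono divide_left_mono) auto
    finally have zV: "iter_exp (Suc k) (z + 2 * d * b) \<le> V"
      unfolding V_def by (rule iter_exp_mono)
    have "(2 / d) * iter_exp (Suc k) z \<le> iter_exp (Suc k) (z + 2 * d * b)"
      by (rule mult_iter_exp_le_add) (use elim d z in \<open>auto simp: b_def\<close>)
    with zV have "(2 / d) * iter_exp (Suc k) z \<le> V" by simp
    then have dV: "2 * iter_exp (Suc k) z \<le> d * V" using d by (simp add: field_simps)
    have "iter_exp (Suc k) z = iter_exp k (exp z)" by (simp add: funpow_swap1)
    also have "\<dots> \<ge> 1" using z by (intro iter_exp_ge_1) simp
    finally have w1: "1 \<le> iter_exp (Suc k) z" .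
    have dV0: "d * V \<ge> 0" using dV w1 by linarith
    define w where "w = iter_exp (Suc k) z"
    \<comment> \<open>The factor 2 in \<open>dV\<close> absorbs the -1 in exp(d V) - 1: for w \<ge>
      1, exp(2 w) \<ge> 2 exp w \<ge> exp w + 1.\<close>
    have ew: "exp w \<ge> 2" using exp_ge_add_one_self[of w] w1 unfolding w_def by linarith
    have "exp w + 1 \<le> exp w * 2" using ew by linarith
    also have "\<dots> \<le> exp w * exp w" by (rule mult_left_mono[OF ew]) simp
    also have "\<dots> = exp (2 * w)" by (simp flip: exp_add)
    also have "\<dots> \<le> exp (d * V)" using dV by (simp add: w_def)
    finally have "exp w \<le> exp (d * V) - 1" by simp
    also have "\<dots> = (exp (d * V) - 1) / 1" by simp
    also have "\<dots> \<le> (exp (d * V) - 1) / d"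
      using d dV0 by (intro divide_left_mono) auto
    finally have le: "iter_exp (Suc (Suc k)) z \<le> (exp (d * V) - 1) / d" by (simp add: w_def)
    from dV0 have V0: "V \<ge> 0" using d by (auto simp only: zero_le_mult_iff)
    show ?case
    proof
      fix u assume u: "u \<in> {0..iter_exp (Suc (Suc k)) ((1 - \<epsilon>) * (exp s / s))}"
      have "exp (- (s - d + d) * u) \<le> sigma_fun (Suc (Suc k)) u"
      proof (rule sigma_ge_exp_Suc[where V = V])
        show "exp (- (s - d) * t) \<le> sigma_fun (Suc k) t" if "t \<in> {0..V}" for t
          using elim(1) that unfolding V_def[symmetric] by blast
        show "u \<in> {0..(exp (d * V) - 1) / d}"
          using u le unfolding z_def b_def atLeastAtMost_iff by linarith
      qed (use elim d V0 in auto)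
      then show "exp (- s * u) \<le> sigma_fun (Suc (Suc k)) u" by simp
    qed
  qed
qed

section \<open>Inversion by iterated logarithms\<close>

lemma filterlim_iter_log: "filterlim (iter_log k) at_top at_top"
proof (induction k)
  case 0
  then show ?case by (simp add: iter_log_def filterlim_ident id_def)
next
  case (Suc k)
  have "iter_log (Suc k) = (\<lambda>u. ln (iter_log k u))" by (auto simp: iter_log_def)
  then show ?case using filterlim_compose[OF ln_at_top Suc] by simp
qed

lemma iter_exp_iter_log: "\<forall>\<^sub>F u in at_top. iter_exp k (iter_log k u) = u"
proof (induction k)
  case 0
  then show ?case by (simp add: iter_log_def)
next
  case (Suc k)
  have "\<forall>\<^sub>F u in at_top. iter_log k u > 0"
    using filterlim_iter_log[of k] by (simp add: filterlim_at_top_dense)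
  with Suc show ?case
  proof eventually_elim
    case (elim u)
    have "iter_exp (Suc k) (iter_log (Suc k) u) = iter_exp k (exp (ln (iter_log k u)))"
      by (simp add: iter_log_def funpow_swap1[of exp])
    with elim show ?case by simp
  qed
qed

text \<open>Shrinking the innermost argument by a constant yields exp(c' ln u) = u^c' with c' < 1 at
  positive depth, far below u / 2; only depth 0 needs c' = c.\<close>

lemma iter_exp_scaled_iter_log:
  assumes "0 < c" "c < 1"
  shows "\<exists>c'\<in>{0<..<1}. \<forall>\<^sub>F u in at_top. iter_exp k (c * iter_log k u) \<le> c' * u"
proof (induction k)
  case 0
  then show ?case using assms by (intro bexI[of _ c]) (auto simp: iter_log_def)
next
  case (Suc k)
  then obtain c' where c': "0 < c'" "c' < 1"
    and ev: "\<forall>\<^sub>F u in at_top. iter_exp k (c * iter_log k u) \<le> c' * u" by auto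
  have "\<forall>\<^sub>F u in at_top. iter_exp k (c * iter_log k (ln u)) \<le> c' * ln u"
    using eventually_compose_filterlim[OF ev ln_at_top] .
  moreover have "\<forall>\<^sub>F u::real in at_top. exp (c' * ln u) \<le> 1 / 2 * u" using c' by real_asymp
  ultimately have "\<forall>\<^sub>F u in at_top. iter_exp (Suc k) (c * iter_log (Suc k) u) \<le> 1 / 2 * u"
  proof eventually_elim
    case (elim u)
    have "iter_exp (Suc k) (c * iter_log (Suc k) u) = exp (iter_exp k (c * iter_log k (ln u)))"
      by (simp add: iter_log_def funpow_swap1)
    also have "\<dots> \<le> exp (c' * ln u)" using elim by simp
    finally show ?case using elim by linarith
  qed
  then show ?case by (intro bexI[of _ "1/2"]) auto
qed

lemma iter_exp_scaled_iter_log_small: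
  assumes "0 < c" "c < 1" "\<epsilon> > 0"
  shows "\<forall>\<^sub>F u in at_top. iter_exp (Suc k) (c * iter_log (Suc k) u) \<le> \<epsilon> * u"
proof -
  obtain c' where c': "0 < c'" "c' < 1"
    and ev: "\<forall>\<^sub>F u in at_top. iter_exp k (c * iter_log k u) \<le> c' * u"
    using iter_exp_scaled_iter_log[OF assms(1,2), of k] by auto
  have "\<forall>\<^sub>F u in at_top. iter_exp k (c * iter_log k (ln u)) \<le> c' * ln u"
    using eventually_compose_filterlim[OF ev ln_at_top] .
  moreover have "\<forall>\<^sub>F u::real in at_top. exp (c' * ln u) \<le> \<epsilon> * u" using c' assms by real_asymp
  ultimately show ?thesis
  proof eventually_elim
    case (elim u)
    have "iter_exp (Suc k) (c * iter_log (Suc k) u) = exp (iter_exp k (c * iter_log k (ln u)))"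
      by (simp add: iter_log_def funpow_swap1)
    also have "\<dots> \<le> exp (c' * ln u)" using elim by simp
    finally show ?case using elim by linarith
  qed
qed

text \<open>With L = \<open>iter_log (Suc k) u\<close>, the choice s = ln (L ln L) - 3 e nearly
  solves exp s / s = L: as s \<ge> ln L, the argument (1 + e) exp s / s is at most exp(-2 e) L. The
  shrunken L makes the iterated exponential at most e u, so the losses add up to 4 e =
  \<epsilon>.\<close>

lemma sigma_upper_bound:
  assumes "\<epsilon> > 0"
  shows "\<forall>\<^sub>F u in at_top. sigma_fun (Suc k) u \<le>
    exp (u * (\<epsilon> - ln (iter_log (Suc k) u * ln (iter_log (Suc k) u))))"
proof -
  define e where "e = \<epsilon> / 4"
  have e: "e > 0" using assms by (simp add: e_def)
  define c where "c = exp (- 2 * e)"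
  have c: "0 < c" "c < 1" using e by (auto simp: c_def)
  have "filterlim (\<lambda>L::real. ln (L * ln L) - 3 * e) at_top at_top" by real_asymp
  then have "filterlim (\<lambda>u. ln (iter_log (Suc k) u * ln (iter_log (Suc k) u)) - 3 * e) at_top at_top"
    by (rule filterlim_compose[OF _ filterlim_iter_log])
  from eventually_compose_filterlim[OF sigma_le_iter_exp[OF e, of "Suc k"] this]
  have 1: "\<forall>\<^sub>F u in at_top. \<forall>v\<ge>0. sigma_fun (Suc k) v \<le> exp (iter_exp (Suc k) ((1 + e) *
      (exp (ln (iter_log (Suc k) u * ln (iter_log (Suc k) u)) - 3 * e) /
       (ln (iter_log (Suc k) u * ln (iter_log (Suc k) u)) - 3 * e))) -
      (ln (iter_log (Suc k) u * ln (iter_log (Suc k) u)) - 3 * e) * v)" .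
  have "\<forall>\<^sub>F L::real in at_top. L > 1 \<and> ln L > 1 \<and> ln (ln L) \<ge> 3 * e"
    by (intro eventually_conj; real_asymp)
  from eventually_compose_filterlim[OF this filterlim_iter_log]
  have 2: "\<forall>\<^sub>F u in at_top. iter_log (Suc k) u > 1 \<and> ln (iter_log (Suc k) u) > 1 \<and> ln (ln (iter_log (Suc k) u)) \<ge> 3 * e" .
  show ?thesis
    using 1 2 iter_exp_scaled_iter_log_small[OF c e, of k] eventually_ge_at_top[of 0]
  proof eventually_elim
    case (elim u)
    define L where "L = iter_log (Suc k) u"
    define s where "s = ln (L * ln L) - 3 * e"
    have L: "L > 1" "ln L > 1" "ln (ln L) \<ge> 3 * e" using elim by (auto simp: L_def)
    have s: "s \<ge> ln L" using L by (simp add: s_def ln_mult)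
    have es: "exp s = L * ln L * exp (- 3 * e)" using L by (simp add: s_def exp_diff exp_minus field_simps)
    have "exp s / s \<le> exp s / ln L" using s L by (intro divide_left_mono) auto
    also have "\<dots> = L * exp (- 3 * e)" using L by (simp add: es)
    finally have "(1 + e) * (exp s / s) \<le> (1 + e) * (L * exp (- 3 * e))" using e by (intro mult_left_mono) auto
    also have "\<dots> \<le> exp e * (L * exp (- 3 * e))" using L by (intro mult_right_mono exp_ge_add_one_self) auto
    also have "\<dots> = c * L" by (simp add: c_def flip: exp_add)
    finally have "iter_exp (Suc k) ((1 + e) * (exp s / s)) \<le> iter_exp (Suc k) (c * L)" by (rule iter_exp_mono)
    also have "\<dots> \<le> e * u" using elim by (simp add: L_def)
    finally have E: "iter_exp (Suc k) ((1 + e) * (exp s / s)) \<le> e * u" .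
    have "sigma_fun (Suc k) u \<le> exp (iter_exp (Suc k) ((1 + e) * (exp s / s)) - s * u)"
      using elim by (simp add: s_def L_def)
    also have "\<dots> \<le> exp (e * u - s * u)" using E by simp
    also have "e * u - s * u = u * (\<epsilon> - ln (L * ln L))" by (simp add: s_def e_def algebra_simps)
    finally show ?case by (simp add: L_def)
  qed
qed

text \<open>Now s = ln (L ln L) + 3 e, so that (1 - e) exp s / s is at least L and u lies in the
  range where exp(- s u) is a lower bound. This uses that ln L / s tends to 1 and that exp(3 e) (1 -
  e) > 1.\<close>

lemma sigma_lower_bound:
  assumes "\<epsilon> > 0"
  shows "\<forall>\<^sub>F u in at_top. exp (u * (- \<epsilon> - ln (iter_log (Suc k) u * ln (iter_log (Suc k) u)))) \<le> sigma_fun (Suc k) u"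
proof -
  define e where "e = min (1/2) (\<epsilon> / 3)"
  have e: "0 < e" "e < 1" "3 * e \<le> \<epsilon>" using assms by (auto simp: e_def)
  have ee: "exp (3 * e) * (1 - e) > 1"
  proof -
    have "1 < (1 + 3 * e) * (1 - e)" using e mult_strict_left_mono[of e "2/3" e] by (simp add: algebra_simps e_def)
    also have "\<dots> \<le> exp (3 * e) * (1 - e)" using e exp_ge_add_one_self[of "3 * e"] by (intro mult_right_mono) auto
    finally show ?thesis .
  qed
  have "filterlim (\<lambda>L::real. ln (L * ln L) + 3 * e) at_top at_top" by real_asymp
  then have "filterlim (\<lambda>u. ln (iter_log (Suc k) u * ln (iter_log (Suc k) u)) + 3 * e) at_top at_top"
    by (rule filterlim_compose[OF _ filterlim_iter_log])
  from eventually_compose_filterlim[OF sigma_ge_iter_exp[OF e(1,2), of k] this]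
  have 1: "\<forall>\<^sub>F u in at_top. \<forall>v\<in>{0..iter_exp (Suc k) ((1 - e) *
      (exp (ln (iter_log (Suc k) u * ln (iter_log (Suc k) u)) + 3 * e) /
       (ln (iter_log (Suc k) u * ln (iter_log (Suc k) u)) + 3 * e)))}.
      exp (- (ln (iter_log (Suc k) u * ln (iter_log (Suc k) u)) + 3 * e) * v) \<le> sigma_fun (Suc k) v" .
  have "((\<lambda>L::real. ln L / (ln (L * ln L) + 3 * e)) \<longlongrightarrow> 1) at_top" by real_asymp
  then have "\<forall>\<^sub>F L::real in at_top. ln L / (ln (L * ln L) + 3 * e) > 1 / (exp (3 * e) * (1 - e))"
    by (rule order_tendstoD(1)) (use ee in simp)
  moreover have "\<forall>\<^sub>F L::real in at_top. L > 1 \<and> ln L > 1" by (intro eventually_conj; real_asymp)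
  ultimately have "\<forall>\<^sub>F L::real in at_top. ln L / (ln (L * ln L) + 3 * e) > 1 / (exp (3 * e) * (1 - e)) \<and> L > 1 \<and> ln L > 1"
    by (rule eventually_conj)
  from eventually_compose_filterlim[OF this filterlim_iter_log]
  have 2: "\<forall>\<^sub>F u in at_top. ln (iter_log (Suc k) u) / (ln (iter_log (Suc k) u * ln (iter_log (Suc k) u)) + 3 * e) > 1 / (exp (3 * e) * (1 - e))
     \<and> iter_log (Suc k) u > 1 \<and> ln (iter_log (Suc k) u) > 1" .
  show ?thesis
    using 1 2 iter_exp_iter_log[of "Suc k"] eventually_ge_at_top[of 0]
  proof eventually_elim
    case (elim u)
    define L where "L = iter_log (Suc k) u"
    define s where "s = ln (L * ln L) + 3 * e"
    have L: "L > 1" "ln L > 1" "ln L / s > 1 / (exp (3 * e) * (1 - e))" using elim by (auto simp: L_def s_def)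
    have es: "exp s = L * ln L * exp (3 * e)" using L by (simp add: s_def exp_add)
    have "1 \<le> ln L / s * (exp (3 * e) * (1 - e))"
      using mult_right_mono[OF less_imp_le[OF L(3)], of "exp (3 * e) * (1 - e)"] ee e by simp
    then have "L * 1 \<le> L * (ln L / s * (exp (3 * e) * (1 - e)))" using L by (intro mult_left_mono) auto
    also have "\<dots> = (1 - e) * (exp s / s)" by (simp add: es)
    finally have "iter_exp (Suc k) L \<le> iter_exp (Suc k) ((1 - e) * (exp s / s))"
      by (intro iter_exp_mono) simp
    then have uE: "u \<le> iter_exp (Suc k) ((1 - e) * (exp s / s))" using elim(3) unfolding L_def[symmetric] by (simp only:)
    have "exp (- s * u) \<le> sigma_fun (Suc k) u"
      using elim(1) unfolding L_def[symmetric] s_def[symmetric]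
      by (rule bspec) (use uE elim(4) in \<open>simp only: atLeastAtMost_iff\<close>)
    moreover have "u * (- \<epsilon> - ln (L * ln L)) \<le> - s * u"
      using mult_right_mono[OF e(3) \<open>0 \<le> u\<close>] by (simp add: s_def algebra_simps)
    ultimately have "exp (u * (- \<epsilon> - ln (L * ln L))) \<le> sigma_fun (Suc k) u"
      by (meson exp_le_cancel_iff order_trans)
    then show ?case by (simp add: L_def)
  qed
qed

theorem sigma_asymptotics:
  assumes "j \<ge> 1"
  shows "\<exists>\<delta>::real \<Rightarrow> real. (\<delta> \<longlongrightarrow> 0) at_top \<and>
            (\<forall>\<^sub>F u in at_top. sigma_fun j u =
               ((1 + \<delta> u) / (iter_log j u * iter_log (Suc j) u)) powr u)"
proof -
  obtain k where j: "j = Suc k" using assms by (cases j) auto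
  define A where "A u = iter_log j u * iter_log (Suc j) u" for u
  have A: "A u = iter_log j u * ln (iter_log j u)" for u by (simp add: A_def iter_log_def)
  have "\<forall>\<^sub>F L::real in at_top. L * ln L > 0" by real_asymp
  from eventually_compose_filterlim[OF this filterlim_iter_log[of j]]
  have Apos: "\<forall>\<^sub>F u in at_top. A u > 0" by (simp add: A)
  have spos: "sigma_fun j u > 0" if "u \<ge> 0" for u
    by (rule vsol_pos[OF vkernel_sigma_kernel vsol_sigma_fun that])
  \<comment> \<open>\<open>q u - 1\<close> is the required \<delta>; positivity of \<sigma> is what
    allows taking the u-th root and raising it to the power u again.\<close>
  define q where "q u = sigma_fun j u powr (1 / u) * A u" for u
  have bnd: "\<forall>\<^sub>F u in at_top. exp (- e) \<le> q u \<and> q u \<le> exp e" if e: "e > 0" for e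
    using sigma_upper_bound[OF e, of k] sigma_lower_bound[OF e, of k] Apos eventually_gt_at_top[of 0]
  proof eventually_elim
    case (elim u)
    have l: "exp (u * (- e - ln (A u))) \<le> sigma_fun j u" and up: "sigma_fun j u \<le> exp (u * (e - ln (A u)))"
      using elim by (auto simp: A j)
    have p: "exp (u * x) powr (1 / u) = exp x" for x using elim by (simp add: exp_powr_real)
    have "exp (- e - ln (A u)) \<le> sigma_fun j u powr (1 / u)"
      using powr_mono2[OF _ _ l, of "1 / u"] elim by (simp add: p)
    moreover have "sigma_fun j u powr (1 / u) \<le> exp (e - ln (A u))"
      using powr_mono2[OF _ _ up, of "1 / u"] elim spos[of u] by (simp add: p)
    ultimately show ?case using elim by (simp add: q_def exp_diff field_simps)
  qed
  have "(q \<longlongrightarrow> 1) at_top"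
  proof (rule order_tendstoI)
    fix a :: real assume a: "a < 1"
    define e where "e = - ln (max a (1/2)) / 2"
    have e: "e > 0" using a by (simp add: e_def)
    have "exp (- (2 * e)) = max a (1/2)" by (simp add: e_def)
    moreover have "exp (- (2 * e)) < exp (- e)" using e by simp
    ultimately have "a < exp (- e)" by linarith
    with bnd[OF e] show "\<forall>\<^sub>F u in at_top. a < q u" by (auto elim: eventually_mono)
  next
    fix a :: real assume a: "1 < a"
    define e where "e = ln a / 2"
    have e: "e > 0" using a by (simp add: e_def)
    have "exp (2 * e) = a" using a by (simp add: e_def)
    moreover have "exp e < exp (2 * e)" using e by simp
    ultimately have "exp e < a" by linarith
    with bnd[OF e] show "\<forall>\<^sub>F u in at_top. q u < a" by (auto elim: eventually_mono)
  qed
  then have "((\<lambda>u. q u - 1) \<longlongrightarrow> 0) at_top" by (simp add: LIM_zero_iff)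
  moreover have "\<forall>\<^sub>F u in at_top. sigma_fun j u = ((1 + (q u - 1)) / (iter_log j u * iter_log (Suc j) u)) powr u"
    using Apos eventually_gt_at_top[of 0]
  proof eventually_elim
    case (elim u)
    have "(q u / A u) powr u = sigma_fun j u"
      using elim spos[of u] by (simp add: q_def powr_powr)
    then show ?case by (simp add: A_def)
  qed
  ultimately show ?thesis by (intro exI[of _ "\<lambda>u. q u - 1"]) auto
qed

section \<open>Sums over primes\<close>

definition primes_le :: "real \<Rightarrow> nat set" where
  "primes_le x = {p. prime p \<and> real p \<le> x}"

lemma finite_nat_le: "finite {n :: nat. real n \<le> x}"
  by (rule finite_subset[of _ "{..nat \<lfloor>x\<rfloor>}"]) (auto intro: le_nat_floor)

lemma finite_primes_le [simp]: "finite (primes_le x)"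
  by (rule finite_subset[OF _ finite_nat_le[of x]]) (auto simp: primes_le_def)

lemma primes_le_ge_2: "p \<in> primes_le x \<Longrightarrow> p \<ge> 2"
  by (auto simp: primes_le_def prime_ge_2_nat)

lemma ln_prime_nonneg: "prime (p :: nat) \<Longrightarrow> 0 \<le> ln (real p)"
  using prime_ge_1_nat[of p] by simp

lemma primes_le_mono: "x \<le> y \<Longrightarrow> primes_le x \<subseteq> primes_le y"
  by (auto simp: primes_le_def)

lemma card_nat_le: "x \<ge> 0 \<Longrightarrow> real (card {n :: nat. 1 \<le> n \<and> real n \<le> x}) = of_int \<lfloor>x\<rfloor>"
proof -
  assume "x \<ge> 0"
  have "{n :: nat. 1 \<le> n \<and> real n \<le> x} = {1..nat \<lfloor>x\<rfloor>}"
    using \<open>x \<ge> 0\<close> by (auto simp: le_nat_iff le_floor_iff)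
  then show ?thesis using \<open>x \<ge> 0\<close> by simp
qed

section \<open>Integers composed of primes from a given set\<close>

definition gen_set :: "nat set \<Rightarrow> real \<Rightarrow> nat set" where
  "gen_set P x = {n. 1 \<le> n \<and> real n \<le> x \<and> (\<forall>p. prime p \<and> p dvd n \<longrightarrow> p \<in> P)}"

lemma finite_gen_set [simp]: "finite (gen_set P x)"
  by (rule finite_subset[OF _ finite_nat_le[of x]]) (auto simp: gen_set_def)

lemma gen_set_subset: "gen_set P x \<subseteq> {n. 1 \<le> n \<and> real n \<le> x}"
  by (auto simp: gen_set_def)

lemma finite_nat_pos_le: "finite {n :: nat. 1 \<le> n \<and> real n \<le> x}"
  by (rule finite_subset[OF _ finite_nat_le[of x]]) auto

lemma card_gen_set_le: "x \<ge> 0 \<Longrightarrow> real (card (gen_set P x)) \<le> x"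
proof -
  assume x: "x \<ge> 0"
  have "card (gen_set P x) \<le> card {n :: nat. 1 \<le> n \<and> real n \<le> x}"
    by (rule card_mono[OF finite_nat_pos_le gen_set_subset])
  then have "real (card (gen_set P x)) \<le> of_int \<lfloor>x\<rfloor>"
    using card_nat_le[OF x] by linarith
  then show ?thesis by linarith
qed

lemma gen_set_multiples:
  assumes "prime p" "p \<in> P"
  shows "bij_betw (\<lambda>m. p * m) (gen_set P (x / p)) {n \<in> gen_set P x. p dvd n}"
proof (rule bij_betwI')
  have p0: "p > 0" using assms prime_gt_0_nat by blast
  show "p * m = p * m' \<longleftrightarrow> m = m'" for m m' using p0 by simp
  show "p * m \<in> {n \<in> gen_set P x. p dvd n}" if "m \<in> gen_set P (x / p)" for m
    using that p0 assms by (auto simp: gen_set_def field_simps prime_dvd_mult_iff dest: primes_dvd_imp_eq)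
  show "\<exists>m\<in>gen_set P (x / p). n = p * m" if "n \<in> {n \<in> gen_set P x. p dvd n}" for n
  proof -
    from that obtain m where m: "n = p * m" by auto
    with that p0 have "m \<in> gen_set P (x / p)" by (auto simp: gen_set_def field_simps)
    with m show ?thesis by blast
  qed
qed

text \<open>Removing one factor p turns the sum S(x) into floor(x / p) + S(x / p), and the geometric
  series of the x / p^i adds up to x / (p - 1).\<close>

lemma sum_multiplicity_le:
  assumes p: "prime p" and "x \<ge> 0"
  shows "(\<Sum>m | 1 \<le> m \<and> real m \<le> x. real (multiplicity p m)) \<le> x / (real p - 1)"
  using assms(2)
proof (induction "nat \<lfloor>x\<rfloor>" arbitrary: x rule: less_induct)
  case less
  let ?A = "\<lambda>x. {m :: nat. 1 \<le> m \<and> real m \<le> x}"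
  have p2: "p \<ge> 2" using p prime_ge_2_nat by blast
  have p0: "p > 0" using p2 by simp
  show ?case
  proof (cases "x < 1")
    case True
    then have "?A x = {}" by auto
    then have "(\<Sum>m\<in>?A x. real (multiplicity p m)) = 0" by (simp only: sum.empty)
    then show ?thesis using less.prems p2 by (simp add: divide_nonneg_nonneg)
  next
    case False
    have x1: "1 \<le> x" using False by simp
    have "nat \<lfloor>x / p\<rfloor> < nat \<lfloor>x\<rfloor>"
    proof -
      have "x / p \<le> x / 2" using p2 x1 by (intro divide_left_mono) auto
      then have "\<lfloor>x / p\<rfloor> \<le> \<lfloor>x / 2\<rfloor>" by (rule floor_mono)
      also have "\<lfloor>x / 2\<rfloor> < \<lfloor>x\<rfloor>"
      proof -
        have "1 \<le> \<lfloor>x\<rfloor>" using x1 by simp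
        moreover have "\<lfloor>x / 2\<rfloor> = \<lfloor>x\<rfloor> div 2" using floor_divide_real_eq_div[of 2 x] by simp
        ultimately show ?thesis by linarith
      qed
      finally show ?thesis using x1 by linarith
    qed
    then have IH: "(\<Sum>m\<in>?A (x / p). real (multiplicity p m)) \<le> x / p / (real p - 1)"
      by (rule less.hyps) (use x1 in auto)
    have "(\<Sum>m\<in>?A x. real (multiplicity p m)) = (\<Sum>m\<in>{m\<in>?A x. p dvd m}. real (multiplicity p m))"
      by (rule sum.mono_neutral_right[OF finite_nat_pos_le]) (auto simp: not_dvd_imp_multiplicity_0)
    also have "\<dots> = (\<Sum>m\<in>?A (x / p). real (multiplicity p (p * m)))"
    proof (rule sum.reindex_bij_betw[symmetric], rule bij_betwI')
      show "p * m = p * m' \<longleftrightarrow> m = m'" for m m' using p0 by simp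
      show "p * m \<in> {m \<in> ?A x. p dvd m}" if "m \<in> ?A (x / p)" for m
        using that p0 by (auto simp: field_simps)
      show "\<exists>m\<in>?A (x / p). n = p * m" if "n \<in> {m \<in> ?A x. p dvd m}" for n
      proof -
        from that obtain m where m: "n = p * m" by auto
        with that p0 have "m \<in> ?A (x / p)" by (auto simp: field_simps)
        with m show ?thesis by blast
      qed
    qed
    also have "\<dots> = (\<Sum>m\<in>?A (x / p). 1 + real (multiplicity p m))"
    proof (rule sum.cong[OF refl])
      fix m assume "m \<in> ?A (x / p)"
      then have "multiplicity p (p * m) = Suc (multiplicity p m)"
        using p by (intro multiplicity_times_same) (auto simp: prime_gt_0_nat)
      then show "real (multiplicity p (p * m)) = 1 + real (multiplicity p m)" by simp
    qed
    also have "\<dots> = of_int \<lfloor>x / p\<rfloor> + (\<Sum>m\<in>?A (x / p). real (multiplicity p m))"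
      using card_nat_le[of "x / p"] x1 by (simp add: sum.distrib)
    also have "\<dots> \<le> x / p + x / p / (real p - 1)"
      using IH of_int_floor_le[of "x / p"] by linarith
    also have "\<dots> = x / (real p - 1)" using p2 by (simp add: divide_simps) (simp add: algebra_simps)
    finally show ?thesis .
  qed
qed

lemma ln_eq_sum_multiplicity:
  assumes "n > 0"
  shows "ln (real n) = (\<Sum>p\<in>prime_factors n. real (multiplicity p n) * ln (real p))"
proof -
  have "real n = (\<Prod>p\<in>prime_factors n. real p ^ multiplicity p n)"
    using assms by (subst prime_factorization_nat[OF assms]) simp
  then have "ln (real n) = ln (\<Prod>p\<in>prime_factors n. real p ^ multiplicity p n)" by simp
  also have "\<dots> = (\<Sum>p\<in>prime_factors n. ln (real p ^ multiplicity p n))"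
    by (rule ln_prod) (auto simp: in_prime_factors_iff prime_gt_0_nat)
  also have "\<dots> = (\<Sum>p\<in>prime_factors n. real (multiplicity p n) * ln (real p))"
    by (rule sum.cong[OF refl]) (auto simp: ln_realpow in_prime_factors_iff prime_gt_0_nat)
  finally show ?thesis .
qed

lemma sum_ln_over_square_bounded: "\<exists>C\<ge>0. \<forall>A. finite A \<longrightarrow> (\<forall>p\<in>A. p \<ge> 2) \<longrightarrow> (\<Sum>p\<in>A. ln (real p) / (real p * (real p - 1))) \<le> C"
proof -
  have sm: "summable (\<lambda>n. 4 * real n powr (- 3 / 2))"
    by (intro summable_mult) (simp add: summable_real_powr_iff)
  define C where "C = (\<Sum>n. 4 * real n powr (- 3 / 2))"
  have "C \<ge> 0" unfolding C_def by (rule suminf_nonneg[OF sm]) auto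
  moreover have "(\<Sum>p\<in>A. ln (real p) / (real p * (real p - 1))) \<le> C" if A: "finite A" "\<forall>p\<in>A. p \<ge> 2" for A
  proof -
    have "ln (real p) / (real p * (real p - 1)) \<le> 4 * real p powr (- 3 / 2)" if "p \<ge> 2" for p :: nat
    proof -
      have p: "real p \<ge> 2" using that by simp
      have "ln (real p) = 2 * ln (sqrt (real p))" using p by (simp add: ln_sqrt)
      also have "\<dots> \<le> 2 * sqrt (real p)" using p ln_le_minus_one[of "sqrt (real p)"] by simp
      finally have l: "ln (real p) \<le> 2 * sqrt (real p)" .
      have "ln (real p) / (real p * (real p - 1)) \<le> (2 * sqrt (real p)) / (real p * (real p / 2))"
        using l p by (intro frac_le mult_left_mono) auto
      also have "\<dots> = 4 * real p powr (1 / 2 - 2)"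
        unfolding powr_diff using p by (simp add: powr_half_sqrt power2_eq_square)
      finally show ?thesis by simp
    qed
    then have "(\<Sum>p\<in>A. ln (real p) / (real p * (real p - 1))) \<le> (\<Sum>p\<in>A. 4 * real p powr (- 3 / 2))"
      using A by (intro sum_mono) auto
    also have "\<dots> \<le> C" unfolding C_def by (rule sum_le_suminf[OF sm A(1)]) auto
    finally show ?thesis .
  qed
  ultimately show ?thesis by blast
qed

text \<open>A weak form of Stirling's formula, from ln (x / m) \<le> 2 sqrt (x / m) and \<Sum> 1 /
  sqrt m \<le> 2 sqrt x.\<close>

lemma sum_ln_gap: 
  assumes x: "x \<ge> 1"
  shows "0 \<le> (\<Sum>m | 1 \<le> m \<and> real m \<le> x. ln x - ln (real m))" "(\<Sum>m | 1 \<le> m \<and> real m \<le> x. ln x - ln (real m)) \<le> 4 * x"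
proof -
  show "0 \<le> (\<Sum>m | 1 \<le> m \<and> real m \<le> x. ln x - ln (real m))"
    by (rule sum_nonneg) auto
  have S: "(\<Sum>m\<in>{1..N}. 1 / sqrt (real m)) \<le> 2 * sqrt (real N)" for N
  proof (induction N)
    case (Suc N)
    have "1 / sqrt (real (Suc N)) \<le> 2 * (sqrt (real (Suc N)) - sqrt (real N))"
    proof -
      let ?a = "sqrt (real (Suc N))" and ?b = "sqrt (real N)"
      have ab: "?a > 0" "?b \<le> ?a" "?b \<ge> 0" by auto
      have "(?a - ?b) * (?a + ?b) = 1" by (simp add: algebra_simps)
      moreover have "(?a - ?b) * (?a + ?b) \<le> (?a - ?b) * (2 * ?a)" using ab by (intro mult_left_mono) auto
      ultimately have "1 \<le> 2 * (?a - ?b) * ?a" by (simp only: mult_ac)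
      then show ?thesis using ab by (subst pos_divide_le_eq) auto
    qed
    then show ?case using Suc by simp
  qed simp
  have "(\<Sum>m | 1 \<le> m \<and> real m \<le> x. ln x - ln (real m)) \<le> (\<Sum>m | 1 \<le> m \<and> real m \<le> x. 2 * (sqrt x / sqrt (real m)))"
  proof (rule sum_mono)
    fix m :: nat assume m: "m \<in> {m. 1 \<le> m \<and> real m \<le> x}"
    have "ln x - ln (real m) = 2 * ln (sqrt (x / real m))"
      using m x by (simp add: ln_sqrt ln_div)
    also have "\<dots> \<le> 2 * sqrt (x / real m)"
      using m x ln_le_minus_one[of "sqrt (x / real m)"] by simp
    finally show "ln x - ln (real m) \<le> 2 * (sqrt x / sqrt (real m))" by (simp add: real_sqrt_divide)
  qed
  also have "\<dots> = 2 * sqrt x * (\<Sum>m | 1 \<le> m \<and> real m \<le> x. 1 / sqrt (real m))"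
    by (simp add: sum_distrib_left)
  also have "(\<Sum>m | 1 \<le> m \<and> real m \<le> x. 1 / sqrt (real m)) = (\<Sum>m\<in>{1..nat \<lfloor>x\<rfloor>}. 1 / sqrt (real m))"
    using x by (intro sum.cong) (auto simp: le_nat_iff le_floor_iff)
  also have "2 * sqrt x * (\<Sum>m\<in>{1..nat \<lfloor>x\<rfloor>}. 1 / sqrt (real m)) \<le> 2 * sqrt x * (2 * sqrt (real (nat \<lfloor>x\<rfloor>)))"
    using x by (intro mult_left_mono S) auto
  also have "\<dots> \<le> 2 * sqrt x * (2 * sqrt x)"
    using x by (intro mult_left_mono real_sqrt_le_mono) (auto intro: order_trans[of _ 1])
  also have "\<dots> = 4 * x" using x by simp
  finally show "(\<Sum>m | 1 \<le> m \<and> real m \<le> x. ln x - ln (real m)) \<le> 4 * x" .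
qed


lemma sum_multiplicity_gen_set:
  assumes p: "prime p" "p \<in> P" and x: "x \<ge> 0"
  shows "real (card (gen_set P (x / p))) \<le> (\<Sum>m\<in>gen_set P x. real (multiplicity p m))"
    and "(\<Sum>m\<in>gen_set P x. real (multiplicity p m)) \<le> real (card (gen_set P (x / p))) + x / (real p * (real p - 1))"
proof -
  have "(\<Sum>m\<in>gen_set P x. real (multiplicity p m)) = (\<Sum>m\<in>{m\<in>gen_set P x. p dvd m}. real (multiplicity p m))"
    by (rule sum.mono_neutral_right) (auto simp: not_dvd_imp_multiplicity_0)
  also have "\<dots> = (\<Sum>m\<in>gen_set P (x / p). real (multiplicity p (p * m)))"
    by (rule sum.reindex_bij_betw[OF gen_set_multiples[OF p], symmetric])
  also have "\<dots> = (\<Sum>m\<in>gen_set P (x / p). 1 + real (multiplicity p m))"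
  proof (rule sum.cong[OF refl])
    fix m assume "m \<in> gen_set P (x / p)"
    then have "multiplicity p (p * m) = Suc (multiplicity p m)"
      using p by (intro multiplicity_times_same) (auto simp: prime_gt_0_nat gen_set_def)
    then show "real (multiplicity p (p * m)) = 1 + real (multiplicity p m)" by simp
  qed
  finally have eq: "(\<Sum>m\<in>gen_set P x. real (multiplicity p m)) =
    real (card (gen_set P (x / p))) + (\<Sum>m\<in>gen_set P (x / p). real (multiplicity p m))"
    by (simp add: sum.distrib)
  show "real (card (gen_set P (x / p))) \<le> (\<Sum>m\<in>gen_set P x. real (multiplicity p m))"
    unfolding eq by (simp add: sum_nonneg)
  have "(\<Sum>m\<in>gen_set P (x / p). real (multiplicity p m)) \<le> (\<Sum>m | 1 \<le> m \<and> real m \<le> x / p. real (multiplicity p m))"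
    by (rule sum_mono2[OF finite_nat_pos_le gen_set_subset]) auto
  also have "\<dots> \<le> x / p / (real p - 1)" using p x by (intro sum_multiplicity_le) auto
  finally show "(\<Sum>m\<in>gen_set P x. real (multiplicity p m)) \<le> real (card (gen_set P (x / p))) + x / (real p * (real p - 1))"
    unfolding eq by simp
qed

text \<open>Chebyshev's device: the sum of ln m over \<open>gen_set P x\<close> differs from the
  cardinality times ln x by at most 4 x, and splitting each ln m into primes gives the sum over p,
  where proper prime powers add at most x \<Sum> ln p / (p (p - 1)). The constant does not depend on
  P, as the later uniformity requires.\<close>

lemma log_identity:
  "\<exists>C\<ge>0. \<forall>P x. x \<ge> 1 \<longrightarrow>
     \<bar>real (card (gen_set P x)) * ln x - (\<Sum>p\<in>P \<inter> primes_le x. ln (real p) * real (card (gen_set P (x / p))))\<bar> \<le> C * x"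
proof -
  obtain C where C: "C \<ge> 0"
    "\<And>A. finite A \<Longrightarrow> (\<forall>p\<in>A. p \<ge> 2) \<Longrightarrow> (\<Sum>p\<in>A. ln (real p) / (real p * (real p - 1))) \<le> C"
    using sum_ln_over_square_bounded by blast
  have "\<bar>real (card (gen_set P x)) * ln x - (\<Sum>p\<in>P \<inter> primes_le x. ln (real p) * real (card (gen_set P (x / p))))\<bar> \<le> (4 + C) * x"
    if x: "x \<ge> 1" for P x
  proof -
    let ?A = "gen_set P x" and ?Q = "P \<inter> primes_le x"
    define S where "S = (\<Sum>m\<in>?A. ln (real m))"
    have "real (card ?A) * ln x - S = (\<Sum>m\<in>?A. ln x - ln (real m))"
      by (simp add: S_def sum_subtractf)
    moreover have "(\<Sum>m\<in>?A. ln x - ln (real m)) \<ge> 0"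
      by (rule sum_nonneg) (auto simp: gen_set_def)
    moreover have "(\<Sum>m\<in>?A. ln x - ln (real m)) \<le> (\<Sum>m | 1 \<le> m \<and> real m \<le> x. ln x - ln (real m))"
      by (rule sum_mono2[OF finite_nat_pos_le gen_set_subset]) auto
    ultimately have 1: "0 \<le> real (card ?A) * ln x - S" "real (card ?A) * ln x - S \<le> 4 * x"
      using sum_ln_gap(2)[OF x] by linarith+
    have "S = (\<Sum>m\<in>?A. \<Sum>p\<in>?Q. real (multiplicity p m) * ln (real p))"
      unfolding S_def
    proof (rule sum.cong[OF refl])
      fix m assume m: "m \<in> ?A"
      have sub: "prime_factors m \<subseteq> ?Q"
      proof
        fix p assume p: "p \<in> prime_factors m"
        then have "p \<le> m" using m by (intro dvd_imp_le) (auto simp: gen_set_def)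
        then have "real p \<le> x" using m by (auto simp: gen_set_def intro: order_trans[of _ "real m"])
        then show "p \<in> ?Q" using p m by (auto simp: gen_set_def primes_le_def in_prime_factors_iff)
      qed
      have "ln (real m) = (\<Sum>p\<in>prime_factors m. real (multiplicity p m) * ln (real p))"
        using m by (intro ln_eq_sum_multiplicity) (auto simp: gen_set_def)
      also have "\<dots> = (\<Sum>p\<in>?Q. real (multiplicity p m) * ln (real p))"
      proof (rule sum.mono_neutral_left[OF _ sub])
        show "\<forall>p\<in>?Q - prime_factors m. real (multiplicity p m) * ln (real p) = 0"
        proof
          fix p assume "p \<in> ?Q - prime_factors m"
          then have "\<not> p dvd m" using m by (auto simp: primes_le_def in_prime_factors_iff gen_set_def)
          then show "real (multiplicity p m) * ln (real p) = 0" by (simp add: not_dvd_imp_multiplicity_0)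
        qed
      qed auto
      finally show "ln (real m) = (\<Sum>p\<in>?Q. real (multiplicity p m) * ln (real p))" .
    qed
    also have "\<dots> = (\<Sum>p\<in>?Q. ln (real p) * (\<Sum>m\<in>?A. real (multiplicity p m)))"
      by (subst sum.swap) (simp add: sum_distrib_left mult.commute)
    finally have S: "S = (\<Sum>p\<in>?Q. ln (real p) * (\<Sum>m\<in>?A. real (multiplicity p m)))" .
    let ?M = "\<Sum>p\<in>?Q. ln (real p) * real (card (gen_set P (x / p)))"
    have Q: "prime p" "p \<in> P" "ln (real p) \<ge> 0" if "p \<in> ?Q" for p
      using that by (auto simp: primes_le_def ln_prime_nonneg)
    have "?M \<le> S" unfolding S
      by (intro sum_mono mult_left_mono sum_multiplicity_gen_set Q) (use x in auto)
    moreover have "S \<le> (\<Sum>p\<in>?Q. ln (real p) * (real (card (gen_set P (x / p))) + x / (real p * (real p - 1))))" unfolding S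
      by (intro sum_mono mult_left_mono sum_multiplicity_gen_set Q) (use x in auto)
    then have "S \<le> ?M + x * (\<Sum>p\<in>?Q. ln (real p) / (real p * (real p - 1)))"
      by (simp add: distrib_left sum.distrib sum_distrib_left mult.commute)
    moreover have "x * (\<Sum>p\<in>?Q. ln (real p) / (real p * (real p - 1))) \<le> x * C"
      using x by (intro mult_left_mono C) (auto dest: primes_le_ge_2)
    ultimately have "?M \<le> S" "S \<le> ?M + C * x" by (auto simp: mult.commute)
    with 1 show ?thesis using x C(1) by (simp add: algebra_simps abs_le_iff)
  qed
  then show ?thesis using C(1) by (intro exI[of _ "4 + C"]) auto
qed

section \<open>The estimates of Chebyshev and Mertens\<close>

lemma theta_double:
  assumes "n \<ge> 1"
  shows "(\<Sum>p\<in>primes_le (2 * real n) - primes_le (real n). ln (real p)) \<le> 2 * real n * ln 2"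
proof -
  let ?N = "(2 * n) choose n"
  have N0: "?N > 0" by simp
  have "primes_le (2 * real n) - primes_le (real n) \<subseteq> prime_factors ?N"
  proof
    fix p assume p: "p \<in> primes_le (2 * real n) - primes_le (real n)"
    then have pp: "prime p" "n < p" "real p \<le> real (2 * n)" by (auto simp: primes_le_def)
    then have "p dvd fact (2 * n)" by (simp add: prime_dvd_fact_iff)
    also have "fact (2 * n) = fact n * fact n * ?N"
      using binomial_fact_lemma[of n "2 * n"] by simp
    finally have "p dvd ?N" using pp by (simp add: prime_dvd_mult_iff prime_dvd_fact_iff)
    then show "p \<in> prime_factors ?N" using pp N0 by (auto simp: in_prime_factors_iff)
  qed
  then have "(\<Sum>p\<in>primes_le (2 * real n) - primes_le (real n). ln (real p)) \<le> (\<Sum>p\<in>prime_factors ?N. ln (real p))"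
    by (intro sum_mono2) (auto simp: in_prime_factors_iff ln_prime_nonneg)
  also have "\<dots> \<le> (\<Sum>p\<in>prime_factors ?N. real (multiplicity p ?N) * ln (real p))"
  proof (rule sum_mono)
    fix p assume p: "p \<in> prime_factors ?N"
    then have "multiplicity p ?N \<ge> 1" using N0 by (auto simp: prime_factors_multiplicity)
    then have "1 * ln (real p) \<le> real (multiplicity p ?N) * ln (real p)"
      using p by (intro mult_right_mono) (auto simp: in_prime_factors_iff ln_prime_nonneg)
    then show "ln (real p) \<le> real (multiplicity p ?N) * ln (real p)" by simp
  qed
  also have "\<dots> = ln (real ?N)" using ln_eq_sum_multiplicity[OF N0] by simp
  also have "\<dots> \<le> ln (2 ^ (2 * n))"
  proof -
    have "?N \<le> 2 ^ (2 * n)" by (rule binomial_le_pow2)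
    then have "real ?N \<le> real (2 ^ (2 * n))" by (rule of_nat_mono)
    then show ?thesis using N0 by (subst ln_le_cancel_iff) auto
  qed
  also have "\<dots> = 2 * real n * ln 2" by (simp add: ln_realpow)
  finally show ?thesis .
qed

lemma theta_pow2: "(\<Sum>p\<in>primes_le (2 ^ k). ln (real p)) \<le> 2 * 2 ^ k * ln 2"
proof (induction k)
  case 0
  have "primes_le 1 = {}" by (auto simp: primes_le_def dest: prime_gt_1_nat)
  then show ?case by simp
next
  case (Suc k)
  have "primes_le (2 ^ Suc k) = primes_le (2 ^ k) \<union> (primes_le (2 ^ Suc k) - primes_le (2 ^ k))"
    using primes_le_mono[of "2 ^ k" "2 ^ Suc k"] by auto
  then have "(\<Sum>p\<in>primes_le (2 ^ Suc k). ln (real p)) =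
      (\<Sum>p\<in>primes_le (2 ^ k). ln (real p)) + (\<Sum>p\<in>primes_le (2 ^ Suc k) - primes_le (2 ^ k). ln (real p))"
    by (metis (no_types, lifting) sum.union_disjoint finite_primes_le finite_Diff Diff_disjoint)
  also have "(\<Sum>p\<in>primes_le (2 ^ Suc k) - primes_le (2 ^ k). ln (real p)) \<le> 2 * 2 ^ k * ln 2"
    using theta_double[of "2 ^ k"] by simp
  finally show ?case using Suc by (simp add: algebra_simps)
qed

lemma theta_le:
  assumes "x \<ge> 0"
  shows "(\<Sum>p\<in>primes_le x. ln (real p)) \<le> 4 * x"
proof (cases "x \<ge> 1")
  case False
  then have "primes_le x = {}" by (auto simp: primes_le_def dest: prime_gt_1_nat)
  then show ?thesis using assms by simp
next
  case True
  define k where "k = (LEAST k. x \<le> 2 ^ k)"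
  obtain k0 where "x < 2 ^ k0" using real_arch_pow[of 2 x] by auto
  then have "x \<le> 2 ^ k0" by simp
  then have k: "x \<le> 2 ^ k" unfolding k_def by (rule LeastI[of "\<lambda>k. x \<le> 2 ^ k"])
  have "2 ^ k \<le> 2 * x"
  proof (cases k)
    case 0
    then show ?thesis using True by simp
  next
    case (Suc j)
    then have "\<not> x \<le> 2 ^ j" using not_less_Least[of j "\<lambda>k. x \<le> 2 ^ k"] by (simp add: k_def)
    then show ?thesis using Suc by simp
  qed
  have "(\<Sum>p\<in>primes_le x. ln (real p)) \<le> (\<Sum>p\<in>primes_le (2 ^ k). ln (real p))"
    by (intro sum_mono2 primes_le_mono k) (auto simp: primes_le_def ln_prime_nonneg)
  also have "\<dots> \<le> 2 * 2 ^ k * ln 2" by (rule theta_pow2)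
  also have "\<dots> \<le> 2 * (2 * x) * 1"
    using \<open>2 ^ k \<le> 2 * x\<close> ln_2_less_1 True by (intro mult_mono) auto
  finally show ?thesis by simp
qed

lemma prime_pi_eq: "prime_pi x = card (primes_le x)"
  by (simp add: prime_pi_def primes_le_def)

text \<open>Primes up to sqrt x are counted as integers, all others have ln p \<ge> ln x / 2; the
  two parts contribute 2 and 8 to the constant.\<close>

lemma prime_pi_le:
  assumes "x \<ge> 1"
  shows "real (prime_pi x) * ln x \<le> 10 * x"
proof -
  let ?s = "sqrt x"
  have s: "?s \<ge> 1" using assms by simp
  have lnx: "ln x \<le> 2 * ?s"
  proof -
    have "ln x = 2 * ln ?s" using assms by (simp add: ln_sqrt)
    also have "\<dots> \<le> 2 * ?s" using ln_le_minus_one[of ?s] s by simp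
    finally show ?thesis .
  qed
  have "card (primes_le ?s) \<le> card {n :: nat. 1 \<le> n \<and> real n \<le> ?s}"
    by (intro card_mono finite_nat_pos_le) (auto simp: primes_le_def prime_ge_Suc_0_nat)
  then have 1: "real (card (primes_le ?s)) \<le> ?s"
    using card_nat_le[of ?s] s of_int_floor_le[of ?s] by linarith
  have "ln ?s * real (card (primes_le x - primes_le ?s)) \<le> (\<Sum>p\<in>primes_le x - primes_le ?s. ln (real p))"
  proof (subst mult.commute, intro sum_bounded_below)
    fix p assume "p \<in> primes_le x - primes_le ?s"
    then have "?s \<le> real p" by (auto simp: primes_le_def)
    then show "ln ?s \<le> ln (real p)" using s by (intro ln_mono) auto
  qed
  also have "\<dots> \<le> (\<Sum>p\<in>primes_le x. ln (real p))"
    by (intro sum_mono2 finite_primes_le) (auto simp: primes_le_def ln_prime_nonneg)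
  also have "\<dots> \<le> 4 * x" using assms by (intro theta_le) auto
  finally have 2: "ln x * real (card (primes_le x - primes_le ?s)) \<le> 8 * x"
    using assms by (simp add: ln_sqrt)
  have "card (primes_le x) \<le> card (primes_le ?s) + card (primes_le x - primes_le ?s)"
    using card_Un_le[of "primes_le ?s" "primes_le x - primes_le ?s"]
      card_mono[of "primes_le ?s \<union> (primes_le x - primes_le ?s)" "primes_le x"] by auto
  then have "real (prime_pi x) \<le> ?s + real (card (primes_le x - primes_le ?s))"
    using 1 by (simp add: prime_pi_eq)
  then have "real (prime_pi x) * ln x \<le> (?s + real (card (primes_le x - primes_le ?s))) * ln x"
    using assms by (intro mult_right_mono) auto
  also have "\<dots> \<le> ?s * ln x + 8 * x" using 2 by (simp add: algebra_simps)
  also have "?s * ln x \<le> ?s * (2 * ?s)" using s lnx by (intro mult_left_mono) auto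
  also have "?s * (2 * ?s) = 2 * x" using assms by simp
  finally show ?thesis by simp
qed

lemma gen_set_primes: "gen_set {p. prime p} x = {n. 1 \<le> n \<and> real n \<le> x}"
  by (auto simp: gen_set_def)

text \<open>For P the set of all primes the counts in \<open>log_identity\<close> are floor(x / p).
  Replacing them by x / p costs at most the sum of ln p over p \<le> x, hence 4 x, and replacing
  floor x by x costs one more x.\<close>

lemma mertens:
  "\<exists>C\<ge>0. \<forall>x\<ge>1. \<bar>(\<Sum>p\<in>primes_le x. ln (real p) / real p) - ln x\<bar> \<le> C"
proof -
  obtain C where C: "C \<ge> 0" and id: "\<And>P x. x \<ge> 1 \<Longrightarrow>
     \<bar>real (card (gen_set P x)) * ln x - (\<Sum>p\<in>P \<inter> primes_le x. ln (real p) * real (card (gen_set P (x / p))))\<bar> \<le> C * x"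
    using log_identity by blast
  have "\<bar>(\<Sum>p\<in>primes_le x. ln (real p) / real p) - ln x\<bar> \<le> C + 5" if x: "x \<ge> 1" for x
  proof -
    let ?M = "\<Sum>p\<in>primes_le x. ln (real p) / real p"
    let ?F = "\<Sum>p\<in>primes_le x. ln (real p) * of_int \<lfloor>x / real p\<rfloor>"
    have "{p. prime p} \<inter> primes_le x = primes_le x" by (auto simp: primes_le_def)
    moreover have "real (card (gen_set {p. prime p} y)) = of_int \<lfloor>y\<rfloor>" if "y \<ge> 0" for y
      unfolding gen_set_primes by (rule card_nat_le[OF that])
    ultimately have 1: "\<bar>of_int \<lfloor>x\<rfloor> * ln x - ?F\<bar> \<le> C * x"
      using id[OF x, of "{p. prime p}"] x by simp
    have "0 \<le> ln x" "ln x \<le> x" using x ln_le_minus_one[of x] by auto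
    then have "(of_int \<lfloor>x\<rfloor> :: real) * ln x \<le> x * ln x" "x * ln x - 1 * ln x \<le> of_int \<lfloor>x\<rfloor> * ln x"
      unfolding left_diff_distrib[symmetric] by (intro mult_right_mono; linarith)+
    then have 2: "\<bar>of_int \<lfloor>x\<rfloor> * ln x - x * ln x\<bar> \<le> x" using \<open>ln x \<le> x\<close> by linarith
    have "x * ?M - ?F = (\<Sum>p\<in>primes_le x. ln (real p) * (x / real p - of_int \<lfloor>x / real p\<rfloor>))"
      by (simp add: sum_distrib_left right_diff_distrib sum_subtractf mult.commute)
    moreover have "(\<Sum>p\<in>primes_le x. ln (real p) * (x / real p - of_int \<lfloor>x / real p\<rfloor>)) \<ge> 0"
      by (intro sum_nonneg mult_nonneg_nonneg) (auto simp: primes_le_def ln_prime_nonneg)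
    moreover have "(\<Sum>p\<in>primes_le x. ln (real p) * (x / real p - of_int \<lfloor>x / real p\<rfloor>)) \<le> (\<Sum>p\<in>primes_le x. ln (real p) * 1)"
    proof (intro sum_mono mult_left_mono)
      fix p show "x / real p - of_int \<lfloor>x / real p\<rfloor> \<le> 1" by linarith
    qed (auto simp: primes_le_def ln_prime_nonneg)
    ultimately have 3: "\<bar>x * ?M - ?F\<bar> \<le> 4 * x" using theta_le[of x] x by simp
    have "\<bar>x * ?M - x * ln x\<bar> \<le> C * x + 5 * x" using 1 2 3 by linarith
    also have "x * ?M - x * ln x = x * (?M - ln x)" by (rule right_diff_distrib[symmetric])
    also have "\<bar>x * (?M - ln x)\<bar> = x * \<bar>?M - ln x\<bar>" using x by (simp add: abs_mult)
    finally have "x * \<bar>?M - ln x\<bar> \<le> x * (C + 5)" by (simp only: distrib_left mult.commute)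
    then show ?thesis using x by simp
  qed
  then show ?thesis using C by (intro exI[of _ "C + 5"]) auto
qed

section \<open>Integers and shifted primes avoiding a set of primes\<close>

lemma prod_primes_dvd:
  fixes S :: "nat set"
  assumes "finite S" "\<And>p. p \<in> S \<Longrightarrow> prime p" "\<And>p. p \<in> S \<Longrightarrow> p dvd n"
  shows "\<Prod>S dvd n"
  using assms
proof (induction S rule: finite_induct)
  case (insert p S)
  have "coprime p (\<Prod>S)"
    by (rule prod_coprime_right) (use insert in \<open>auto intro!: primes_coprime\<close>)
  then have "p * \<Prod>S dvd n" using insert by (intro divides_mult) auto
  then show ?case using insert by simp
qed simp

lemma prime_dvd_prod_primes_iff:
  fixes S :: "nat set"
  assumes "finite S" "\<And>p. p \<in> S \<Longrightarrow> prime p" "prime q"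
  shows "q dvd \<Prod>S \<longleftrightarrow> q \<in> S"
proof
  assume "q dvd \<Prod>S"
  then obtain p where "p \<in> S" "q dvd p" using assms(1,3) by (auto simp: prime_dvd_prod_iff)
  then show "q \<in> S" using assms primes_dvd_imp_eq by blast
qed (use assms in auto)

lemma inj_on_prod_primes:
  assumes "\<And>p. p \<in> Q \<Longrightarrow> prime (p :: nat)" "finite Q"
  shows "inj_on Prod (Pow Q)"
proof (rule inj_onI)
  fix S T assume ST: "S \<in> Pow Q" "T \<in> Pow Q" "\<Prod>S = \<Prod>T"
  have fin: "finite S" "finite T" using ST assms finite_subset by auto
  have "q dvd \<Prod>S' \<longleftrightarrow> q \<in> S'" if "q \<in> Q" "S' \<subseteq> Q" "finite S'" for q S'
    by (rule prime_dvd_prod_primes_iff) (use that assms in auto)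
  then have "q \<in> S \<longleftrightarrow> q \<in> T" if "q \<in> Q" for q
    using ST fin that by (metis PowD)
  then show "S = T" using ST by auto
qed

lemma sum_Pow_minus_one:
  assumes "finite A"
  shows "(\<Sum>S\<in>Pow A. (-1 :: real) ^ card S) = (if A = {} then 1 else 0)"
proof -
  have "(\<Prod>x\<in>A. (1::real) - 1) = (\<Sum>X\<in>Pow A. (-1) ^ card X * (\<Prod>x\<in>X. 1) * (\<Prod>x\<in>A-X. 1))"
    by (rule prod_diff_conv_sum[OF assms])
  then show ?thesis using assms by (cases "A = {}") (auto simp: zero_power card_gt_0_iff)
qed

lemma sum_sym_pairs:
  fixes g :: "nat \<Rightarrow> nat \<Rightarrow> real"
  assumes "finite A" "\<And>a b. g a b = g b a"
  shows "(\<Sum>a\<in>A. \<Sum>b\<in>A. g a b) = (\<Sum>a\<in>A. g a a) + 2 * (\<Sum>(a, b)\<in>{(a, b). a \<in> A \<and> b \<in> A \<and> a < b}. g a b)"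
proof -
  define L where "L = {(a, b). a \<in> A \<and> b \<in> A \<and> a < b}"
  define G where "G = {(a, b). a \<in> A \<and> b \<in> A \<and> b < a}"
  define E where "E = (\<lambda>a. (a, a)) ` A"
  have fin: "finite L" "finite G" "finite E"
    using assms(1) by (auto simp: L_def G_def E_def intro: finite_subset[of _ "A \<times> A"])
  have "A \<times> A = E \<union> (L \<union> G)" by (auto simp: L_def G_def E_def)
  then have "(\<Sum>a\<in>A. \<Sum>b\<in>A. g a b) = (\<Sum>(a, b)\<in>E \<union> (L \<union> G). g a b)"
    by (simp add: sum.cartesian_product)
  also have "\<dots> = (\<Sum>(a, b)\<in>E. g a b) + ((\<Sum>(a, b)\<in>L. g a b) + (\<Sum>(a, b)\<in>G. g a b))"
    using fin by (subst sum.union_disjoint; (subst sum.union_disjoint)?) (auto simp: L_def G_def E_def)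
  also have "(\<Sum>(a, b)\<in>E. g a b) = (\<Sum>a\<in>A. g a a)"
    unfolding E_def by (subst sum.reindex) (auto simp: inj_on_def)
  also have "(\<Sum>(a, b)\<in>G. g a b) = (\<Sum>(a, b)\<in>L. g a b)"
    by (rule sum.reindex_bij_witness[of _ prod.swap prod.swap]) (auto simp: L_def G_def assms(2))
  finally show ?thesis by (simp add: L_def)
qed

text \<open>Turan's variance argument: \<open>N i\<close>, the number of primes of \<open>R\<close>
  dividing \<open>f i\<close>, has mean about \<mu> and variance of order \<mu>, while every i
  counted on the left has \<open>N i = 0\<close> and contributes \<mu>^2. Only the moduli q and q q'
  enter, so distribution over \<open>D\<close> is enough.\<close>

lemma second_moment_bound:
  fixes I :: "'a set" and f :: "'a \<Rightarrow> nat" and R :: "nat set"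
  assumes I: "finite I" and R: "finite R" "\<And>q. q \<in> R \<Longrightarrow> prime q"
    and D: "finite D" "R \<subseteq> D" "\<And>q q'. q \<in> R \<Longrightarrow> q' \<in> R \<Longrightarrow> q < q' \<Longrightarrow> q * q' \<in> D"
    and lam: "\<mu> = (\<Sum>q\<in>R. 1 / real q)" "\<mu> \<ge> 1" and tau: "0 \<le> \<tau>" "\<tau> \<le> 1"
    and err: "(\<Sum>d\<in>D. \<bar>real (card {i\<in>I. d dvd f i}) - real (card I) / real d\<bar>) \<le> \<tau> * real (card I)"
  shows "real (card {i\<in>I. \<forall>q\<in>R. \<not> q dvd f i}) \<le> 6 / \<mu> * real (card I)"
proof -
  define X where "X = real (card I)"
  define c where "c d = real (card {i\<in>I. d dvd f i})" for d
  define r where "r d = c d - X / real d" for d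
  define L where "L = {(a, b). a \<in> R \<and> b \<in> R \<and> a < b}"
  define N where "N i = (\<Sum>q\<in>R. if q dvd f i then 1 else 0 :: real)" for i
  have finL: "finite L" by (rule finite_subset[of _ "R \<times> R"]) (auto simp: L_def R)
  have X0: "X \<ge> 0" by (simp add: X_def)
  have errR: "(\<Sum>q\<in>R. \<bar>r q\<bar>) \<le> \<tau> * X"
    using err sum_mono2[OF D(1,2), of "\<lambda>d. \<bar>r d\<bar>"] by (simp add: r_def c_def X_def)
  \<comment> \<open>Different pairs have different products, so the errors of all pairs are covered
    by the single error sum over \<open>D\<close>.\<close>
  have inj: "inj_on (\<lambda>(a, b). a * b) L"
  proof (rule inj_onI, clarsimp)
    fix a b a' b' assume *: "(a, b) \<in> L" "(a', b') \<in> L" and eq: "a * b = a' * b'"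
    have pr: "prime a" "prime b" "prime a'" "prime b'" "a < b" "a' < b'" using * R by (auto simp: L_def)
    have "a dvd a' * b'" using eq by (metis dvd_triv_left)
    then have "a = a' \<or> a = b'" using pr by (auto simp: prime_dvd_mult_iff dest: primes_dvd_imp_eq)
    moreover have "a > 0" using pr prime_gt_0_nat by blast
    ultimately show "a = a' \<and> b = b'"
    proof (elim disjE)
      assume "a = b'"
      then have "b = a'" using eq \<open>a > 0\<close> by (simp add: mult.commute)
      then show ?thesis using pr \<open>a = b'\<close> by simp
    qed (use eq in auto)
  qed
  have "(\<Sum>(a, b)\<in>L. \<bar>r (a * b)\<bar>) = (\<Sum>d\<in>(\<lambda>(a, b). a * b) ` L. \<bar>r d\<bar>)"
    by (subst sum.reindex[OF inj]) (auto intro: sum.cong)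
  also have "\<dots> \<le> (\<Sum>d\<in>D. \<bar>r d\<bar>)"
    by (rule sum_mono2[OF D(1)]) (auto simp: L_def D(3))
  also have "\<dots> \<le> \<tau> * X" using err by (simp add: r_def c_def X_def)
  finally have errL: "(\<Sum>(a, b)\<in>L. \<bar>r (a * b)\<bar>) \<le> \<tau> * X" .
  have cI: "(\<Sum>i\<in>I. if P i then 1 else 0 :: real) = real (card {i\<in>I. P i})" for P
    using I by (simp add: sum.If_cases Int_def)
  have sumN: "(\<Sum>i\<in>I. N i) = (\<Sum>q\<in>R. c q)"
    unfolding N_def by (subst sum.swap) (simp add: cI c_def)
  have sumN2: "(\<Sum>i\<in>I. (N i)\<^sup>2) = (\<Sum>q\<in>R. c q) + 2 * (\<Sum>(a, b)\<in>L. c (a * b))"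
  proof -
    have "(N i)\<^sup>2 = (\<Sum>q\<in>R. if q dvd f i then 1 else 0) + 2 * (\<Sum>(a, b)\<in>L. if a * b dvd f i then 1 else 0)" for i
    proof -
      have "(N i)\<^sup>2 = (\<Sum>a\<in>R. \<Sum>b\<in>R. (if a dvd f i then 1 else 0) * (if b dvd f i then 1 else 0))"
        by (simp add: N_def power2_eq_square sum_product)
      also have "\<dots> = (\<Sum>a\<in>R. (if a dvd f i then 1 else 0) * (if a dvd f i then 1 else 0))
          + 2 * (\<Sum>(a, b)\<in>{(a, b). a \<in> R \<and> b \<in> R \<and> a < b}. (if a dvd f i then 1 else 0) * (if b dvd f i then 1 else 0))"
        by (rule sum_sym_pairs) (use R in auto)
      also have "(\<Sum>a\<in>R. (if a dvd f i then 1 else 0) * (if a dvd f i then 1 else 0)) = (\<Sum>q\<in>R. if q dvd f i then 1 else 0 :: real)"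
        by (rule sum.cong) auto
      also have "(\<Sum>(a, b)\<in>{(a, b). a \<in> R \<and> b \<in> R \<and> a < b}. (if a dvd f i then 1 else 0) * (if b dvd f i then 1 else 0))
          = (\<Sum>(a, b)\<in>L. if a * b dvd f i then 1 else 0 :: real)"
      proof (rule sum.cong, goal_cases)
        case 1 then show ?case by (simp add: L_def)
      next
        case (2 x)
        then obtain a b where x: "x = (a, b)" "a \<in> R" "b \<in> R" "a < b" by (auto simp: L_def)
        have "coprime a b" using x R by (intro primes_coprime) auto
        then have "a * b dvd f i \<longleftrightarrow> a dvd f i \<and> b dvd f i"
          by (auto intro: divides_mult dvd_mult_left dvd_mult_right)
        then show ?case by (simp add: x)
      qed
      finally show ?thesis .
    qed
    then have "(\<Sum>i\<in>I. (N i)\<^sup>2) = (\<Sum>i\<in>I. \<Sum>q\<in>R. if q dvd f i then 1 else 0) + 2 * (\<Sum>i\<in>I. \<Sum>(a, b)\<in>L. if a * b dvd f i then 1 else 0)"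
      by (simp add: sum.distrib sum_distrib_left)
    also have "(\<Sum>i\<in>I. \<Sum>q\<in>R. if q dvd f i then 1 else 0 :: real) = (\<Sum>q\<in>R. c q)"
      by (subst sum.swap) (simp add: cI c_def)
    also have "(\<Sum>i\<in>I. \<Sum>(a, b)\<in>L. if a * b dvd f i then 1 else 0 :: real) = (\<Sum>(a, b)\<in>L. c (a * b))"
      by (subst sum.swap) (simp add: cI c_def case_prod_unfold)
    finally show ?thesis .
  qed
  have sc: "\<bar>(\<Sum>q\<in>R. c q) - X * \<mu>\<bar> \<le> \<tau> * X"
  proof -
    have "(\<Sum>q\<in>R. c q) - X * \<mu> = (\<Sum>q\<in>R. r q)"
      by (simp add: r_def lam sum_subtractf sum_distrib_left)
    then show ?thesis using sum_abs[of r R] errR by linarith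
  qed
  have sc2: "2 * (\<Sum>(a, b)\<in>L. c (a * b)) \<le> X * \<mu>\<^sup>2 + 2 * \<tau> * X"
  proof -
    have "\<mu>\<^sup>2 = (\<Sum>a\<in>R. \<Sum>b\<in>R. 1 / real a * (1 / real b))"
      by (simp add: lam power2_eq_square sum_product)
    also have "\<dots> = (\<Sum>a\<in>R. 1 / real a * (1 / real a)) + 2 * (\<Sum>(a, b)\<in>{(a, b). a \<in> R \<and> b \<in> R \<and> a < b}. 1 / real a * (1 / real b))"
      by (rule sum_sym_pairs) (use R in auto)
    finally have "2 * (\<Sum>(a, b)\<in>L. 1 / real a * (1 / real b)) \<le> \<mu>\<^sup>2"
      unfolding L_def[symmetric] using sum_nonneg[of R "\<lambda>a. 1 / real a * (1 / real a)"] by simp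
    then have 1: "X * (2 * (\<Sum>(a, b)\<in>L. 1 / real a * (1 / real b))) \<le> X * \<mu>\<^sup>2"
      using X0 by (rule mult_left_mono)
    have "(\<Sum>(a, b)\<in>L. c (a * b)) \<le> (\<Sum>(a, b)\<in>L. X * (1 / real a * (1 / real b)) + \<bar>r (a * b)\<bar>)"
      by (rule sum_mono) (auto simp: r_def)
    also have "\<dots> = X * (\<Sum>(a, b)\<in>L. 1 / real a * (1 / real b)) + (\<Sum>(a, b)\<in>L. \<bar>r (a * b)\<bar>)"
      by (simp add: case_prod_unfold sum.distrib sum_distrib_left)
    finally show ?thesis using 1 errL by linarith
  qed
  define B where "B = {i\<in>I. \<forall>q\<in>R. \<not> q dvd f i}"
  have "real (card B) * \<mu>\<^sup>2 = (\<Sum>i\<in>B. (N i - \<mu>)\<^sup>2)"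
    by (simp add: B_def N_def)
  also have "\<dots> \<le> (\<Sum>i\<in>I. (N i - \<mu>)\<^sup>2)"
    by (rule sum_mono2[OF I]) (auto simp: B_def)
  also have "\<dots> = (\<Sum>i\<in>I. (N i)\<^sup>2) - 2 * \<mu> * (\<Sum>i\<in>I. N i) + X * \<mu>\<^sup>2"
    by (simp add: power2_diff sum.distrib sum_subtractf sum_distrib_left sum_distrib_right X_def mult_ac)
  also have "\<dots> = (\<Sum>q\<in>R. c q) + 2 * (\<Sum>(a, b)\<in>L. c (a * b)) - 2 * \<mu> * (\<Sum>q\<in>R. c q) + X * \<mu>\<^sup>2"
    by (simp add: sumN sumN2)
  also have "\<dots> \<le> (X * \<mu> + \<tau> * X) + (X * \<mu>\<^sup>2 + 2 * \<tau> * X) - 2 * \<mu> * (X * \<mu> - \<tau> * X) + X * \<mu>\<^sup>2"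
  proof -
    have "2 * \<mu> * (X * \<mu> - \<tau> * X) \<le> 2 * \<mu> * (\<Sum>q\<in>R. c q)"
      using sc lam by (intro mult_left_mono) auto
    then show ?thesis using sc sc2 by linarith
  qed
  also have "\<dots> = X * (\<mu> + 3 * \<tau> + 2 * \<mu> * \<tau>)" by (simp add: algebra_simps power2_eq_square)
  also have "\<dots> \<le> X * (6 * \<mu>)"
  proof (rule mult_left_mono[OF _ X0])
    have "\<mu> * \<tau> \<le> \<mu> * 1" using tau lam by (intro mult_left_mono) auto
    then show "\<mu> + 3 * \<tau> + 2 * \<mu> * \<tau> \<le> 6 * \<mu>" using tau lam by linarith
  qed
  finally have "real (card B) * \<mu> * \<mu> \<le> X * 6 * \<mu>" by (simp add: power2_eq_square mult_ac)
  then have "real (card B) * \<mu> \<le> X * 6" using lam by simp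
  then show ?thesis using lam by (simp add: B_def X_def field_simps)
qed

text \<open>Dropping the terms with \<open>\<Prod>S > Z\<close> affects only those \<open>i\<close> for which the part of \<open>f i\<close> made of primes
  from \<open>Q\<close> exceeds \<open>Z\<close>. The cofactor is then less than \<open>z\<close>, so \<open>f i\<close> has no prime factor in \<open>(z, w]\<close>,
  which is rare by the second moment bound. This replaces an upper bound sieve.\<close>

lemma truncated_inclusion_exclusion:
  fixes I :: "'a set" and f :: "'a \<Rightarrow> nat" and Q :: "nat set" and y z Z w t :: real
  assumes I: "finite I" "\<And>i. i \<in> I \<Longrightarrow> 1 \<le> f i \<and> real (f i) \<le> t"
    and Q: "finite Q" "\<And>q. q \<in> Q \<Longrightarrow> prime q \<and> y < real q" and y: "1 < y" "t \<le> y ^ N"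
    and z: "1 \<le> z" "z \<le> w" "w \<le> y" "w * w \<le> Z" "t = z * Z"
    and D: "D = {d. 1 \<le> d \<and> real d \<le> Z \<and> (\<forall>p. prime p \<and> p dvd d \<longrightarrow> z < real p)}"
    and lam: "\<mu> = (\<Sum>q\<in>primes_le w - primes_le z. 1 / real q)" "\<mu> \<ge> 1" and tau: "0 \<le> \<tau>" "\<tau> \<le> 1"
    and err: "(\<Sum>d\<in>D. \<bar>real (card {i\<in>I. d dvd f i}) - real (card I) / real d\<bar>) \<le> \<tau> * real (card I)"
  shows "\<bar>real (card {i\<in>I. \<forall>q\<in>Q. \<not> q dvd f i}) -
      real (card I) * (\<Sum>S | S \<subseteq> Q \<and> real (\<Prod>S) \<le> Z. (-1) ^ card S / real (\<Prod>S))\<bar>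
      \<le> ((1 + 2 ^ N) * (6 / \<mu>) + \<tau>) * real (card I)"
proof -
  define X where "X = real (card I)"
  define c where "c d = real (card {i\<in>I. d dvd f i})" for d
  define QI where "QI i = {q\<in>Q. q dvd f i}" for i
  define \<S> where "\<S> = {S. S \<subseteq> Q \<and> real (\<Prod>S) \<le> Z}"
  define B where "B = {i\<in>I. real (\<Prod>(QI i)) > Z}"
  let ?R = "primes_le w - primes_le z"
  have X0: "X \<ge> 0" by (simp add: X_def)
  have Z1: "1 \<le> Z" using z mult_mono[of 1 w 1 w] by linarith
  have finS: "finite \<S>" by (rule finite_subset[of _ "Pow Q"]) (auto simp: \<S>_def Q)
  have finQI: "finite (QI i)" for i using Q by (auto simp: QI_def)
  have finD: "finite D"
    unfolding D by (rule finite_subset[OF _ finite_nat_le[of Z]]) auto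
  have prQ: "prime q" "y < real q" if "q \<in> Q" for q using Q that by auto
  have dvd_iff: "\<Prod>S dvd f i \<longleftrightarrow> S \<subseteq> QI i" if "S \<subseteq> Q" for S i
  proof (rule iffI)
    have finS: "finite S" using that Q finite_subset by auto
    assume S: "\<Prod>S dvd f i"
    show "S \<subseteq> QI i"
    proof
      fix q assume "q \<in> S"
      then have "q dvd \<Prod>S" using dvd_prodI[OF finS, of q "\<lambda>x. x"] by simp
      then show "q \<in> QI i" using S that \<open>q \<in> S\<close> dvd_trans by (auto simp: QI_def)
    qed
  next
    assume S: "S \<subseteq> QI i"
    then have "finite S" using finQI finite_subset by blast
    then show "\<Prod>S dvd f i"
      by (rule prod_primes_dvd) (use S prQ in \<open>auto simp: QI_def\<close>)
  qed
  have QI_le: "real (\<Prod>(QI i)) \<le> t" if "i \<in> I" for i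
  proof -
    have "\<Prod>(QI i) dvd f i" using dvd_iff[of "QI i" i] by (auto simp: QI_def)
    then have "\<Prod>(QI i) \<le> f i" using I(2)[OF that] by (intro dvd_imp_le) auto
    then show ?thesis using I(2)[OF that] by (meson of_nat_mono order_trans)
  qed
  \<comment> \<open>At most N primes above y fit into \<open>f i\<close> \<le> y^N, so for an
    exceptional i there are at most 2^N terms and the trivial bound is affordable.\<close>
  have cardQI: "card (QI i) \<le> N" if "i \<in> I" for i
  proof -
    have "y ^ card (QI i) = (\<Prod>q\<in>QI i. y)" by simp
    also have "\<dots> \<le> (\<Prod>q\<in>QI i. real q)" by (rule prod_mono) (use prQ y in \<open>auto simp: QI_def intro: less_imp_le\<close>)
    also have "\<dots> = real (\<Prod>(QI i))" by simp
    also have "\<dots> \<le> y ^ N" using QI_le[OF that] y by linarith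
    finally show ?thesis using y by (simp add: power_increasing_iff)
  qed
  have Bsub: "B \<subseteq> {i\<in>I. \<forall>q\<in>?R. \<not> q dvd f i}"
  proof -
    have False if i: "i \<in> I" "Z < real (\<Prod>(QI i))" and q: "q \<in> primes_le w" "q \<notin> primes_le z" "q dvd f i" for i q
    proof -
    have pq: "prime q" "real q \<le> w" "z < real q" using q by (auto simp: primes_le_def)
    have nq: "q \<notin> QI i" using pq prQ[of q] z by (auto simp: QI_def)
    have "\<Prod>(insert q (QI i)) dvd f i"
      by (rule prod_primes_dvd) (use finQI pq q prQ in \<open>auto simp: QI_def\<close>)
    then have "q * \<Prod>(QI i) dvd f i" using nq finQI by simp
    then have "q * \<Prod>(QI i) \<le> f i" using I(2)[OF i(1)] by (intro dvd_imp_le) auto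
    then have "real q * real (\<Prod>(QI i)) \<le> t"
      using I(2)[OF i(1)] by (metis of_nat_le_iff of_nat_mult order_trans)
    moreover have "z * Z < real q * real (\<Prod>(QI i))"
      using i pq z Z1 by (intro mult_strict_mono) auto
    ultimately show False using z by simp
    qed
    then show ?thesis unfolding B_def by blast
  qed
  have R: "finite ?R" "\<And>q. q \<in> ?R \<Longrightarrow> prime q"
    using finite_primes_le by (blast, auto simp: primes_le_def)
  have RD: "?R \<subseteq> D"
  proof
    fix q assume q: "q \<in> ?R"
    then have "prime q" "real q \<le> w" "z < real q" by (auto simp: primes_le_def)
    moreover have "w \<le> Z" using z mult_mono[of 1 w w w] by linarith
    ultimately show "q \<in> D" by (auto simp: D prime_ge_Suc_0_nat dest: primes_dvd_imp_eq)
  qed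
  have RRD: "q * q' \<in> D" if "q \<in> ?R" "q' \<in> ?R" for q q'
  proof -
    have *: "prime q" "real q \<le> w" "z < real q" "prime q'" "real q' \<le> w" "z < real q'"
      using that by (auto simp: primes_le_def)
    have "real (q * q') \<le> w * w" using * z unfolding of_nat_mult by (intro mult_mono) auto
    then have "real (q * q') \<le> Z" using z by linarith
    moreover have "1 \<le> q * q'" using * by (simp add: prime_gt_0_nat Suc_leI)
    ultimately show ?thesis using * by (auto simp: D prime_dvd_mult_iff dest: primes_dvd_imp_eq)
  qed
  have "real (card B) \<le> real (card {i\<in>I. \<forall>q\<in>?R. \<not> q dvd f i})"
    using Bsub I by (intro of_nat_mono card_mono) auto
  also have "\<dots> \<le> 6 / \<mu> * X"
    unfolding X_def by (rule second_moment_bound[OF I(1) R finD RD _ lam tau err]) (auto intro: RRD)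
  finally have cardB: "real (card B) \<le> 6 / \<mu> * X" .
  have fS: "finite {S\<in>\<S>. S \<subseteq> QI i}" for i using finS by auto
  have pt: "\<bar>(if QI i = {} then 1 else 0) - (\<Sum>S\<in>{S\<in>\<S>. S \<subseteq> QI i}. (-1) ^ card S)\<bar> \<le> (if i \<in> B then 1 + 2 ^ N else 0 :: real)"
    if i: "i \<in> I" for i
  proof (cases "i \<in> B")
    case False
    have "{S\<in>\<S>. S \<subseteq> QI i} = Pow (QI i)"
    proof
      show "Pow (QI i) \<subseteq> {S\<in>\<S>. S \<subseteq> QI i}"
      proof
        fix S assume S: "S \<in> Pow (QI i)"
        have pos: "\<Prod>(QI i) > 0" by (rule prod_pos) (use prQ in \<open>auto simp: QI_def prime_gt_0_nat\<close>)
        have "\<Prod>S dvd \<Prod>(QI i)" using S finQI by (intro prod_dvd_prod_subset) auto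
        then have "\<Prod>S \<le> \<Prod>(QI i)" using pos by (intro dvd_imp_le) auto
        then have "real (\<Prod>S) \<le> real (\<Prod>(QI i))" by (rule of_nat_mono)
        also have "\<dots> \<le> Z" using False i by (auto simp: B_def)
        finally have "real (\<Prod>S) \<le> Z" .
        then show "S \<in> {S\<in>\<S>. S \<subseteq> QI i}" using S by (auto simp: \<S>_def QI_def)
      qed
    qed auto
    then show ?thesis using sum_Pow_minus_one[OF finQI[of i]] False by simp
  next
    case True
    have "\<bar>\<Sum>S\<in>{S\<in>\<S>. S \<subseteq> QI i}. (-1 :: real) ^ card S\<bar> \<le> (\<Sum>S\<in>{S\<in>\<S>. S \<subseteq> QI i}. \<bar>(-1 :: real) ^ card S\<bar>)"
      by (rule sum_abs)
    also have "\<dots> = real (card {S\<in>\<S>. S \<subseteq> QI i})" by (simp add: power_abs)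
    also have "\<dots> \<le> real (card (Pow (QI i)))"
      using finQI by (intro of_nat_mono card_mono) auto
    also have "\<dots> = 2 ^ card (QI i)" using finQI by (simp add: card_Pow)
    also have "\<dots> \<le> 2 ^ N" by (rule power_increasing[OF cardQI[OF i]]) simp
    finally have "\<bar>\<Sum>S\<in>{S\<in>\<S>. S \<subseteq> QI i}. (-1 :: real) ^ card S\<bar> \<le> 2 ^ N" .
    moreover have "\<bar>(if QI i = {} then 1 else 0) - s\<bar> \<le> 1 + \<bar>s\<bar>" for s :: real by auto
    ultimately show ?thesis using True by (smt (verit))
  qed
  have fin: "real (card {i\<in>I. \<forall>q\<in>Q. \<not> q dvd f i}) = (\<Sum>i\<in>I. if QI i = {} then 1 else 0)"
  proof -
    have "{i\<in>I. \<forall>q\<in>Q. \<not> q dvd f i} = {i\<in>I. QI i = {}}" by (auto simp: QI_def)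
    then show ?thesis using I by (simp add: sum.If_cases Int_def)
  qed
  have swap: "(\<Sum>i\<in>I. \<Sum>S\<in>{S\<in>\<S>. S \<subseteq> QI i}. (-1) ^ card S) = (\<Sum>S\<in>\<S>. (-1) ^ card S * c (\<Prod>S))"
  proof -
    have "(\<Sum>i\<in>I. \<Sum>S\<in>{S\<in>\<S>. S \<subseteq> QI i}. (-1 :: real) ^ card S) = (\<Sum>i\<in>I. \<Sum>S\<in>\<S>. if S \<subseteq> QI i then (-1) ^ card S else 0)"
      by (rule sum.cong[OF refl]) (rule sum.inter_filter[OF finS])
    also have "\<dots> = (\<Sum>S\<in>\<S>. \<Sum>i\<in>I. if S \<subseteq> QI i then (-1) ^ card S else 0)" by (rule sum.swap)
    also have "\<dots> = (\<Sum>S\<in>\<S>. (-1) ^ card S * c (\<Prod>S))"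
    proof (rule sum.cong[OF refl])
      fix S assume "S \<in> \<S>"
      then have "{i\<in>I. S \<subseteq> QI i} = {i\<in>I. \<Prod>S dvd f i}" using dvd_iff[of S] by (auto simp: \<S>_def)
      then show "(\<Sum>i\<in>I. if S \<subseteq> QI i then (-1) ^ card S else 0) = (-1) ^ card S * c (\<Prod>S)"
        using I by (simp add: sum.If_cases Int_def c_def)
    qed
    finally show ?thesis .
  qed
  have "\<bar>real (card {i\<in>I. \<forall>q\<in>Q. \<not> q dvd f i}) - (\<Sum>S\<in>\<S>. (-1) ^ card S * c (\<Prod>S))\<bar>
      = \<bar>\<Sum>i\<in>I. (if QI i = {} then 1 else 0) - (\<Sum>S\<in>{S\<in>\<S>. S \<subseteq> QI i}. (-1) ^ card S)\<bar>"
    unfolding fin swap[symmetric] by (simp add: sum_subtractf)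
  also have "\<dots> \<le> (\<Sum>i\<in>I. if i \<in> B then 1 + 2 ^ N else 0)"
    by (rule order_trans[OF sum_abs]) (rule sum_mono[OF pt])
  also have "\<dots> = (1 + 2 ^ N) * real (card B)"
  proof -
    have "I \<inter> B = B" by (auto simp: B_def)
    then show ?thesis using I by (simp add: sum.If_cases)
  qed
  also have "\<dots> \<le> (1 + 2 ^ N) * (6 / \<mu> * X)" by (intro mult_left_mono cardB) auto
  finally have part1: "\<bar>real (card {i\<in>I. \<forall>q\<in>Q. \<not> q dvd f i}) - (\<Sum>S\<in>\<S>. (-1) ^ card S * c (\<Prod>S))\<bar> \<le> (1 + 2 ^ N) * (6 / \<mu> * X)" .
  have "\<bar>(\<Sum>S\<in>\<S>. (-1) ^ card S * c (\<Prod>S)) - X * (\<Sum>S\<in>\<S>. (-1) ^ card S / real (\<Prod>S))\<bar>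
      = \<bar>\<Sum>S\<in>\<S>. (-1) ^ card S * (c (\<Prod>S) - X / real (\<Prod>S))\<bar>"
    by (simp add: sum_distrib_left sum_subtractf right_diff_distrib mult.commute)
  also have "\<dots> \<le> (\<Sum>S\<in>\<S>. \<bar>c (\<Prod>S) - X / real (\<Prod>S)\<bar>)"
    by (rule order_trans[OF sum_abs]) (simp add: abs_mult power_abs)
  also have "\<dots> = (\<Sum>d\<in>Prod ` \<S>. \<bar>c d - X / real d\<bar>)"
  proof -
    have "inj_on Prod \<S>"
      by (rule inj_on_subset[OF inj_on_prod_primes[of Q]]) (use Q in \<open>auto simp: \<S>_def\<close>)
    then show ?thesis by (simp add: sum.reindex)
  qed
  also have "\<dots> \<le> (\<Sum>d\<in>D. \<bar>c d - X / real d\<bar>)"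
  proof (rule sum_mono2[OF finD])
    show "Prod ` \<S> \<subseteq> D"
    proof
      fix d assume "d \<in> Prod ` \<S>"
      then obtain S where S: "S \<subseteq> Q" "real (\<Prod>S) \<le> Z" "d = \<Prod>S" by (auto simp: \<S>_def)
      have finS: "finite S" using S Q finite_subset by auto
      have "\<Prod>S > 0" by (rule prod_pos) (use prQ S in \<open>auto simp: prime_gt_0_nat\<close>)
      moreover have "z < real p" if "prime p" "p dvd \<Prod>S" for p
      proof -
        have "p \<in> S" using prime_dvd_prod_primes_iff[OF finS _ that(1)] that S prQ by auto
        then show ?thesis using prQ[of p] S z by auto
      qed
      ultimately show "d \<in> D" using S by (auto simp: D)
    qed
  qed auto
  also have "\<dots> \<le> \<tau> * X" using err by (simp add: c_def X_def)
  finally have part2: "\<bar>(\<Sum>S\<in>\<S>. (-1) ^ card S * c (\<Prod>S)) - X * (\<Sum>S\<in>\<S>. (-1) ^ card S / real (\<Prod>S))\<bar> \<le> \<tau> * X" .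
  have "\<bar>real (card {i\<in>I. \<forall>q\<in>Q. \<not> q dvd f i}) - X * (\<Sum>S\<in>\<S>. (-1) ^ card S / real (\<Prod>S))\<bar>
      \<le> (1 + 2 ^ N) * (6 / \<mu> * X) + \<tau> * X"
    using part1 part2 by linarith
  also have "(1 + 2 ^ N) * (6 / \<mu> * X) + \<tau> * X = ((1 + 2 ^ N) * (6 / \<mu>) + \<tau>) * X"
    by (simp only: distrib_right mult.assoc)
  finally show ?thesis unfolding X_def \<S>_def .
qed


text \<open>By Mertens, ln p / p sums to at least ln w - 2 C over (w, w^2], where ln p \<le> 2 ln w;
  for ln w \<ge> 4 C this leaves at least 1/4 for the sum of 1/p. The m successive squarings
  contribute independently.\<close>

lemma sum_recip_primes_ge:
  "\<exists>w0>1. \<forall>w\<ge>w0. \<forall>m. real m / 4 \<le> (\<Sum>p\<in>primes_le (w ^ (2 ^ m)) - primes_le w. 1 / real p)"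
proof -
  obtain C where C: "C \<ge> 0" "\<And>x. x \<ge> 1 \<Longrightarrow> \<bar>(\<Sum>p\<in>primes_le x. ln (real p) / real p) - ln x\<bar> \<le> C"
    using mertens by blast
  define w0 where "w0 = exp (4 * C + 1)"
  have w0: "w0 > 1" using C by (simp add: w0_def)
  have single: "1 / 4 \<le> (\<Sum>p\<in>primes_le (w ^ 2) - primes_le w. 1 / real p)" if w: "w \<ge> w0" for w
  proof -
    have w1: "w > 1" using w w0 by simp
    have "ln w0 \<le> ln w" using w w0 by (intro ln_mono) auto
    then have lw: "ln w \<ge> 4 * C + 1" by (simp add: w0_def)
    have ww: "w \<le> w ^ 2" using w1 by (simp add: power2_eq_square)
    have "(\<Sum>p\<in>primes_le (w ^ 2) - primes_le w. ln (real p) / real p)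
        = (\<Sum>p\<in>primes_le (w ^ 2). ln (real p) / real p) - (\<Sum>p\<in>primes_le w. ln (real p) / real p)"
      by (rule sum_diff) (use primes_le_mono[OF ww] in auto)
    also have "\<dots> \<ge> ln (w ^ 2) - C - (ln w + C)"
      using C(2)[of w] C(2)[of "w ^ 2"] w1 ww by linarith
    finally have "ln w - 2 * C \<le> (\<Sum>p\<in>primes_le (w ^ 2) - primes_le w. ln (real p) / real p)"
      using w1 by (simp add: ln_realpow)
    also have "\<dots> \<le> (\<Sum>p\<in>primes_le (w ^ 2) - primes_le w. 2 * ln w * (1 / real p))"
    proof (rule sum_mono)
      fix p assume p: "p \<in> primes_le (w ^ 2) - primes_le w"
      then have "0 < real p" "real p \<le> w ^ 2" by (auto simp: primes_le_def prime_gt_0_nat)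
      then have "ln (real p) \<le> ln (w ^ 2)" by (intro ln_mono) auto
      also have "\<dots> = 2 * ln w" using w1 by (simp add: ln_realpow)
      finally have "ln (real p) / real p \<le> 2 * ln w / real p" by (intro divide_right_mono) auto
      then show "ln (real p) / real p \<le> 2 * ln w * (1 / real p)" by simp
    qed
    also have "\<dots> = 2 * ln w * (\<Sum>p\<in>primes_le (w ^ 2) - primes_le w. 1 / real p)"
      by (simp add: sum_distrib_left)
    finally have "ln w * (1 / 4) \<le> ln w * (\<Sum>p\<in>primes_le (w ^ 2) - primes_le w. 1 / real p)"
      using lw by linarith
    then show ?thesis using lw C(1) by (simp only: mult_le_cancel_left)
  qed
  have "real m / 4 \<le> (\<Sum>p\<in>primes_le (w ^ (2 ^ m)) - primes_le w. 1 / real p)" if w: "w \<ge> w0" for w m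
  proof (induction m)
    case (Suc m)
    let ?W = "w ^ (2 ^ m)"
    have w1: "w \<ge> 1" using w w0 by simp
    have Ww: "w \<le> ?W" using power_increasing[of 1 "2 ^ m" w] w1 by simp
    have W2: "w ^ (2 ^ Suc m) = ?W ^ 2" by (simp flip: power_mult add: mult.commute)
    have "?W \<le> ?W ^ 2" using Ww w1 by (simp add: power2_eq_square)
    then have eq: "primes_le (?W ^ 2) - primes_le w = (primes_le ?W - primes_le w) \<union> (primes_le (?W ^ 2) - primes_le ?W)"
      using primes_le_mono[of ?W "?W ^ 2"] primes_le_mono[OF Ww] by auto
    have "(\<Sum>p\<in>primes_le (?W ^ 2) - primes_le w. 1 / real p) =
       (\<Sum>p\<in>primes_le ?W - primes_le w. 1 / real p) + (\<Sum>p\<in>primes_le (?W ^ 2) - primes_le ?W. 1 / real p)"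
      unfolding eq by (rule sum.union_disjoint) auto
    moreover have "1 / 4 \<le> (\<Sum>p\<in>primes_le (?W ^ 2) - primes_le ?W. 1 / real p)"
      by (rule single) (use Ww w in linarith)
    ultimately show ?case unfolding W2 using Suc by (simp add: add_divide_distrib)
  qed simp
  with w0 show ?thesis by blast
qed

text \<open>\<open>d\<close> has at most M prime factors, all above z, so \<open>totient d\<close>
  is at least d (1 - M / z). Hence for rough moduli the density 1 / \<open>totient d\<close> for
  primes and 1 / d for integers agree up to a negligible factor, which makes the two counts
  comparable.\<close>

lemma recip_totient_rough:
  assumes d: "1 \<le> d" "real d \<le> z ^ M" and rough: "\<And>p. prime p \<Longrightarrow> p dvd d \<Longrightarrow> z < real p"
    and z: "1 < z" "real M / z \<le> 1 / 2"
  shows "\<bar>1 / real (totient d) - 1 / real d\<bar> \<le> 2 * real M / z * (1 / real d)"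
proof -
  have pf: "z < real p" if "p \<in> prime_factors d" for p
    using that rough by (auto simp: in_prime_factors_iff)
  have "z ^ card (prime_factors d) = (\<Prod>p\<in>prime_factors d. z)" by simp
  also have "\<dots> \<le> (\<Prod>p\<in>prime_factors d. real p)" by (rule prod_mono) (use pf z in \<open>auto intro: less_imp_le\<close>)
  also have "\<dots> = real (\<Prod>(prime_factors d))" by simp
  also have "\<Prod>(prime_factors d) \<le> d"
    using d by (intro dvd_imp_le prod_primes_dvd) (auto simp: in_prime_factors_iff)
  then have "real (\<Prod>(prime_factors d)) \<le> real d" by (rule of_nat_mono)
  also have "\<dots> \<le> z ^ M" by fact
  finally have cM: "card (prime_factors d) \<le> M" using z by (simp add: power_increasing_iff)
  have "1 - real M / z \<le> 1 - (\<Sum>p\<in>prime_factors d. 1 / real p)"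
  proof -
    have "(\<Sum>p\<in>prime_factors d. 1 / real p) \<le> real (card (prime_factors d)) * (1 / z)"
    proof (rule sum_bounded_above)
      fix p assume "p \<in> prime_factors d"
      then show "1 / real p \<le> 1 / z" using pf[of p] z by (intro divide_left_mono) auto
    qed
    also have "\<dots> \<le> real M * (1 / z)" using cM z by (intro mult_right_mono) auto
    finally show ?thesis by simp
  qed
  also have "\<dots> \<le> (\<Prod>p\<in>prime_factors d. 1 - 1 / real p)"
    by (rule Weierstrass_prod_ineq) (auto simp: in_prime_factors_iff prime_ge_1_nat)
  finally have lo: "1 - real M / z \<le> (\<Prod>p\<in>prime_factors d. 1 - 1 / real p)" .
  define a where "a = (\<Prod>p\<in>prime_factors d. 1 - 1 / real p)"
  have a2: "1 - real M / z \<le> a" using lo by (simp add: a_def)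
  have a_half: "1 / 2 \<le> a" using a2 z(2) by linarith
  have a_pos: "a > 0" using a_half by linarith
  have a1: "a \<le> 1" unfolding a_def by (rule prod_le_1) (auto simp: in_prime_factors_iff prime_ge_1_nat)
  have phi: "real (totient d) = real d * a" unfolding a_def by (rule totient_formula2)
  have d0: "real d > 0" using d by simp
  have "1 / real (totient d) - 1 / real d = 1 / real d * ((1 - a) / a)"
    using d0 a_pos by (simp add: phi field_simps)
  moreover have "(1 - a) / a \<le> 2 * real M / z"
    using frac_le[of "real M / z" "1 - a" "1 / 2" a] a1 a2 a_half z by (simp add: mult.commute)
  moreover have "(1 - a) / a \<ge> 0" using a_pos a1 by simp
  moreover have "\<bar>1 / real d * b\<bar> \<le> c * (1 / real d)" if "0 \<le> b" "b \<le> c" for b c :: real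
    using that d0 by (simp add: abs_mult divide_right_mono)
  ultimately show ?thesis by metis
qed

section \<open>From integers to shifted primes\<close>

lemma sum_recip_le:
  assumes "finite D" "\<And>d. d \<in> D \<Longrightarrow> 1 \<le> d \<and> real d \<le> t" "t \<ge> 1"
  shows "(\<Sum>d\<in>D. 1 / real d) \<le> 1 + ln t"
proof -
  have "(\<Sum>d\<in>D. 1 / real d) \<le> (\<Sum>d\<in>{1..nat \<lfloor>t\<rfloor>}. 1 / real d)"
    by (rule sum_mono2) (use assms in \<open>auto simp: le_nat_iff le_floor_iff\<close>)
  also have "\<dots> \<le> ln (real (nat \<lfloor>t\<rfloor>)) + 1"
  proof -
    have "(\<Sum>d\<in>{1..Suc n}. 1 / real d) \<le> ln (real (Suc n)) + 1" for n
    proof (induction n)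
      case (Suc n)
      have "ln (real (Suc n) / real (Suc (Suc n))) \<le> real (Suc n) / real (Suc (Suc n)) - 1"
        by (rule ln_le_minus_one) simp
      moreover have "ln (real (Suc n) / real (Suc (Suc n))) = ln (real (Suc n)) - ln (real (Suc (Suc n)))"
        by (simp add: ln_div)
      moreover have "real (Suc n) / real (Suc (Suc n)) - 1 = - (1 / real (Suc (Suc n)))"
        by (simp add: field_simps)
      moreover have "(\<Sum>d\<in>{1..Suc (Suc n)}. 1 / real d) = (\<Sum>d\<in>{1..Suc n}. 1 / real d) + 1 / real (Suc (Suc n))" by simp
      ultimately show ?case using Suc.IH by linarith
    qed simp
    from this[of "nat \<lfloor>t\<rfloor> - 1"] show ?thesis using assms by (simp add: le_nat_iff Suc_diff_1)
  qed
  also have "\<dots> \<le> ln t + 1" using assms by (simp add: le_nat_iff)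
  finally show ?thesis by simp
qed

lemma card_multiples:
  assumes "d \<ge> 1" "t \<ge> 0"
  shows "real (card {n\<in>{n. 1 \<le> n \<and> real n \<le> t}. d dvd n}) = of_int \<lfloor>t / real d\<rfloor>"
proof -
  have "bij_betw (\<lambda>m. d * m) {m. 1 \<le> m \<and> real m \<le> t / real d} {n\<in>{n. 1 \<le> n \<and> real n \<le> t}. d dvd n}"
  proof (rule bij_betwI')
    show "d * m = d * m' \<longleftrightarrow> m = m'" for m m' using assms by simp
    show "d * m \<in> {n\<in>{n. 1 \<le> n \<and> real n \<le> t}. d dvd n}" if "m \<in> {m. 1 \<le> m \<and> real m \<le> t / real d}" for m
      using that assms by (auto simp: field_simps)
    show "\<exists>m\<in>{m. 1 \<le> m \<and> real m \<le> t / real d}. n = d * m" if "n \<in> {n\<in>{n. 1 \<le> n \<and> real n \<le> t}. d dvd n}" for n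
    proof -
      from that obtain m where m: "n = d * m" by auto
      with that assms have "m \<in> {m. 1 \<le> m \<and> real m \<le> t / real d}" by (auto simp: field_simps)
      with m show ?thesis by blast
    qed
  qed
  from bij_betw_same_card[OF this] card_nat_le[of "t / real d"] assms show ?thesis by simp
qed

lemma abs_diff_le_add: "\<bar>a - b\<bar> \<le> x \<Longrightarrow> \<bar>c - b\<bar> \<le> y \<Longrightarrow> \<bar>a - c\<bar> \<le> x + y"
  for a b c x y :: real
  by linarith

text \<open>\<open>truncated_inclusion_exclusion\<close> is applied to all n \<le> t and to all p -
  1 with p \<le> t, with the same \<open>Q\<close>, \<open>D\<close> and \<open>\<Sigma>\<close>.
  The value of \<open>\<Sigma>\<close> is never computed; it is eliminated between the two results.
  The error sums over \<open>D\<close> are at most one per modulus for integers and come from the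
  hypothesis for primes.\<close>

lemma transference:
  assumes EH: "\<And>\<epsilon>::real. \<epsilon> > 0 \<Longrightarrow>
      (\<lambda>x::real. \<Sum>d\<in>{1..nat \<lfloor>x powr (1 - \<epsilon>)\<rfloor>}.
          \<bar>real (prime_pi_ap1 x d) - real (prime_pi x) / real (totient d)\<bar>)
        \<in> o[at_top](\<lambda>x. real (prime_pi x))"
    and U: "U > 1" and e: "e > 0"
  shows "\<forall>\<^sub>F t in at_top. \<forall>Q. (\<forall>q\<in>Q. prime q \<and> t powr (1 / U) < real q) \<longrightarrow>
    \<bar>real (card {p\<in>primes_le t. \<forall>q\<in>Q. \<not> q dvd (p - 1)}) -
      real (prime_pi t) * (real (card {n. 1 \<le> n \<and> real n \<le> t \<and> (\<forall>q\<in>Q. \<not> q dvd n)}) / t)\<bar> \<le> e * real (prime_pi t)"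
proof -
  define e1 where "e1 = min 1 (e / 2)"
  have e1: "0 < e1" "e1 \<le> 1" "e1 \<le> e / 2" using e by (auto simp: e1_def)
  define N where "N = nat \<lceil>U\<rceil>"
  have N: "real N \<ge> U" unfolding N_def using U by linarith
  \<comment> \<open>With z = t^\<epsilon> and w = t^\<eta>: \<eta> \<le> 1/U keeps w below the
    primes of \<open>Q\<close>, \<eta> \<le> 1/4 gives w^2 \<le> t^(1 - \<epsilon>), and \<epsilon>
    = \<eta> / 2^m means that w arises from z by m squarings, so that \<mu> \<ge> m / 4. The size of
    m makes the exceptional term (1 + 2^N) 6 / \<mu> at most e1 / 4.\<close>
  define \<eta> where "\<eta> = min (1 / U) (1 / 4)"
  have eta: "0 < \<eta>" "\<eta> \<le> 1 / U" "\<eta> \<le> 1 / 4" using U by (auto simp: \<eta>_def)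
  obtain m :: nat where m: "real m \<ge> max 4 (96 * (1 + 2 ^ N) / e1)" using real_arch_simple by blast
  define \<epsilon> where "\<epsilon> = \<eta> / 2 ^ m"
  have eps: "0 < \<epsilon>" "\<epsilon> \<le> \<eta>" "\<epsilon> \<le> 1 / 4" using eta by (auto simp: \<epsilon>_def field_simps intro: order_trans)
  define M where "M = nat \<lceil>1 / \<epsilon>\<rceil>"
  have M: "real M \<ge> 1 / \<epsilon>" unfolding M_def using eps by linarith
  define \<tau> where "\<tau> = e1 / 4"
  have tau: "0 < \<tau>" "\<tau> \<le> 1" using e1 by (auto simp: \<tau>_def)
  obtain w0 where w0: "w0 > 1" "\<And>w m. w \<ge> w0 \<Longrightarrow> real m / 4 \<le> (\<Sum>p\<in>primes_le (w ^ (2 ^ m)) - primes_le w. 1 / real p)"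
    using sum_recip_primes_ge by blast
  have "\<forall>\<^sub>F t in at_top. norm (\<Sum>d\<in>{1..nat \<lfloor>t powr (1 - \<epsilon>)\<rfloor>}.
      \<bar>real (prime_pi_ap1 t d) - real (prime_pi t) / real (totient d)\<bar>) \<le> \<tau> / 2 * norm (real (prime_pi t))"
    by (rule landau_o.smallD[OF EH[OF eps(1)]]) (use tau in auto)
  then have ev1: "\<forall>\<^sub>F t in at_top. (\<Sum>d\<in>{1..nat \<lfloor>t powr (1 - \<epsilon>)\<rfloor>}.
      \<bar>real (prime_pi_ap1 t d) - real (prime_pi t) / real (totient d)\<bar>) \<le> \<tau> / 2 * real (prime_pi t)"
    by (rule eventually_mono) (auto simp: abs_of_nonneg sum_nonneg)
  have ev2: "\<forall>\<^sub>F t::real in at_top. t powr \<epsilon> \<ge> w0" using eps by real_asymp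
  have ev3: "\<forall>\<^sub>F t::real in at_top. t powr (1 - \<epsilon>) \<le> \<tau> * (t - 1)" using eps tau by real_asymp
  have ev4: "\<forall>\<^sub>F t::real in at_top. real M / t powr \<epsilon> \<le> 1 / 2" using eps by real_asymp
  have ev5: "\<forall>\<^sub>F t::real in at_top. 2 * real M / t powr \<epsilon> * (1 + ln t) \<le> \<tau> / 2" using eps tau by real_asymp
  show ?thesis
    using ev1 ev2 ev3 ev4 ev5 eventually_ge_at_top[of "max 2 (4 / e)"]
  proof eventually_elim
    case (elim t)
    have t: "t \<ge> 2" "t \<ge> 4 / e" using elim by auto
    show ?case
    proof (intro allI impI)
      fix Q0 :: "nat set" assume Q0: "\<forall>q\<in>Q0. prime q \<and> t powr (1 / U) < real q"
      \<comment> \<open>\<open>Q0\<close> may be infinite, but its members above t divide no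
        positive integer up to t, hence neither an n nor a p - 1 under consideration.\<close>
      define Q where "Q = {q\<in>Q0. real q \<le> t}"
      have finQ: "finite Q" by (rule finite_subset[OF _ finite_nat_le[of t]]) (auto simp: Q_def)
      define y z Z w where "y = t powr (1 / U)" and "z = t powr \<epsilon>" and "Z = t powr (1 - \<epsilon>)" and "w = t powr \<eta>"
      have Q: "prime q \<and> y < real q" if "q \<in> Q" for q using Q0 that by (auto simp: Q_def y_def)
      have y: "1 < y" using t U by (simp add: y_def)
      have yN: "t \<le> y ^ N"
      proof -
        have "t = t powr 1" using t by simp
        also have "\<dots> \<le> t powr (1 / U * real N)" using t U N by (intro powr_mono) (auto simp: field_simps)
        also have "\<dots> = y ^ N" using t by (simp add: y_def powr_power)
        finally show ?thesis .
      qed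
      have z1: "1 < z" using t eps by (simp add: z_def)
      have zw: "z \<le> w" "w \<le> y" using t eps eta by (auto simp: z_def w_def y_def intro!: powr_mono)
      have wwZ: "w * w \<le> Z"
      proof -
        have "w * w = t powr (\<eta> + \<eta>)" by (simp only: w_def powr_add)
        also have "\<dots> \<le> Z" unfolding Z_def using t eps eta by (intro powr_mono) auto
        finally show ?thesis .
      qed
      have tzZ: "t = z * Z" using t by (simp add: z_def Z_def flip: powr_add)
      have Z0: "Z \<ge> 1" using t eps by (simp add: Z_def ge_one_powr_ge_zero)
      have Zt: "Z \<le> t" using t eps powr_mono[of "1 - \<epsilon>" 1 t] by (simp add: Z_def)
      have wz: "w = z ^ (2 ^ m)"
        using t by (simp add: w_def z_def \<epsilon>_def powr_powr flip: powr_realpow)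
      define D where "D = {d. 1 \<le> d \<and> real d \<le> Z \<and> (\<forall>p. prime p \<and> p dvd d \<longrightarrow> z < real p)}"
      have finD: "finite D" unfolding D_def by (rule finite_subset[OF _ finite_nat_le[of Z]]) auto
      define \<mu> where "\<mu> = (\<Sum>q\<in>primes_le w - primes_le z. 1 / real q)"
      have mu4: "real m / 4 \<le> \<mu>" unfolding \<mu>_def wz by (rule w0(2)) (use elim in \<open>auto simp: z_def\<close>)
      then have mu1: "\<mu> \<ge> 1" using m by linarith
      have "96 * (1 + 2 ^ N) / e1 \<le> 4 * \<mu>" using mu4 m by linarith
      then have "24 * (1 + 2 ^ N) \<le> \<mu> * e1" using e1 by (simp add: field_simps)
      then have bound: "(1 + 2 ^ N) * (6 / \<mu>) + \<tau> \<le> e1 / 2" using mu1 by (simp add: \<tau>_def field_simps)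
      define \<Sigma> where "\<Sigma> = (\<Sum>S | S \<subseteq> Q \<and> real (\<Prod>S) \<le> Z. (-1) ^ card S / real (\<Prod>S))"
      define NN where "NN = {n :: nat. 1 \<le> n \<and> real n \<le> t}"
      have cNN: "real (card NN) = of_int \<lfloor>t\<rfloor>" unfolding NN_def using t by (intro card_nat_le) auto
      have "\<bar>real (card {n\<in>NN. \<forall>q\<in>Q. \<not> q dvd n}) - real (card NN) * \<Sigma>\<bar> \<le> ((1 + 2 ^ N) * (6 / \<mu>) + \<tau>) * real (card NN)"
        unfolding \<Sigma>_def
      proof (rule truncated_inclusion_exclusion[OF _ _ finQ Q y yN less_imp_le[OF z1] zw wwZ tzZ D_def \<mu>_def mu1 less_imp_le[OF tau(1)] tau(2)])
        show "finite NN" unfolding NN_def by (rule finite_nat_pos_le)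
        have "(\<Sum>d\<in>D. \<bar>real (card {i\<in>NN. d dvd i}) - real (card NN) / real d\<bar>) \<le> (\<Sum>d\<in>D. 1)"
        proof (rule sum_mono)
          fix d assume "d \<in> D"
          then have d: "real d \<ge> 1" by (auto simp: D_def)
          have 1: "real (card {i\<in>NN. d dvd i}) = of_int \<lfloor>t / real d\<rfloor>"
            unfolding NN_def using d t by (intro card_multiples) auto
          have "of_int \<lfloor>t\<rfloor> / real d \<le> t / real d" using d by (intro divide_right_mono) auto
          moreover have "(t - 1) / real d \<le> of_int \<lfloor>t\<rfloor> / real d"
            using d by (intro divide_right_mono) linarith+
          moreover have "t / real d - 1 \<le> (t - 1) / real d" using d by (simp add: field_simps)
          ultimately have "t / real d - 1 \<le> of_int \<lfloor>t\<rfloor> / real d" "of_int \<lfloor>t\<rfloor> / real d \<le> t / real d" by linarith+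
          then show "\<bar>real (card {i\<in>NN. d dvd i}) - real (card NN) / real d\<bar> \<le> 1"
            unfolding 1 cNN by linarith
        qed
        also have "\<dots> = real (card D)" by simp
        also have "\<dots> \<le> Z"
        proof -
          have "card D \<le> card {d :: nat. 1 \<le> d \<and> real d \<le> Z}"
            by (rule card_mono[OF finite_nat_pos_le]) (auto simp: D_def)
          then show ?thesis using card_nat_le[of Z] Z0 of_int_floor_le[of Z] by linarith
        qed
        also have "Z \<le> \<tau> * (t - 1)" using elim by (simp add: Z_def)
        also have "\<dots> \<le> \<tau> * real (card NN)" unfolding cNN using tau by (intro mult_left_mono) linarith+
        finally show "(\<Sum>d\<in>D. \<bar>real (card {i\<in>NN. d dvd i}) - real (card NN) / real d\<bar>) \<le> \<tau> * real (card NN)" .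
      qed (auto simp: NN_def)
      also have "\<dots> \<le> e1 / 2 * real (card NN)" using bound by (intro mult_right_mono) auto
      finally have N1: "\<bar>real (card {n\<in>NN. \<forall>q\<in>Q. \<not> q dvd n}) - real (card NN) * \<Sigma>\<bar> \<le> e1 / 2 * real (card NN)" .
      have pic: "real (card (primes_le t)) = real (prime_pi t)" by (simp add: prime_pi_eq)
      have "\<bar>real (card {p\<in>primes_le t. \<forall>q\<in>Q. \<not> q dvd (p - 1)}) - real (card (primes_le t)) * \<Sigma>\<bar> \<le> ((1 + 2 ^ N) * (6 / \<mu>) + \<tau>) * real (card (primes_le t))"
        unfolding \<Sigma>_def
      proof (rule truncated_inclusion_exclusion[OF _ _ finQ Q y yN less_imp_le[OF z1] zw wwZ tzZ D_def \<mu>_def mu1 less_imp_le[OF tau(1)] tau(2)])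
        fix p assume "p \<in> primes_le t"
        then show "1 \<le> p - 1 \<and> real (p - 1) \<le> t"
          using primes_le_ge_2[of p t] by (auto simp: primes_le_def)
      next
        have ap: "card {p\<in>primes_le t. d dvd (p - 1)} = prime_pi_ap1 t d" for d
        proof -
          have "{p\<in>primes_le t. d dvd (p - 1)} = {p. prime p \<and> real p \<le> t \<and> [p = 1] (mod d)}"
            using prime_ge_1_nat by (auto simp: primes_le_def cong_altdef_nat)
          then show ?thesis by (simp add: prime_pi_ap1_def)
        qed
        let ?\<pi> = "real (prime_pi t)"
        have "(\<Sum>d\<in>D. \<bar>real (card {p\<in>primes_le t. d dvd (p - 1)}) - real (card (primes_le t)) / real d\<bar>)
          \<le> (\<Sum>d\<in>D. \<bar>real (prime_pi_ap1 t d) - ?\<pi> / real (totient d)\<bar> + ?\<pi> * (2 * real M / z * (1 / real d)))"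
        proof (rule sum_mono)
          fix d assume d: "d \<in> D"
          have "\<bar>1 / real (totient d) - 1 / real d\<bar> \<le> 2 * real M / z * (1 / real d)"
          proof (rule recip_totient_rough)
            show "real M / z \<le> 1 / 2" using elim by (simp add: z_def)
            have "real d \<le> t" using d Zt by (auto simp: D_def)
            also have "t = t powr 1" using t by simp
            also have "\<dots> \<le> t powr (\<epsilon> * real M)" using t M eps by (intro powr_mono) (auto simp: field_simps)
            also have "\<dots> = z ^ M" using t by (simp add: z_def powr_power mult.commute)
            finally show "real d \<le> z ^ M" .
          qed (use d z1 in \<open>auto simp: D_def\<close>)
          then have "?\<pi> * \<bar>1 / real (totient d) - 1 / real d\<bar> \<le> ?\<pi> * (2 * real M / z * (1 / real d))"
            by (intro mult_left_mono) auto
          moreover have "?\<pi> * \<bar>1 / real (totient d) - 1 / real d\<bar> = \<bar>?\<pi> / real (totient d) - ?\<pi> / real d\<bar>"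
            by (simp add: abs_mult[of ?\<pi>, simplified, symmetric] right_diff_distrib)
          ultimately show "\<bar>real (card {p\<in>primes_le t. d dvd (p - 1)}) - real (card (primes_le t)) / real d\<bar>
            \<le> \<bar>real (prime_pi_ap1 t d) - ?\<pi> / real (totient d)\<bar> + ?\<pi> * (2 * real M / z * (1 / real d))"
            unfolding ap pic by linarith
        qed
        also have "\<dots> = (\<Sum>d\<in>D. \<bar>real (prime_pi_ap1 t d) - ?\<pi> / real (totient d)\<bar>) + ?\<pi> * (2 * real M / z * (\<Sum>d\<in>D. 1 / real d))"
          by (simp add: sum.distrib sum_distrib_left)
        also have "(\<Sum>d\<in>D. \<bar>real (prime_pi_ap1 t d) - ?\<pi> / real (totient d)\<bar>) \<le>
            (\<Sum>d\<in>{1..nat \<lfloor>t powr (1 - \<epsilon>)\<rfloor>}. \<bar>real (prime_pi_ap1 t d) - ?\<pi> / real (totient d)\<bar>)"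
          using Z0 by (intro sum_mono2) (auto simp: D_def Z_def le_nat_iff le_floor_iff)
        also have "\<dots> \<le> \<tau> / 2 * ?\<pi>" using elim by simp
        also have "?\<pi> * (2 * real M / z * (\<Sum>d\<in>D. 1 / real d)) \<le> ?\<pi> * (2 * real M / z * (1 + ln t))"
          using z1 t Zt by (intro mult_left_mono sum_recip_le finD) (auto simp: D_def)
        also have "\<dots> \<le> ?\<pi> * (\<tau> / 2)" using elim by (intro mult_left_mono) (auto simp: z_def)
        finally show "(\<Sum>d\<in>D. \<bar>real (card {p\<in>primes_le t. d dvd (p - 1)}) - real (card (primes_le t)) / real d\<bar>) \<le> \<tau> * real (card (primes_le t))"
          unfolding pic by (simp add: algebra_simps)
      qed auto
      also have "\<dots> \<le> e1 / 2 * real (card (primes_le t))" using bound by (intro mult_right_mono) auto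
      finally have P1: "\<bar>real (card {p\<in>primes_le t. \<forall>q\<in>Q. \<not> q dvd (p - 1)}) - real (prime_pi t) * \<Sigma>\<bar> \<le> e1 / 2 * real (prime_pi t)"
        unfolding pic .
      define A where "A = real (card {n\<in>NN. \<forall>q\<in>Q. \<not> q dvd n})"
      define X where "X = real (card NN)"
      have X: "t - 1 \<le> X" "X \<le> t" "1 \<le> X" using t unfolding X_def cNN by linarith+
      have AX: "0 \<le> A" "A \<le> X" unfolding A_def X_def NN_def
        by (auto intro!: card_mono finite_nat_pos_le[unfolded One_nat_def])
      have N1': "\<bar>A - X * \<Sigma>\<bar> \<le> e1 / 2 * X" using N1 by (simp add: A_def X_def)
      \<comment> \<open>The alternating sum \<open>\<Sigma>\<close> has no evident bound of its own;
        one is read off from the integer count, since 0 \<le> A \<le> X. It is needed to replace X =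
        floor t by t.\<close>
      have "\<bar>X * \<Sigma>\<bar> \<le> 2 * X"
      proof -
        have "e1 / 2 * X \<le> 1 * X" using e1 X by (intro mult_right_mono) auto
        then show ?thesis using N1' AX by linarith
      qed
      then have S2: "\<bar>\<Sigma>\<bar> \<le> 2" using X by (simp add: abs_mult)
      have "\<bar>A / t - \<Sigma>\<bar> \<le> e1 / 2 + 2 / t"
      proof -
        have "\<bar>(t - X) * \<Sigma>\<bar> \<le> 1 * 2" unfolding abs_mult using X S2 by (intro mult_mono) auto
        moreover have "e1 / 2 * X \<le> e1 / 2 * t" using X e1 by (intro mult_left_mono) auto
        moreover have "A - t * \<Sigma> = (A - X * \<Sigma>) - (t - X) * \<Sigma>" by (simp add: algebra_simps)
        ultimately have "\<bar>A - t * \<Sigma>\<bar> \<le> e1 / 2 * t + 2" using N1' by linarith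
        moreover have "\<bar>A / t - \<Sigma>\<bar> = \<bar>A - t * \<Sigma>\<bar> / t"
        proof -
          have "A / t - \<Sigma> = (A - t * \<Sigma>) / t" using t by (simp add: field_simps)
          then show ?thesis using t by simp
        qed
        ultimately show ?thesis using t by (simp add: field_simps)
      qed
      moreover have "2 / t \<le> e / 2" using t e by (simp add: field_simps)
      ultimately have "\<bar>A / t - \<Sigma>\<bar> \<le> e1 / 2 + e / 2" by linarith
      then have "real (prime_pi t) * \<bar>A / t - \<Sigma>\<bar> \<le> real (prime_pi t) * (e1 / 2 + e / 2)"
        by (intro mult_left_mono) auto
      moreover have "real (prime_pi t) * \<bar>A / t - \<Sigma>\<bar> = \<bar>real (prime_pi t) * (A / t) - real (prime_pi t) * \<Sigma>\<bar>"
        by (simp add: abs_mult[of "real (prime_pi t)", simplified, symmetric] right_diff_distrib)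
      ultimately have "\<bar>real (prime_pi t) * (A / t) - real (prime_pi t) * \<Sigma>\<bar> \<le> real (prime_pi t) * (e1 / 2 + e / 2)" by simp
      with P1 have fin: "\<bar>real (card {p\<in>primes_le t. \<forall>q\<in>Q. \<not> q dvd (p - 1)}) - real (prime_pi t) * (A / t)\<bar>
          \<le> e1 / 2 * real (prime_pi t) + real (prime_pi t) * (e1 / 2 + e / 2)"
        by (rule abs_diff_le_add)
      also have "\<dots> = (e1 + e / 2) * real (prime_pi t)" by (simp add: algebra_simps)
      also have "\<dots> \<le> e * real (prime_pi t)" using e1 by (intro mult_right_mono) auto
      finally have fin: "\<bar>real (card {p\<in>primes_le t. \<forall>q\<in>Q. \<not> q dvd (p - 1)}) - real (prime_pi t) * (A / t)\<bar> \<le> e * real (prime_pi t)" .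
      have small: "q \<in> Q" if "q \<in> Q0" "q dvd n" "1 \<le> n" "real n \<le> t" for q n
      proof -
        have "q \<le> n" using that by (intro dvd_imp_le) auto
        then show ?thesis using that by (auto simp: Q_def)
      qed
      have "{p\<in>primes_le t. \<forall>q\<in>Q. \<not> q dvd (p - 1)} = {p\<in>primes_le t. \<forall>q\<in>Q0. \<not> q dvd (p - 1)}"
      proof -
        have "q \<in> Q" if "p \<in> primes_le t" "q \<in> Q0" "q dvd (p - 1)" for p q
          by (rule small[OF that(2,3)]) (use primes_le_ge_2[OF that(1)] that(1) in \<open>auto simp: primes_le_def\<close>)
        then show ?thesis by (auto simp: Q_def)
      qed
      moreover have "{n\<in>NN. \<forall>q\<in>Q. \<not> q dvd n} = {n. 1 \<le> n \<and> real n \<le> t \<and> (\<forall>q\<in>Q0. \<not> q dvd n)}"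
        using small by (auto simp: NN_def Q_def)
      ultimately show "\<bar>real (card {p\<in>primes_le t. \<forall>q\<in>Q0. \<not> q dvd (p - 1)}) -
        real (prime_pi t) * (real (card {n. 1 \<le> n \<and> real n \<le> t \<and> (\<forall>q\<in>Q0. \<not> q dvd n)}) / t)\<bar> \<le> e * real (prime_pi t)"
        using fin by (simp add: A_def)
    qed
  qed
qed

section \<open>Counting integers composed of given primes\<close>

text \<open>A comparison of Riemann-Stieltjes type: on each of n equal pieces G is constant up to
  \<omega>, and the cumulative masses agree up to \<tau> at both ends of a piece. The term
  \<open>2 * real n * \<tau>\<close> forces n to be chosen before \<tau>.\<close>

lemma weighted_sum_vs_integral:
  fixes a v :: "'a \<Rightarrow> real" and G \<kappa> :: "real \<Rightarrow> real"
  assumes S: "finite S" "\<And>p. p \<in> S \<Longrightarrow> a p \<ge> 0 \<and> v p > 0"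
    and ker: "vkernel \<kappa>" and T: "0 < T" and n: "n > 0"
    and G: "continuous_on {0..T} G" "\<And>s. s \<in> {0..T} \<Longrightarrow> \<bar>G s\<bar> \<le> 1"
    and osc: "\<And>s s'. s \<in> {0..T} \<Longrightarrow> s' \<in> {0..T} \<Longrightarrow> \<bar>s - s'\<bar> \<le> T / real n \<Longrightarrow> \<bar>G s - G s'\<bar> \<le> \<omega>"
    and close: "\<And>s. s \<in> {0..T} \<Longrightarrow> \<bar>(\<Sum>p\<in>{p\<in>S. v p \<le> s}. a p) - integral {0..s} \<kappa>\<bar> \<le> \<tau>"
  shows "\<bar>(\<Sum>p\<in>{p\<in>S. v p \<le> T}. a p * G (v p)) - integral {0..T} (\<lambda>t. G t * \<kappa> t)\<bar> \<le> \<omega> * (2 * T + \<tau>) + 2 * real n * \<tau>"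
proof -
  define s where "s i = T * real i / real n" for i
  define A where "A x = (\<Sum>p\<in>{p\<in>S. v p \<le> x}. a p)" for x
  define K where "K x = integral {0..x} \<kappa>" for x
  define AG where "AG x = (\<Sum>p\<in>{p\<in>S. v p \<le> x}. a p * G (v p))" for x
  define KG where "KG x = integral {0..x} (\<lambda>t. G t * \<kappa> t)" for x
  have om: "\<omega> \<ge> 0" using osc[of 0 0] T by auto
  have s0: "s 0 = 0" and sn: "s n = T" using n by (auto simp: s_def)
  have s_mono: "s i \<le> s j" if "i \<le> j" for i j
    using that T by (auto simp: s_def intro!: divide_right_mono mult_left_mono)
  have s_range: "s i \<in> {0..T}" if "i \<le> n" for i
    using s_mono[of 0 i] s_mono[OF that] by (simp add: s0 sn)
  have s_step: "s (Suc i) - s i = T / real n" for i by (simp add: s_def algebra_simps add_divide_distrib)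
  have Gint: "(\<lambda>t. G t * \<kappa> t) integrable_on {a..b}" if "0 \<le> a" "b \<le> T" for a b
  proof -
    have "(\<lambda>t. G t * \<kappa> t) integrable_on {0..T}" by (rule vkernelD(4)[OF ker G(1)])
    then show ?thesis by (rule integrable_on_subinterval) (use that in auto)
  qed
  have main: "\<bar>AG (s i) - KG (s i)\<bar> \<le> \<omega> * (A (s i) + K (s i)) + 2 * real i * \<tau>" if "i \<le> n" for i
    using that
  proof (induction i)
    case 0
    have "{p\<in>S. v p \<le> 0} = {}" using S by force
    then show ?case by (simp only: AG_def KG_def A_def K_def s0) simp
  next
    case (Suc i)
    then have i: "i \<le> n" and IH: "\<bar>AG (s i) - KG (s i)\<bar> \<le> \<omega> * (A (s i) + K (s i)) + 2 * real i * \<tau>" by auto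
    let ?x = "s i" and ?y = "s (Suc i)"
    have xy: "0 \<le> ?x" "?x \<le> ?y" "?y \<le> T" "?x \<in> {0..T}" "?y \<in> {0..T}"
      using s_range[OF i] s_range[OF Suc.prems] s_mono[of i "Suc i"] by auto
    define J where "J = {p\<in>S. ?x < v p \<and> v p \<le> ?y}"
    have split: "{p\<in>S. v p \<le> ?y} = {p\<in>S. v p \<le> ?x} \<union> J" using xy by (auto simp: J_def)
    have Asp: "A ?y = A ?x + (\<Sum>p\<in>J. a p)" "AG ?y = AG ?x + (\<Sum>p\<in>J. a p * G (v p))"
      unfolding A_def AG_def split by (rule sum.union_disjoint; use S in \<open>auto simp: J_def\<close>)+
    have Ksp: "K ?y = K ?x + integral {?x..?y} \<kappa>" "KG ?y = KG ?x + integral {?x..?y} (\<lambda>t. G t * \<kappa> t)"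
      unfolding K_def KG_def using xy
      by (auto intro!: Henstock_Kurzweil_Integration.integral_combine[symmetric] vkernel_integrable[OF ker] Gint)
    have 1: "\<bar>(\<Sum>p\<in>J. a p * G (v p)) - G ?y * (\<Sum>p\<in>J. a p)\<bar> \<le> \<omega> * (\<Sum>p\<in>J. a p)"
    proof -
      have "(\<Sum>p\<in>J. a p * G (v p)) - G ?y * (\<Sum>p\<in>J. a p) = (\<Sum>p\<in>J. a p * (G (v p) - G ?y))"
        by (simp add: sum_distrib_left sum_distrib_right sum_subtractf right_diff_distrib mult.commute)
      also have "\<bar>\<dots>\<bar> \<le> (\<Sum>p\<in>J. \<bar>a p * (G (v p) - G ?y)\<bar>)" by (rule sum_abs)
      also have "\<dots> \<le> (\<Sum>p\<in>J. a p * \<omega>)"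
      proof (rule sum_mono)
        fix p assume p: "p \<in> J"
        have "\<bar>G (v p) - G ?y\<bar> \<le> \<omega>"
          using p xy s_step[of i] by (intro osc) (auto simp: J_def)
        then show "\<bar>a p * (G (v p) - G ?y)\<bar> \<le> a p * \<omega>"
          using p S by (auto simp: abs_mult J_def intro!: mult_left_mono)
      qed
      finally show ?thesis by (simp add: sum_distrib_left mult.commute)
    qed
    have 2: "\<bar>integral {?x..?y} (\<lambda>t. G t * \<kappa> t) - G ?y * integral {?x..?y} \<kappa>\<bar> \<le> \<omega> * integral {?x..?y} \<kappa>"
    proof -
      have ki: "\<kappa> integrable_on {?x..?y}" by (rule vkernel_integrable[OF ker]) (use xy in auto)
      have "integral {?x..?y} (\<lambda>t. G t * \<kappa> t) - G ?y * integral {?x..?y} \<kappa> = integral {?x..?y} (\<lambda>t. G t * \<kappa> t - G ?y * \<kappa> t)"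
        using Gint[of ?x ?y] xy ki by (subst Henstock_Kurzweil_Integration.integral_diff) (auto intro: integrable_on_mult_right)
      also have "norm \<dots> \<le> integral {?x..?y} (\<lambda>t. \<omega> * \<kappa> t)"
      proof (rule integral_norm_bound_integral)
        show "(\<lambda>t. G t * \<kappa> t - G ?y * \<kappa> t) integrable_on {?x..?y}"
          using Gint[of ?x ?y] xy ki by (intro Henstock_Kurzweil_Integration.integrable_diff integrable_on_mult_right) auto
        show "(\<lambda>t. \<omega> * \<kappa> t) integrable_on {?x..?y}" using ki by (rule integrable_on_mult_right)
        fix t assume t: "t \<in> {?x..?y}"
        have "\<bar>G t - G ?y\<bar> \<le> \<omega>" using t xy s_step[of i] by (intro osc) auto
        then have "\<bar>G t - G ?y\<bar> * \<kappa> t \<le> \<omega> * \<kappa> t" by (intro mult_right_mono vkernelD(1)[OF ker])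
        then show "norm (G t * \<kappa> t - G ?y * \<kappa> t) \<le> \<omega> * \<kappa> t"
          using vkernelD(1)[OF ker, of t] by (simp add: abs_mult flip: left_diff_distrib)
      qed
      finally show ?thesis by simp
    qed
    have 3: "\<bar>G ?y * (\<Sum>p\<in>J. a p) - G ?y * integral {?x..?y} \<kappa>\<bar> \<le> 2 * \<tau>"
    proof -
      have "\<bar>A ?x - K ?x\<bar> \<le> \<tau>" "\<bar>A ?y - K ?y\<bar> \<le> \<tau>"
        unfolding A_def K_def by (rule close, use xy in auto)+
      then have "\<bar>(\<Sum>p\<in>J. a p) - integral {?x..?y} \<kappa>\<bar> \<le> 2 * \<tau>" using Asp(1) Ksp(1) by linarith
      then have "\<bar>G ?y\<bar> * \<bar>(\<Sum>p\<in>J. a p) - integral {?x..?y} \<kappa>\<bar> \<le> 1 * (2 * \<tau>)"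
        using G(2)[OF xy(5)] by (intro mult_mono) auto
      then show ?thesis by (simp add: abs_mult flip: right_diff_distrib)
    qed
    have "\<bar>AG ?y - KG ?y\<bar> \<le> \<omega> * (A ?x + K ?x) + 2 * real i * \<tau> + \<omega> * (\<Sum>p\<in>J. a p) + \<omega> * integral {?x..?y} \<kappa> + 2 * \<tau>"
      using IH 1 2 3 Asp(2) Ksp(2) by linarith
    also have "\<dots> = \<omega> * (A ?y + K ?y) + 2 * real (Suc i) * \<tau>"
      by (simp add: Asp Ksp algebra_simps)
    finally show ?case .
  qed
  have KT: "K T \<le> T"
  proof -
    have "integral {0..T} \<kappa> \<le> integral {0..T} (\<lambda>_. 1 :: real)"
      by (rule integral_le[OF vkernel_integrable[OF ker]]) (use vkernelD(2)[OF ker] in auto)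
    then show ?thesis using T by (simp add: K_def)
  qed
  moreover have "\<bar>A T - K T\<bar> \<le> \<tau>" unfolding A_def K_def by (rule close) (use T in auto)
  ultimately have "A T + K T \<le> 2 * T + \<tau>" by linarith
  then have "\<omega> * (A T + K T) \<le> \<omega> * (2 * T + \<tau>)" using om by (rule mult_left_mono)
  then show ?thesis using main[of n] by (simp add: sn AG_def KG_def)
qed

lemma vkernel_integral_diff_le:
  assumes ker: "vkernel \<kappa>" and "0 \<le> a" "a \<le> b"
  shows "integral {0..b} \<kappa> - integral {0..a} \<kappa> \<le> b - a"
proof -
  have "integral {0..b} \<kappa> = integral {0..a} \<kappa> + integral {a..b} \<kappa>"
    using assms by (intro Henstock_Kurzweil_Integration.integral_combine[symmetric] vkernel_integrable[OF ker]) auto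
  moreover have "integral {a..b} \<kappa> \<le> integral {a..b} (\<lambda>_. 1 :: real)"
    by (rule integral_le[OF vkernel_integrable[OF ker]]) (use assms vkernelD(2)[OF ker] in auto)
  ultimately show ?thesis using assms by simp
qed

text \<open>The inequality is iterated over steps of length \<open>1/2\<close>, because the mass of the weights on
  \<open>(0, 1/2]\<close> is less than \<open>1\<close>.\<close>

lemma discrete_gronwall:
  fixes a v :: "'a \<Rightarrow> real" and \<Delta> :: "real \<Rightarrow> real"
  assumes S: "finite S" "\<And>p. p \<in> S \<Longrightarrow> a p \<ge> 0 \<and> v p > 0"
    and mass: "\<And>s s'. 0 \<le> s \<Longrightarrow> s \<le> s' \<Longrightarrow> s' \<le> U \<Longrightarrow> (\<Sum>p\<in>{p\<in>S. s < v p \<and> v p \<le> s'}. a p) \<le> s' - s + 2 * \<tau>"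
    and tau: "0 \<le> \<tau>" "\<tau> \<le> 1 / 16" and eta: "0 < \<eta>" "\<eta> \<le> 1 / 2"
    and bnd: "\<And>s. s \<in> {0..U} \<Longrightarrow> \<bar>\<Delta> s\<bar> \<le> 1" and init: "\<And>s. s \<in> {\<eta>..1} \<Longrightarrow> \<bar>\<Delta> s\<bar> \<le> b" and b: "b \<ge> 0"
    and rec: "\<And>s. s \<in> {1..U} \<Longrightarrow> s * \<bar>\<Delta> s\<bar> \<le> (\<Sum>p\<in>{p\<in>S. v p \<le> s}. a p * \<bar>\<Delta> (s - v p)\<bar>) + \<kappa>" and kap: "\<kappa> \<ge> 0"
    and s: "\<eta> \<le> s" "s \<le> U" "s \<le> 1 + real j / 2"
  shows "\<bar>\<Delta> s\<bar> \<le> 6 ^ j * (b + (\<eta> + 2 * \<tau> + \<kappa>))"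
  using s
proof (induction j arbitrary: s)
  case 0
  then show ?case using init[of s] eta tau kap by simp
next
  case (Suc j)
  define k where "k = \<eta> + 2 * \<tau> + \<kappa>"
  define Bj where "Bj = 6 ^ j * (b + k)"
  have k0: "k > 0" using eta tau kap by (simp add: k_def)
  have "1 * (b + k) \<le> Bj" unfolding Bj_def using b k0 by (intro mult_right_mono) auto
  then have Bk: "k \<le> Bj" "0 \<le> Bj" using b k0 by auto
  have IH: "\<bar>\<Delta> r\<bar> \<le> Bj" if "\<eta> \<le> r" "r \<le> U" "r \<le> 1 + real j / 2" for r
    using Suc.IH[OF that] by (simp add: Bj_def k_def)
  define m where "m = min U (1 + real (Suc j) / 2)"
  \<comment> \<open>A supremum and not a maximum, since \<open>\<Delta>\<close> need not be
    continuous; \<open>bnd\<close> keeps it finite.\<close>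
  define M where "M = (SUP r\<in>{\<eta>..m}. \<bar>\<Delta> r\<bar>)"
  have bdd: "bdd_above ((\<lambda>r. \<bar>\<Delta> r\<bar>) ` {\<eta>..m})"
    by (rule bdd_aboveI[of _ 1]) (use bnd eta in \<open>auto simp: m_def\<close>)
  have Mup: "\<bar>\<Delta> r\<bar> \<le> M" if "\<eta> \<le> r" "r \<le> m" for r
    unfolding M_def by (rule cSUP_upper[OF _ bdd]) (use that in auto)
  have sm: "s \<le> m" using Suc.prems by (simp add: m_def)
  have M0: "M \<ge> 0" using Mup[of s] Suc.prems sm by linarith
  have step: "\<bar>\<Delta> r\<bar> \<le> 5 / 8 * M + 9 / 8 * Bj + k" if r: "\<eta> \<le> r" "r \<le> m" for r
  proof (cases "r \<le> 1 + real j / 2")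
    case True
    then have "\<bar>\<Delta> r\<bar> \<le> Bj" using IH r by (simp add: m_def)
    also have "\<dots> \<le> 5 / 8 * M + 9 / 8 * Bj + k" using M0 Bk k0 by linarith
    finally show ?thesis .
  next
    case False
    have rU: "r \<in> {1..U}" using False r by (auto simp: m_def)
    have r': "r \<le> 1 + real j / 2 + 1 / 2" using r by (simp add: m_def add_divide_distrib)
    \<comment> \<open>For p in \<open>S1\<close> the argument r - v p stays in the range of the
      supremum \<open>M\<close>, in \<open>S2\<close> it falls back to the range of the induction
      hypothesis, and in \<open>S3\<close> it is below \<eta>, where only the trivial bound 1 is
      known.\<close>
    define S1 S2 S3 where "S1 = {p\<in>S. v p \<le> 1/2}" and "S2 = {p\<in>S. 1/2 < v p \<and> v p \<le> r - \<eta>}"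
      and "S3 = {p\<in>S. r - \<eta> < v p \<and> v p \<le> r}"
    have fin: "finite S1" "finite S2" "finite S3" using S by (auto simp: S1_def S2_def S3_def)
    have r1: "1 \<le> r" using rU by simp
    have half: "1 / 2 \<le> r - \<eta>" using r1 eta by linarith
    have un: "{p\<in>S. v p \<le> r} = S1 \<union> (S2 \<union> S3)"
      using half eta by (auto simp: S1_def S2_def S3_def)
    have "(\<Sum>p\<in>{p\<in>S. v p \<le> r}. a p * \<bar>\<Delta> (r - v p)\<bar>) = (\<Sum>p\<in>S1. a p * \<bar>\<Delta> (r - v p)\<bar>) +
        ((\<Sum>p\<in>S2. a p * \<bar>\<Delta> (r - v p)\<bar>) + (\<Sum>p\<in>S3. a p * \<bar>\<Delta> (r - v p)\<bar>))"
      unfolding un using fin half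
      by (subst sum.union_disjoint; (subst sum.union_disjoint)?) (auto simp: S1_def S2_def S3_def)
    also have "(\<Sum>p\<in>S1. a p * \<bar>\<Delta> (r - v p)\<bar>) \<le> (\<Sum>p\<in>S1. a p * M)"
    proof (rule sum_mono)
      fix p assume p: "p \<in> S1"
      have "\<bar>\<Delta> (r - v p)\<bar> \<le> M"
      proof (rule Mup)
        have "0 < v p" "v p \<le> 1 / 2" using p S by (auto simp: S1_def)
        then show "\<eta> \<le> r - v p" "r - v p \<le> m" using r half by linarith+
      qed
      then show "a p * \<bar>\<Delta> (r - v p)\<bar> \<le> a p * M" using p S by (intro mult_left_mono) (auto simp: S1_def)
    qed
    also have "(\<Sum>p\<in>S2. a p * \<bar>\<Delta> (r - v p)\<bar>) \<le> (\<Sum>p\<in>S2. a p * Bj)"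
    proof (rule sum_mono)
      fix p assume p: "p \<in> S2"
      have "\<bar>\<Delta> (r - v p)\<bar> \<le> Bj"
        by (rule IH) (use p r' rU in \<open>auto simp: S2_def\<close>)
      then show "a p * \<bar>\<Delta> (r - v p)\<bar> \<le> a p * Bj" using p S by (intro mult_left_mono) (auto simp: S2_def)
    qed
    also have "(\<Sum>p\<in>S3. a p * \<bar>\<Delta> (r - v p)\<bar>) \<le> (\<Sum>p\<in>S3. a p * 1)"
    proof (rule sum_mono)
      fix p assume p: "p \<in> S3"
      then have "v p > 0" using S by (auto simp: S3_def)
      then have "\<bar>\<Delta> (r - v p)\<bar> \<le> 1"
        by (intro bnd) (use p rU in \<open>auto simp: S3_def\<close>)
      then show "a p * \<bar>\<Delta> (r - v p)\<bar> \<le> a p * 1" using p S by (intro mult_left_mono) (auto simp: S3_def)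
    qed
    finally have "(\<Sum>p\<in>{p\<in>S. v p \<le> r}. a p * \<bar>\<Delta> (r - v p)\<bar>) \<le> (\<Sum>p\<in>S1. a p) * M + ((\<Sum>p\<in>S2. a p) * Bj + (\<Sum>p\<in>S3. a p))"
      by (simp add: sum_distrib_right)
    also have "\<dots> \<le> (1 / 2 + 2 * \<tau>) * M + ((r + 2 * \<tau>) * Bj + (\<eta> + 2 * \<tau>))"
    proof (intro add_mono mult_right_mono M0 Bk)
      have "S1 = {p\<in>S. 0 < v p \<and> v p \<le> 1/2}" using S by (auto simp: S1_def)
      then show "(\<Sum>p\<in>S1. a p) \<le> 1 / 2 + 2 * \<tau>" using mass[of 0 "1/2"] rU by simp
      show "(\<Sum>p\<in>S2. a p) \<le> r + 2 * \<tau>" unfolding S2_def using mass[of "1/2" "r - \<eta>"] half rU eta by auto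
      show "(\<Sum>p\<in>S3. a p) \<le> \<eta> + 2 * \<tau>" unfolding S3_def using mass[of "r - \<eta>" r] half rU eta by auto
    qed
    finally have "r * \<bar>\<Delta> r\<bar> \<le> (1 / 2 + 2 * \<tau>) * M + (r + 2 * \<tau>) * Bj + k"
      using rec[OF rU] by (simp add: k_def)
    also have "\<dots> \<le> r * ((1 / 2 + 2 * \<tau>) * M) + r * ((1 + 2 * \<tau>) * Bj) + r * k"
    proof (intro add_mono)
      show "(1 / 2 + 2 * \<tau>) * M \<le> r * ((1 / 2 + 2 * \<tau>) * M)"
        using mult_right_mono[OF r1, of "(1 / 2 + 2 * \<tau>) * M"] tau M0 by simp
      show "k \<le> r * k" using mult_right_mono[OF r1, of k] k0 by simp
      have "r + 2 * \<tau> \<le> r * (1 + 2 * \<tau>)" using mult_right_mono[OF r1, of "2 * \<tau>"] tau by (simp add: algebra_simps)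
      then have "(r + 2 * \<tau>) * Bj \<le> r * (1 + 2 * \<tau>) * Bj" using Bk by (intro mult_right_mono) auto
      then show "(r + 2 * \<tau>) * Bj \<le> r * ((1 + 2 * \<tau>) * Bj)" by (simp add: mult.assoc)
    qed
    also have "\<dots> = r * ((1 / 2 + 2 * \<tau>) * M + (1 + 2 * \<tau>) * Bj + k)" by (simp add: distrib_left)
    finally have "\<bar>\<Delta> r\<bar> \<le> (1 / 2 + 2 * \<tau>) * M + (1 + 2 * \<tau>) * Bj + k" using r1 by simp
    also have "\<dots> \<le> 5 / 8 * M + 9 / 8 * Bj + k"
      using tau M0 Bk by (intro add_mono mult_right_mono) auto
    finally show ?thesis .
  qed
  \<comment> \<open>With 1/2 + 2 \<tau> \<le> 5/8 the supremum is absorbed on the left: 3/8 M \<le>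
    9/8 Bj + k \<le> 17/8 Bj. The resulting factor 17/3 explains the base 6.\<close>
  have "M \<le> 5 / 8 * M + 9 / 8 * Bj + k"
    unfolding M_def by (rule cSUP_least) (use step Suc.prems sm in \<open>auto simp flip: M_def\<close>)
  then have "M \<le> 6 * Bj" using Bk k0 by linarith
  moreover have "\<bar>\<Delta> s\<bar> \<le> M" using Mup Suc.prems sm by simp
  ultimately show ?case by (simp add: Bj_def k_def)
qed


text \<open>At x = y^s, \<open>log_identity\<close> divided by x ln y reads s F(s) = \<Sum> a_p F(s
  - v_p) + O(1 / ln y) with a_p = ln p / (p ln y) and v_p = ln p / ln y, a discrete copy of the
  equation of \<sigma>. The tolerance \<tau> is chosen before y and P.\<close>

theorem mean_value:
  assumes ker: "vkernel \<kappa>" and sol: "vsol \<kappa> \<sigma>" and U: "U \<ge> 1" and e: "e > 0"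
  shows "\<exists>\<tau>>0. \<forall>\<^sub>F y in at_top. \<forall>P. primes_le y \<subseteq> P \<longrightarrow>
      (\<forall>v\<in>{0..U}. \<bar>(\<Sum>p\<in>P \<inter> primes_le (y powr v). ln (real p) / (real p * ln y)) - integral {0..v} \<kappa>\<bar> \<le> \<tau>) \<longrightarrow>
      (\<forall>v\<in>{1..U}. \<bar>real (card (gen_set P (y powr v))) / y powr v - \<sigma> v\<bar> \<le> e)"
proof -
  obtain C where C: "C \<ge> 0" and id: "\<And>P x. x \<ge> 1 \<Longrightarrow>
     \<bar>real (card (gen_set P x)) * ln x - (\<Sum>p\<in>P \<inter> primes_le x. ln (real p) * real (card (gen_set P (x / p))))\<bar> \<le> C * x"
    using log_identity by blast
  define j where "j = nat \<lceil>2 * U\<rceil>"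
  have j: "U \<le> 1 + real j / 2" unfolding j_def using U by linarith
  define E where "E = (6 :: real) ^ j"
  have E: "E \<ge> 1" by (simp add: E_def)
  \<comment> \<open>Five errors are each made at most c and then multiplied by E = 6^j: the start-up
    error y^(-\<eta>), the cut-off \<eta>, the mass errors 2 \<tau> + 2 n \<tau>, the oscillation
    \<omega> (2 U + \<tau>), and C / ln y. The choices are made in the order \<omega>, \<delta>, n,
    \<tau>.\<close>
  define c where "c = e / (8 * E)"
  have c: "c > 0" using e E by (simp add: c_def)
  define \<eta> where "\<eta> = min (1/2) c"
  have eta: "0 < \<eta>" "\<eta> \<le> 1 / 2" "\<eta> \<le> c" using c by (auto simp: \<eta>_def)
  define \<omega> where "\<omega> = c / (2 * U + 1)"
  have om: "\<omega> > 0" using c U by (simp add: \<omega>_def)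
  have "uniformly_continuous_on {0..U} \<sigma>"
    by (rule compact_uniformly_continuous[OF vsolD(2)[OF sol]]) auto
  then obtain \<delta> where del: "\<delta> > 0" "\<And>s s'. s \<in> {0..U} \<Longrightarrow> s' \<in> {0..U} \<Longrightarrow> \<bar>s' - s\<bar> < \<delta> \<Longrightarrow> \<bar>\<sigma> s' - \<sigma> s\<bar> < \<omega>"
    using om unfolding uniformly_continuous_on_def dist_real_def by metis
  obtain n0 :: nat where n0: "real n0 > U / \<delta>" using reals_Archimedean2 by blast
  define n where "n = Suc n0"
  have n: "n > 0" "U / real n < \<delta>"
  proof -
    have "U / \<delta> < real n" using n0 by (simp add: n_def)
    then show "U / real n < \<delta>" using del by (simp add: field_simps n_def)
  qed (simp add: n_def)
  define \<tau> where "\<tau> = min (1/16) (c / (2 * (real n + 1)))"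
  have tau: "0 < \<tau>" using c by (simp add: \<tau>_def)
  have tau16: "\<tau> \<le> 1 / 16" unfolding \<tau>_def by (rule min.cobounded1)
  have "\<tau> \<le> c / (2 * (real n + 1))" by (simp add: \<tau>_def)
  then have taun: "2 * \<tau> + 2 * real n * \<tau> \<le> c" by (simp add: field_simps)
  have ev1: "\<forall>\<^sub>F y::real in at_top. y powr (- \<eta>) \<le> c" using eta c by real_asymp
  have ev2: "\<forall>\<^sub>F y::real in at_top. C / ln y \<le> c" using c by real_asymp
  have "\<forall>\<^sub>F y in at_top. \<forall>P. primes_le y \<subseteq> P \<longrightarrow>
      (\<forall>v\<in>{0..U}. \<bar>(\<Sum>p\<in>P \<inter> primes_le (y powr v). ln (real p) / (real p * ln y)) - integral {0..v} \<kappa>\<bar> \<le> \<tau>) \<longrightarrow>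
      (\<forall>v\<in>{1..U}. \<bar>real (card (gen_set P (y powr v))) / y powr v - \<sigma> v\<bar> \<le> e)"
    using ev1 ev2 eventually_ge_at_top[of 2]
  proof eventually_elim
    case (elim y)
    have y: "y > 1" "ln y > 0" using elim by auto
    show ?case
    proof (intro allI impI ballI)
      fix P v0
      assume P: "primes_le y \<subseteq> P" and v0: "v0 \<in> {1..U}"
        and cl: "\<forall>v\<in>{0..U}. \<bar>(\<Sum>p\<in>P \<inter> primes_le (y powr v). ln (real p) / (real p * ln y)) - integral {0..v} \<kappa>\<bar> \<le> \<tau>"
      define S where "S = P \<inter> primes_le (y powr U)"
      define a where "a p = ln (real p) / (real p * ln y)" for p
      define v where "v p = ln (real p) / ln y" for p
      define F where "F s = real (card (gen_set P (y powr s))) / y powr s" for s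
      define \<Delta> where "\<Delta> s = F s - \<sigma> s" for s
      have S: "finite S" "\<And>p. p \<in> S \<Longrightarrow> a p \<ge> 0 \<and> v p > 0"
        using y primes_le_ge_2 by (auto simp: S_def a_def v_def dest!: primes_le_ge_2)
      have yv: "y powr v p = real p" if "p \<in> primes_le x" for p x
        using y primes_le_ge_2[OF that] by (simp add: v_def powr_def)
      have v_le: "v p \<le> s \<longleftrightarrow> real p \<le> y powr s" if "p \<in> primes_le x" for p x s
        using yv[OF that] y by (metis powr_le_cancel_iff)
      have Sv: "{p\<in>S. v p \<le> s} = P \<inter> primes_le (y powr s)" if "s \<le> U" for s
      proof -
        have "y powr s \<le> y powr U" using that y by simp
        then have "primes_le (y powr s) \<subseteq> primes_le (y powr U)" by (rule primes_le_mono)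
        then show ?thesis using v_le by (auto simp: S_def primes_le_def)
      qed
      have close: "\<bar>(\<Sum>p\<in>{p\<in>S. v p \<le> s}. a p) - integral {0..s} \<kappa>\<bar> \<le> \<tau>" if "s \<in> {0..U}" for s
        using cl that Sv[of s] by (simp add: a_def)
      have mass: "(\<Sum>p\<in>{p\<in>S. s < v p \<and> v p \<le> s'}. a p) \<le> s' - s + 2 * \<tau>"
        if "0 \<le> s" "s \<le> s'" "s' \<le> U" for s s'
      proof -
        have "{p\<in>S. s < v p \<and> v p \<le> s'} = {p\<in>S. v p \<le> s'} - {p\<in>S. v p \<le> s}" by auto
        then have "(\<Sum>p\<in>{p\<in>S. s < v p \<and> v p \<le> s'}. a p) = (\<Sum>p\<in>{p\<in>S. v p \<le> s'}. a p) - (\<Sum>p\<in>{p\<in>S. v p \<le> s}. a p)"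
          using S that by (simp only:) (rule sum_diff, auto)
        then show ?thesis using close[of s] close[of s'] vkernel_integral_diff_le[OF ker that(1,2)] that by auto
      qed
      have F01: "0 \<le> F s" "F s \<le> 1" for s
        using card_gen_set_le[of "y powr s" P] y by (auto simp: F_def)
      have bnd: "\<bar>\<Delta> s\<bar> \<le> 1" if "s \<in> {0..U}" for s
        using F01[of s] vsol_bounds[OF ker sol, of s] that by (auto simp: \<Delta>_def abs_le_iff)
      have init: "\<bar>\<Delta> s\<bar> \<le> y powr (- \<eta>)" if s: "s \<in> {\<eta>..1}" for s
      proof -
        have sy: "y powr s \<le> y" using powr_mono[of s 1 y] s y by simp
        have "gen_set P (y powr s) = {n. 1 \<le> n \<and> real n \<le> y powr s}"
        proof -
          have "p \<in> P" if "1 \<le> n" "real n \<le> y powr s" "prime p" "p dvd n" for n p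
          proof -
            have "p \<le> n" using that by (intro dvd_imp_le) auto
            then have "real p \<le> y" using that sy by linarith
            then show ?thesis using P that by (auto simp: primes_le_def)
          qed
          then show ?thesis by (auto simp: gen_set_def)
        qed
        then have "real (card (gen_set P (y powr s))) = of_int \<lfloor>y powr s\<rfloor>"
          using card_nat_le[of "y powr s"] by simp
        moreover have "\<sigma> s = 1" using vsolD(3)[OF sol, of s] s eta by auto
        ultimately have "\<Delta> s = (of_int \<lfloor>y powr s\<rfloor> - y powr s) / y powr s"
          using y by (simp add: \<Delta>_def F_def diff_divide_distrib)
        then have "\<bar>\<Delta> s\<bar> = \<bar>of_int \<lfloor>y powr s\<rfloor> - y powr s\<bar> / y powr s" by simp
        also have "\<dots> \<le> 1 / y powr s" by (rule divide_right_mono, linarith, simp)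
        also have "\<dots> = y powr (- s)" by (simp add: powr_minus divide_inverse)
        also have "\<dots> \<le> y powr (- \<eta>)" using s y by (intro powr_mono) auto
        finally show ?thesis .
      qed
      define \<kappa>' where "\<kappa>' = C / ln y + (\<omega> * (2 * U + \<tau>) + 2 * real n * \<tau>)"
      have kap0: "\<kappa>' \<ge> 0" using C y om tau U by (simp add: \<kappa>'_def)
      have rec: "s * \<bar>\<Delta> s\<bar> \<le> (\<Sum>p\<in>{p\<in>S. v p \<le> s}. a p * \<bar>\<Delta> (s - v p)\<bar>) + \<kappa>'" if s: "s \<in> {1..U}" for s
      proof -
        let ?Q = "P \<inter> primes_le (y powr s)" and ?x = "y powr s"
        have x: "?x \<ge> 1" using y s by (simp add: ge_one_powr_ge_zero)
        have SQ: "{p\<in>S. v p \<le> s} = ?Q" using Sv s by simp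
        have lnx: "ln ?x = s * ln y" using y by (simp add: ln_powr)
        have t1: "\<bar>s * F s - (\<Sum>p\<in>?Q. a p * F (s - v p))\<bar> \<le> C / ln y"
        proof -
          have "ln (real p) * real (card (gen_set P (?x / real p))) = ?x * ln y * (a p * F (s - v p))" if "p \<in> ?Q" for p
          proof -
            have p: "p \<in> primes_le ?x" "real p > 0" using that primes_le_ge_2[of p ?x] by auto
            have "y powr (s - v p) = ?x / real p" using yv[OF p(1)] by (simp add: powr_diff)
            then show ?thesis using p y x by (simp add: F_def a_def)
          qed
          then have sm: "(\<Sum>p\<in>?Q. ln (real p) * real (card (gen_set P (?x / real p)))) = ?x * ln y * (\<Sum>p\<in>?Q. a p * F (s - v p))"
            by (simp add: sum_distrib_left)
          have "real (card (gen_set P ?x)) * ln ?x = ?x * ln y * (s * F s)"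
            using x by (simp add: F_def lnx)
          with id[OF x, of P] sm have "\<bar>?x * ln y * (s * F s) - ?x * ln y * (\<Sum>p\<in>?Q. a p * F (s - v p))\<bar> \<le> C * ?x"
            by (simp only:)
          then have "\<bar>?x * ln y * (s * F s - (\<Sum>p\<in>?Q. a p * F (s - v p)))\<bar> \<le> C * ?x"
            by (simp only: right_diff_distrib)
          then have "\<bar>?x * ln y\<bar> * \<bar>s * F s - (\<Sum>p\<in>?Q. a p * F (s - v p))\<bar> \<le> ?x * C"
            by (simp only: abs_mult mult.commute)
          moreover have "\<bar>?x * ln y\<bar> = ?x * ln y" using x y by simp
          ultimately have "?x * ln y * \<bar>s * F s - (\<Sum>p\<in>?Q. a p * F (s - v p))\<bar> \<le> ?x * C"
            by (simp only:)
          then have "ln y * \<bar>s * F s - (\<Sum>p\<in>?Q. a p * F (s - v p))\<bar> \<le> C"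
            unfolding mult.assoc using x by (subst (asm) mult_le_cancel_left_pos) auto
          then show ?thesis using y by (simp add: pos_le_divide_eq mult.commute)
        qed
        have t2: "\<bar>(\<Sum>p\<in>?Q. a p * \<sigma> (s - v p)) - s * \<sigma> s\<bar> \<le> \<omega> * (2 * U + \<tau>) + 2 * real n * \<tau>"
        proof -
          have "\<bar>(\<Sum>p\<in>{p\<in>S. v p \<le> s}. a p * \<sigma> (s - v p)) - integral {0..s} (\<lambda>t. \<sigma> (s - t) * \<kappa> t)\<bar> \<le> \<omega> * (2 * s + \<tau>) + 2 * real n * \<tau>"
          proof (rule weighted_sum_vs_integral[OF S ker _ n(1)])
            show "continuous_on {0..s} (\<lambda>t. \<sigma> (s - t))"
              by (rule continuous_on_flip[OF vsolD(2)[OF sol, of s]]) simp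
            show "\<bar>\<sigma> (s - t)\<bar> \<le> 1" if "t \<in> {0..s}" for t
              using vsol_bounds[OF ker sol, of "s - t"] that by (auto simp: abs_le_iff)
            show "\<bar>\<sigma> (s - t) - \<sigma> (s - t')\<bar> \<le> \<omega>" if "t \<in> {0..s}" "t' \<in> {0..s}" "\<bar>t - t'\<bar> \<le> s / real n" for t t'
            proof -
              have "s / real n \<le> U / real n" using s by (intro divide_right_mono) auto
              then have "\<bar>(s - t) - (s - t')\<bar> < \<delta>" using that n by auto
              then show ?thesis using del(2)[of "s - t'" "s - t"] that s by fastforce
            qed
            show "\<bar>(\<Sum>p\<in>{p\<in>S. v p \<le> r}. a p) - integral {0..r} \<kappa>\<bar> \<le> \<tau>" if "r \<in> {0..s}" for r
              by (rule close) (use that s in auto)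
          qed (use s in auto)
          moreover have "\<omega> * (2 * s + \<tau>) \<le> \<omega> * (2 * U + \<tau>)" using om s by (intro mult_left_mono) auto
          ultimately show ?thesis unfolding SQ using vsolD(4)[OF sol, of s] s by auto
        qed
        have "s * \<Delta> s = (s * F s - (\<Sum>p\<in>?Q. a p * F (s - v p))) + (\<Sum>p\<in>?Q. a p * \<Delta> (s - v p)) + ((\<Sum>p\<in>?Q. a p * \<sigma> (s - v p)) - s * \<sigma> s)"
          by (simp add: \<Delta>_def right_diff_distrib sum_subtractf)
        moreover have "\<bar>\<Sum>p\<in>?Q. a p * \<Delta> (s - v p)\<bar> \<le> (\<Sum>p\<in>?Q. a p * \<bar>\<Delta> (s - v p)\<bar>)"
        proof (rule order_trans[OF sum_abs], rule sum_mono)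
          fix p assume "p \<in> ?Q"
          then have "p \<in> S" using SQ by blast
          then show "\<bar>a p * \<Delta> (s - v p)\<bar> \<le> a p * \<bar>\<Delta> (s - v p)\<bar>" using S by (simp add: abs_mult)
        qed
        ultimately have "\<bar>s * \<Delta> s\<bar> \<le> (\<Sum>p\<in>?Q. a p * \<bar>\<Delta> (s - v p)\<bar>) + \<kappa>'"
          using t1 t2 unfolding \<kappa>'_def by linarith
        then show ?thesis unfolding SQ using s by (simp add: abs_mult)
      qed
      have "\<bar>\<Delta> v0\<bar> \<le> 6 ^ j * (y powr (- \<eta>) + (\<eta> + 2 * \<tau> + \<kappa>'))"
        by (rule discrete_gronwall[OF S mass less_imp_le[OF tau] tau16 eta(1,2) bnd init _ rec kap0])
           (use v0 eta j in auto)
      also have "\<dots> \<le> E * (5 * c)"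
      proof -
        have "\<omega> * (2 * U + \<tau>) \<le> \<omega> * (2 * U + 1)" using om tau16 by (intro mult_left_mono) auto
        also have "\<dots> = c" using U by (simp add: \<omega>_def)
        finally have "\<omega> * (2 * U + \<tau>) \<le> c" .
        then have "y powr (- \<eta>) + (\<eta> + 2 * \<tau> + \<kappa>') \<le> 5 * c"
          using elim taun eta unfolding \<kappa>'_def by linarith
        then show ?thesis unfolding E_def by (intro mult_left_mono) auto
      qed
      also have "\<dots> \<le> e" using E e by (simp add: c_def)
      finally show "\<bar>real (card (gen_set P (y powr v0))) / y powr v0 - \<sigma> v0\<bar> \<le> e"
        by (simp add: \<Delta>_def F_def)
    qed
  qed
  with tau show ?thesis by blast
qed

section \<open>Large prime factors of iterates of the totient\<close>

text \<open>Ignoring repeated large prime factors, \<open>\<phi>\<^sub>k(n)\<close> is \<open>y\<close>-smooth iff all primes dividing \<open>n\<close> lie in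
  \<open>level_primes k y\<close>.\<close>

fun level_primes :: "nat \<Rightarrow> real \<Rightarrow> nat set" where
  "level_primes 0 y = primes_le y"
| "level_primes (Suc k) y = {p. prime p \<and> (\<forall>q. prime q \<and> q dvd p - 1 \<longrightarrow> q \<in> level_primes k y)}"

lemma primes_le_subset_level_primes: "primes_le y \<subseteq> level_primes k y"
proof (induction k)
  case (Suc k)
  show ?case
  proof
    fix p assume p: "p \<in> primes_le y"
    have "q \<in> level_primes k y" if q: "prime q" "q dvd p - 1" for q
    proof -
      have "p \<ge> 2" using p by (rule primes_le_ge_2)
      then have "q \<le> p - 1" using q by (intro dvd_imp_le) auto
      then have "real q \<le> y" using p by (auto simp: primes_le_def)
      then show ?thesis using q Suc by (auto simp: primes_le_def)
    qed
    then show "p \<in> level_primes (Suc k) y" using p by (auto simp: primes_le_def)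
  qed
qed simp

lemma phi_iter_0 [simp]: "phi_iter 0 n = n"
  by (simp add: phi_iter_def)

lemma phi_iter_Suc: "phi_iter (Suc k) n = phi_iter k (totient n)"
  by (simp add: phi_iter_def funpow_swap1)

lemma phi_iter_pos: "n > 0 \<Longrightarrow> phi_iter k n > 0"
  by (induction k arbitrary: n) (auto simp: phi_iter_Suc)

lemma phi_iter_dvd_mono: "a dvd b \<Longrightarrow> phi_iter k a dvd phi_iter k b"
  by (induction k arbitrary: a b) (auto simp: phi_iter_Suc intro: totient_dvd_mono totient_dvd)

text \<open>This direction has no exceptions: p - 1 = \<phi>(p) divides \<phi>(n), and
  \<open>phi_iter k\<close> preserves divisibility, so smoothness descends from n at level k + 1 to
  p - 1 at level k.\<close>

lemma smooth_phi_iter_imp_level_primes: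
  assumes "n \<ge> 1" "\<And>p. prime p \<Longrightarrow> p dvd phi_iter k n \<Longrightarrow> real p \<le> y" "prime p" "p dvd n"
  shows "p \<in> level_primes k y"
  using assms
proof (induction k arbitrary: n p)
  case 0
  then show ?case by (auto simp: primes_le_def)
next
  case (Suc k)
  have "totient p dvd totient n" using Suc.prems by (intro totient_dvd)
  then have dv: "phi_iter k (p - 1) dvd phi_iter k (totient n)"
    using Suc.prems by (intro phi_iter_dvd_mono) (simp add: totient_prime)
  have "q \<in> level_primes k y" if "prime q" "q dvd p - 1" for q
  proof (rule Suc.IH[OF _ _ that])
    show "p - 1 \<ge> 1" using prime_ge_2_nat[of p] Suc.prems by simp
    show "real r \<le> y" if "prime r" "r dvd phi_iter k (p - 1)" for r
      using Suc.prems(2)[of r] that dvd_trans[OF that(2) dv] by (simp add: phi_iter_Suc)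
  qed
  then show ?case using Suc.prems by auto
qed

section \<open>Completely additive functions and chains of primes\<close>

definition cadd :: "(nat \<Rightarrow> nat) \<Rightarrow> nat \<Rightarrow> nat" where
  "cadd g n = (\<Sum>p\<in>prime_factors n. multiplicity p n * g p)"

lemma cadd_superset:
  assumes "finite A" "prime_factors n \<subseteq> A" "\<And>p. p \<in> A \<Longrightarrow> prime p" "n > 0"
  shows "cadd g n = (\<Sum>p\<in>A. multiplicity p n * g p)"
  unfolding cadd_def
proof (rule sum.mono_neutral_left[OF assms(1,2)])
  show "\<forall>p\<in>A - prime_factors n. multiplicity p n * g p = 0"
    using assms(3,4) by (auto simp: in_prime_factors_iff not_dvd_imp_multiplicity_0)
qed

lemma cadd_mult:
  assumes "n > 0" "m > 0"
  shows "cadd g (n * m) = cadd g n + cadd g m"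
proof -
  let ?A = "prime_factors n \<union> prime_factors m"
  have pf: "prime_factors (n * m) = ?A" using assms by (intro prime_factors_product) auto
  have pr: "prime p" if "p \<in> ?A" for p using that by (auto simp: in_prime_factors_iff)
  have "cadd g (n * m) = (\<Sum>p\<in>?A. multiplicity p n * g p + multiplicity p m * g p)"
    unfolding cadd_def pf
    using assms pr by (intro sum.cong refl) (subst prime_elem_multiplicity_mult_distrib, auto simp: distrib_right)
  also have "\<dots> = cadd g n + cadd g m"
    using cadd_superset[of ?A n g] cadd_superset[of ?A m g] assms pr by (auto simp: sum.distrib)
  finally show ?thesis .
qed

lemma cadd_1 [simp]: "cadd g (Suc 0) = 0" by (simp add: cadd_def)

lemma cadd_power: "n > 0 \<Longrightarrow> cadd g (n ^ k) = k * cadd g n"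
  by (induction k) (auto simp: cadd_mult)

lemma cadd_prod: "finite A \<Longrightarrow> (\<And>x. x \<in> A \<Longrightarrow> f x > 0) \<Longrightarrow> cadd g (\<Prod>x\<in>A. f x) = (\<Sum>x\<in>A. cadd g (f x))"
  by (induction A rule: finite_induct) (auto simp: cadd_mult prod_pos)

text \<open>\<open>chain_count q j n\<close> counts, with multiplicity, the chains \<open>q | q\<^sub>1 - 1, q\<^sub>1 | q\<^sub>2 - 1, \<dots>, q\<^sub>j | n\<close>
  of primes.\<close>

fun chain_count :: "nat \<Rightarrow> nat \<Rightarrow> nat \<Rightarrow> nat" where
  "chain_count q 0 = cadd (\<lambda>p. if p = q then 1 else 0)"
| "chain_count q (Suc j) = cadd (\<lambda>p. chain_count q j (p - 1))"

lemma chain_count_eq_cadd: "\<exists>g. chain_count q j = cadd g"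
  by (cases j) auto

lemma chain_count_0:
  assumes "prime q" "n > 0"
  shows "chain_count q 0 n = multiplicity q n"
proof (cases "q dvd n")
  case True
  then show ?thesis using assms
    by (auto simp: cadd_def if_distrib sum.If_cases in_prime_factors_iff Int_absorb1 cong: if_cong)
next
  case False
  then show ?thesis using assms
    by (auto simp: cadd_def in_prime_factors_iff not_dvd_imp_multiplicity_0)
qed

text \<open>Primes increase along a chain, since q | q' - 1 forces q < q'. This confines q to q
  \<le> n and excludes chains from q through a smaller prime.\<close>

lemma chain_count_pos_imp:
  assumes "chain_count q j n > 0" "n > 0"
  shows "\<exists>p\<in>prime_factors n. q \<le> p"
  using assms
proof (induction j arbitrary: n)
  case 0
  have "q \<in> prime_factors n"
  proof (rule ccontr)
    assume "q \<notin> prime_factors n"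
    then have "chain_count q 0 n = 0" unfolding chain_count.simps cadd_def by (intro sum.neutral) auto
    with 0 show False by simp
  qed
  then show ?case by blast
next
  case (Suc j)
  have "(\<Sum>p\<in>prime_factors n. multiplicity p n * chain_count q j (p - 1)) \<noteq> 0"
    using Suc.prems(1) unfolding chain_count.simps cadd_def by (simp only: neq0_conv)
  then obtain p where "p \<in> prime_factors n" "multiplicity p n * chain_count q j (p - 1) \<noteq> 0"
    by (rule sum.not_neutral_contains_not_neutral)
  then have p: "p \<in> prime_factors n" "chain_count q j (p - 1) > 0" by auto
  have "p - 1 > 0" using p prime_ge_2_nat[of p] by (auto simp: in_prime_factors_iff)
  from Suc.IH[OF p(2) this] obtain r where r: "r \<in> prime_factors (p - 1)" "q \<le> r" by blast
  then have "r \<le> p - 1" using \<open>p - 1 > 0\<close> by (intro dvd_imp_le) (auto simp: in_prime_factors_iff)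
  then show ?case using r p by (intro bexI[of _ p]) auto
qed

text \<open>\<phi>(n) is the product of the p^(a - 1) (p - 1). The factors p - 1 account for the
  chains that are one link longer. The powers p^(a - 1) contribute nothing: for p > y the exponent
  is 0, and no chain from q > y passes through a prime p \<le> y.\<close>

lemma chain_count_totient:
  assumes n: "n > 0" and sq: "\<And>r. prime r \<Longrightarrow> y < real r \<Longrightarrow> \<not> r ^ 2 dvd n" and q: "y < real q"
  shows "chain_count q i (totient n) \<le> chain_count q (Suc i) n"
proof -
  obtain g where g: "chain_count q i = cadd g" using chain_count_eq_cadd by blast
  have "cadd g (totient n) = cadd g (\<Prod>p\<in>prime_factors n. p ^ (multiplicity p n - 1) * (p - 1))"
    using n by (simp add: totient_formula1)
  also have "\<dots> = (\<Sum>p\<in>prime_factors n. cadd g (p ^ (multiplicity p n - 1) * (p - 1)))"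
    by (rule cadd_prod) (auto simp: in_prime_factors_iff prime_gt_0_nat prime_gt_Suc_0_nat)
  also have "\<dots> \<le> (\<Sum>p\<in>prime_factors n. multiplicity p n * cadd g (p - 1))"
  proof (rule sum_mono)
    fix p assume p: "p \<in> prime_factors n"
    then have pr: "prime p" "p dvd n" "p > 0" "p - 1 > 0"
      using prime_gt_1_nat[of p] by (auto simp: in_prime_factors_iff)
    have m1: "multiplicity p n \<ge> 1" using p n by (auto simp: prime_factors_multiplicity)
    have "(multiplicity p n - 1) * cadd g p = 0"
    proof (cases "y < real p")
      case True
      then have "\<not> p ^ 2 dvd n" using sq pr by blast
      then have "multiplicity p n < 2" using pr n
        by (metis multiplicity_dvd' not_less)
      then show ?thesis by simp
    next
      case False
      have "cadd g p = 0"
      proof (rule ccontr)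
        assume "cadd g p \<noteq> 0"
        then have "\<exists>r\<in>prime_factors p. q \<le> r" using pr g by (intro chain_count_pos_imp[of q i]) auto
        then have "q \<le> p" using pr by (simp add: prime_factorization_prime)
        then show False using False q by linarith
      qed
      then show ?thesis by simp
    qed
    then have "cadd g (p ^ (multiplicity p n - 1) * (p - 1)) = cadd g (p - 1)"
      using pr by (simp add: cadd_mult cadd_power)
    also have "\<dots> \<le> multiplicity p n * cadd g (p - 1)" using m1 by simp
    finally show "cadd g (p ^ (multiplicity p n - 1) * (p - 1)) \<le> multiplicity p n * cadd g (p - 1)" .
  qed
  also have "\<dots> = chain_count q (Suc i) n" by (simp add: g cadd_def[of _ n])
  finally show ?thesis by (simp add: g)
qed

lemma multiplicity_phi_iter_le:
  assumes "prime q" "y < real q" "n > 0"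
    and "\<And>i' r. i' < i \<Longrightarrow> prime r \<Longrightarrow> y < real r \<Longrightarrow> \<not> r ^ 2 dvd phi_iter i' n"
  shows "multiplicity q (phi_iter i n) \<le> chain_count q i n"
  using assms
proof (induction i arbitrary: n)
  case 0
  then show ?case using chain_count_0[of q n] by simp
next
  case (Suc i)
  have "multiplicity q (phi_iter i (totient n)) \<le> chain_count q i (totient n)"
  proof (rule Suc.IH)
    show "\<not> r ^ 2 dvd phi_iter i' (totient n)" if "i' < i" "prime r" "y < real r" for i' r
      using Suc.prems(4)[of "Suc i'" r] that by (simp add: phi_iter_Suc)
  qed (use Suc.prems in auto)
  also have "\<dots> \<le> chain_count q (Suc i) n"
    using Suc.prems(4)[of 0] Suc.prems by (intro chain_count_totient[of _ y]) auto
  finally show ?case by (simp add: phi_iter_Suc)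
qed

lemma chain_count_level_primes:
  assumes "n > 0" "\<And>p. prime p \<Longrightarrow> p dvd n \<Longrightarrow> p \<in> level_primes k y" "prime q" "y < real q"
  shows "chain_count q k n = 0"
  using assms
proof (induction k arbitrary: n)
  case 0
  have "\<not> q dvd n" using 0(2)[of q] 0 by (auto simp: primes_le_def)
  then show ?case using chain_count_0[of q n] 0 by (simp add: not_dvd_imp_multiplicity_0)
next
  case (Suc k)
  have "chain_count q k (p - 1) = 0" if "p \<in> prime_factors n" for p
  proof (rule Suc.IH)
    have p: "prime p" "p dvd n" using that by (auto simp: in_prime_factors_iff)
    then show "p - 1 > 0" using prime_gt_1_nat[of p] by simp
    show "r \<in> level_primes k y" if "prime r" "r dvd p - 1" for r
      using Suc.prems(2)[OF p] that by simp
  qed (use Suc.prems in auto)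
  then show ?case by (simp add: cadd_def)
qed

text \<open>If no iterate before the k-th is divisible by the square of a prime above y, the
  multiplicity of q is at most a chain count, which is 0 here. Otherwise, at the first iterate
  divisible by such an r^2, minimality makes the multiplicity bound available and the chain count of
  r is at least 2.\<close>

lemma not_smooth_imp_chain_count:
  assumes n: "n > 0" "\<And>p. prime p \<Longrightarrow> p dvd n \<Longrightarrow> p \<in> level_primes k y"
    and q: "prime q" "q dvd phi_iter k n" "y < real q"
  shows "\<exists>i<k. \<exists>r. prime r \<and> y < real r \<and> chain_count r i n \<ge> 2"
proof (cases "\<exists>i<k. \<exists>r. prime r \<and> y < real r \<and> r ^ 2 dvd phi_iter i n")
  case True
  define Pr where "Pr i \<longleftrightarrow> i < k \<and> (\<exists>r. prime r \<and> y < real r \<and> r ^ 2 dvd phi_iter i n)" for i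
  obtain i0 where "Pr i0" using True by (auto simp: Pr_def)
  define i where "i = (LEAST i. Pr i)"
  have "Pr i" unfolding i_def by (rule LeastI[of Pr, OF \<open>Pr i0\<close>])
  then obtain r where r: "i < k" "prime r" "y < real r" "r ^ 2 dvd phi_iter i n" by (auto simp: Pr_def)
  have least: "\<not> r' ^ 2 dvd phi_iter i' n" if "i' < i" "prime r'" "y < real r'" for i' r'
    using not_less_Least[of i' Pr] that r by (auto simp: i_def Pr_def)
  have "2 \<le> multiplicity r (phi_iter i n)"
    using r phi_iter_pos[OF n(1), of i] by (intro multiplicity_geI) auto
  also have "\<dots> \<le> chain_count r i n"
    by (rule multiplicity_phi_iter_le[OF r(2,3) n(1) least])
  finally show ?thesis using r by blast
next
  case False
  have "multiplicity q (phi_iter k n) \<le> chain_count q k n"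
    by (rule multiplicity_phi_iter_le[OF q(1,3) n(1)]) (use False in blast)
  also have "\<dots> = 0" by (rule chain_count_level_primes[OF n q(1,3)])
  finally have "q \<notin> prime_factors (phi_iter k n)" by (simp add: prime_factors_multiplicity)
  with q phi_iter_pos[OF n(1), of k] show ?thesis by (simp add: in_prime_factors_iff)
qed


section \<open>Moments of chain counts with weights 1/n\<close>

definition upto_real :: "real \<Rightarrow> nat set" where
  "upto_real x = {n. 1 \<le> n \<and> real n \<le> x}"

lemma finite_upto_real [simp]: "finite (upto_real x)"
  unfolding upto_real_def by (rule finite_nat_pos_le)

lemma finite_nat_pos_le' [simp]: "finite {n. Suc 0 \<le> n \<and> real n \<le> x}"
  using finite_nat_pos_le[of x] by simp

text \<open>The weight 1/n turns n = p m into a factor 1/p at once, and the range of m may be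
  enlarged from x / p back to x. Logarithmic weights thus avoid tracking the length of the
  sum.\<close>

lemma sum_multiples_le:
  fixes h :: "nat \<Rightarrow> real"
  assumes p: "prime p" and h: "\<And>n. n \<ge> 1 \<Longrightarrow> h n \<ge> 0" "\<And>n. n \<ge> 1 \<Longrightarrow> \<not> p dvd n \<Longrightarrow> h n = 0"
  shows "(\<Sum>n\<in>upto_real x. h n / real n) \<le> 1 / real p * (\<Sum>n\<in>upto_real x. h (p * n) / real n)"
proof -
  have p1: "p \<ge> 1" using p prime_ge_1_nat by blast
  have "(\<Sum>n\<in>upto_real x. h n / real n) = (\<Sum>n\<in>{n\<in>upto_real x. p dvd n}. h n / real n)"
    by (rule sum.mono_neutral_right) (auto simp: h(2) upto_real_def)
  also have "\<dots> \<le> (\<Sum>n\<in>(\<lambda>m. p * m) ` upto_real x. h n / real n)"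
  proof (rule sum_mono2)
    show "{n\<in>upto_real x. p dvd n} \<subseteq> (\<lambda>m. p * m) ` upto_real x"
    proof
      fix n assume n: "n \<in> {n\<in>upto_real x. p dvd n}"
      then obtain m where m: "n = p * m" by auto
      have "m \<ge> 1" using n m by (cases m) (auto simp: upto_real_def)
      have "m \<le> n" using p1 m by simp
      then have "m \<in> upto_real x" using n \<open>m \<ge> 1\<close> by (auto simp: upto_real_def)
      with m show "n \<in> (\<lambda>m. p * m) ` upto_real x" by blast
    qed
    show "0 \<le> h n / real n" if "n \<in> (\<lambda>m. p * m) ` upto_real x - {n\<in>upto_real x. p dvd n}" for n
    proof -
      have "n \<ge> 1" using that p1 by (auto simp: upto_real_def Suc_le_eq)
      then show ?thesis using h(1)[of n] by simp
    qed
  qed auto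
  also have "\<dots> = (\<Sum>n\<in>upto_real x. h (p * n) / real (p * n))"
    using p1 by (subst sum.reindex) (auto simp: inj_on_def)
  also have "\<dots> = 1 / real p * (\<Sum>n\<in>upto_real x. h (p * n) / real n)"
    by (simp add: sum_distrib_left)
  finally show ?thesis .
qed

text \<open>Replacing n by p n raises the multiplicity of p by one, so the sum of multiplicities
  reappears in its own bound; since p \<ge> 2, solving for it costs at most a factor 2.\<close>

lemma geometric_bootstrap:
  fixes s r :: real
  assumes "prime p" "s \<le> 1 / real p * (r + s)" "r \<ge> 0"
  shows "s \<le> 2 / real p * r"
proof -
  have p: "real p \<ge> 2" using prime_ge_2_nat[OF assms(1)] by simp
  have "real p * s \<le> r + s" using assms(2) p by (simp add: field_simps)
  moreover have "s * (real p / 2) \<le> s * (real p - 1) \<or> s \<le> 0"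
    using p by (cases "s \<le> 0") (auto intro!: mult_left_mono)
  ultimately have "s * (real p / 2) \<le> r \<or> s \<le> 0" by (auto simp: algebra_simps)
  then show ?thesis
  proof
    assume "s * (real p / 2) \<le> r"
    then show ?thesis using p by (simp add: field_simps)
  next
    assume "s \<le> 0"
    moreover have "0 \<le> 2 / real p * r" using p assms by simp
    ultimately show ?thesis by linarith
  qed
qed

lemma multiplicity_times_prime:
  fixes p r n :: nat
  assumes "prime p" "prime r" "n \<ge> 1"
  shows "multiplicity r (p * n) = (if r = p then Suc (multiplicity r n) else multiplicity r n)"
proof -
  have "p \<noteq> 0" "n \<noteq> 0" using assms prime_gt_0_nat[of p] by auto
  then have "multiplicity r (p * n) = multiplicity r p + multiplicity r n"
    using assms by (intro prime_elem_multiplicity_mult_distrib) auto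
  moreover have "multiplicity r p = (if r = p then 1 else 0)"
    using assms by (auto simp: multiplicity_self prime_gt_0_nat prime_multiplicity_other)
  ultimately show ?thesis by simp
qed

lemma moment_multiplicity:
  assumes x: "x \<ge> 1" and L: "L = 1 + ln x" and p: "prime p"
  shows "(\<Sum>n\<in>upto_real x. real (multiplicity p n) / real n) \<le> 2 * L / real p"
proof -
  let ?s = "\<Sum>n\<in>upto_real x. real (multiplicity p n) / real n"
  have "?s \<le> 1 / real p * (\<Sum>n\<in>upto_real x. real (multiplicity p (p * n)) / real n)"
    by (rule sum_multiples_le[OF p]) (auto simp: not_dvd_imp_multiplicity_0)
  also have "(\<Sum>n\<in>upto_real x. real (multiplicity p (p * n)) / real n) = (\<Sum>n\<in>upto_real x. 1 / real n + real (multiplicity p n) / real n)"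
    by (intro sum.cong refl) (auto simp: upto_real_def multiplicity_times_prime[OF p p] add_divide_distrib)
  also have "\<dots> = (\<Sum>n\<in>upto_real x. 1 / real n) + ?s" by (simp add: sum.distrib)
  finally have "?s \<le> 2 / real p * (\<Sum>n\<in>upto_real x. 1 / real n)"
    by (rule geometric_bootstrap[OF p]) (simp add: sum_nonneg)
  also have "\<dots> \<le> 2 / real p * L"
    unfolding L using x by (intro mult_left_mono sum_recip_le) (auto simp: upto_real_def finite_nat_pos_le)
  finally show ?thesis by simp
qed

lemma moment_multiplicity_mixed:
  assumes x: "x \<ge> 1" and L: "L = 1 + ln x" and p: "prime p" "prime r" "p \<noteq> r"
  shows "(\<Sum>n\<in>upto_real x. real (multiplicity p n) * real (multiplicity r n) / real n) \<le> 4 * L / (real p * real r)"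
proof -
  let ?s = "\<Sum>n\<in>upto_real x. real (multiplicity p n) * real (multiplicity r n) / real n"
  have "?s \<le> 1 / real p * (\<Sum>n\<in>upto_real x. real (multiplicity p (p * n)) * real (multiplicity r (p * n)) / real n)"
    by (rule sum_multiples_le[OF p(1)]) (auto simp: not_dvd_imp_multiplicity_0)
  also have "(\<Sum>n\<in>upto_real x. real (multiplicity p (p * n)) * real (multiplicity r (p * n)) / real n)
      = (\<Sum>n\<in>upto_real x. real (multiplicity r n) / real n + real (multiplicity p n) * real (multiplicity r n) / real n)"
    using p(3) by (intro sum.cong refl) (auto simp: upto_real_def multiplicity_times_prime[OF p(1,1)] multiplicity_times_prime[OF p(1,2)] add_divide_distrib distrib_right)
  also have "\<dots> = (\<Sum>n\<in>upto_real x. real (multiplicity r n) / real n) + ?s" by (simp add: sum.distrib)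
  finally have "?s \<le> 2 / real p * (\<Sum>n\<in>upto_real x. real (multiplicity r n) / real n)"
    by (rule geometric_bootstrap[OF p(1)]) (simp add: sum_nonneg)
  also have "\<dots> \<le> 2 / real p * (2 * L / real r)"
    by (intro mult_left_mono moment_multiplicity[OF x L p(2)]) auto
  finally show ?thesis by simp
qed

lemma moment_multiplicity_factorial:
  assumes x: "x \<ge> 1" and L: "L = 1 + ln x" and p: "prime p"
  shows "(\<Sum>n\<in>upto_real x. real (multiplicity p n) * (real (multiplicity p n) - 1) / real n) \<le> 8 * L / (real p * real p)"
proof -
  let ?m = "\<lambda>n. real (multiplicity p n)"
  let ?s = "\<Sum>n\<in>upto_real x. ?m n * (?m n - 1) / real n"
  have nn: "0 \<le> ?m n * (?m n - 1)" for n by (cases "multiplicity p n") auto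
  have "?s \<le> 1 / real p * (\<Sum>n\<in>upto_real x. ?m (p * n) * (?m (p * n) - 1) / real n)"
    by (rule sum_multiples_le[OF p]) (auto simp: not_dvd_imp_multiplicity_0 nn)
  also have "(\<Sum>n\<in>upto_real x. ?m (p * n) * (?m (p * n) - 1) / real n) = (\<Sum>n\<in>upto_real x. 2 * (?m n / real n) + ?m n * (?m n - 1) / real n)"
  proof (intro sum.cong refl)
    fix n assume "n \<in> upto_real x"
    then have "?m (p * n) = ?m n + 1" "real n > 0"
      using multiplicity_times_prime[OF p p, of n] by (auto simp: upto_real_def)
    then show "?m (p * n) * (?m (p * n) - 1) / real n = 2 * (?m n / real n) + ?m n * (?m n - 1) / real n"
      by (simp only:) (simp add: field_simps)
  qed
  also have "\<dots> = 2 * (\<Sum>n\<in>upto_real x. ?m n / real n) + ?s" by (simp add: sum.distrib sum_distrib_left)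
  finally have "?s \<le> 2 / real p * (2 * (\<Sum>n\<in>upto_real x. ?m n / real n))"
    by (rule geometric_bootstrap[OF p]) (simp add: sum_nonneg)
  also have "\<dots> \<le> 2 / real p * (2 * (2 * L / real p))"
    by (intro mult_left_mono moment_multiplicity[OF x L p]) auto
  finally show ?thesis by simp
qed

lemma cadd_upto_real:
  assumes "n \<in> upto_real x"
  shows "cadd g n = (\<Sum>p\<in>primes_le x. multiplicity p n * g p)"
proof (rule cadd_superset[OF finite_primes_le])
  show "prime_factors n \<subseteq> primes_le x"
  proof
    fix p assume p: "p \<in> prime_factors n"
    then have "p \<le> n" using assms by (intro dvd_imp_le) (auto simp: in_prime_factors_iff upto_real_def)
    then show "p \<in> primes_le x" using p assms by (auto simp: in_prime_factors_iff upto_real_def primes_le_def)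
  qed
qed (use assms in \<open>auto simp: primes_le_def upto_real_def\<close>)

lemma first_moment_cadd:
  assumes x: "x \<ge> 1" and L: "L = 1 + ln x"
  shows "(\<Sum>n\<in>upto_real x. real (cadd g n) / real n) \<le> 2 * L * (\<Sum>p\<in>primes_le x. real (g p) / real p)"
proof -
  have "(\<Sum>n\<in>upto_real x. real (cadd g n) / real n) = (\<Sum>n\<in>upto_real x. \<Sum>p\<in>primes_le x. real (g p) * (real (multiplicity p n) / real n))"
    by (intro sum.cong refl) (simp add: cadd_upto_real sum_divide_distrib mult_ac)
  also have "\<dots> = (\<Sum>p\<in>primes_le x. real (g p) * (\<Sum>n\<in>upto_real x. real (multiplicity p n) / real n))"
    by (subst sum.swap) (simp add: sum_distrib_left)
  also have "\<dots> \<le> (\<Sum>p\<in>primes_le x. real (g p) * (2 * L / real p))"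
    by (intro sum_mono mult_left_mono moment_multiplicity[OF x L]) (auto simp: primes_le_def)
  also have "\<dots> = 2 * L * (\<Sum>p\<in>primes_le x. real (g p) / real p)"
    by (simp add: sum_distrib_left mult_ac)
  finally show ?thesis .
qed

text \<open>The factorial moment vanishes at the values 0 and 1 and so detects repetitions only. On
  the diagonal, with multiplicity m and value g, m g (m g - 1) = g^2 m (m - 1) + g (g - 1) m: either
  p itself repeats, which gains 1/p^2, or the repetition lies within g.\<close>

lemma second_moment_cadd:
  assumes x: "x \<ge> 1" and L: "L = 1 + ln x"
  shows "(\<Sum>n\<in>upto_real x. real (cadd g n) * (real (cadd g n) - 1) / real n) \<le>
    8 * L * (\<Sum>p\<in>primes_le x. real (g p) / real p)\<^sup>2 + 2 * L * (\<Sum>p\<in>primes_le x. real (g p) * (real (g p) - 1) / real p)"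
proof -
  let ?P = "primes_le x" and ?m = "\<lambda>p n. real (multiplicity p n)" and ?g = "\<lambda>p. real (g p)"
  have L0: "L \<ge> 0" using x by (simp add: L)
  define T where "T p r n = (?m p n * ?m r n * ?g p * ?g r - (if p = r then ?m p n * ?g p else 0)) / real n" for p r n
  have "real (cadd g n) * (real (cadd g n) - 1) / real n = (\<Sum>p\<in>?P. \<Sum>r\<in>?P. T p r n)" if n: "n \<in> upto_real x" for n
  proof -
    have "real (cadd g n) * (real (cadd g n) - 1) = (\<Sum>p\<in>?P. ?m p n * ?g p) * (\<Sum>r\<in>?P. ?m r n * ?g r) - (\<Sum>p\<in>?P. ?m p n * ?g p)"
      using cadd_upto_real[OF n, of g] by (simp add: right_diff_distrib)
    also have "\<dots> = (\<Sum>p\<in>?P. \<Sum>r\<in>?P. ?m p n * ?m r n * ?g p * ?g r) - (\<Sum>p\<in>?P. \<Sum>r\<in>?P. if p = r then ?m p n * ?g p else 0)"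
      by (simp add: sum_product mult_ac)
    also have "\<dots> = (\<Sum>p\<in>?P. \<Sum>r\<in>?P. ?m p n * ?m r n * ?g p * ?g r - (if p = r then ?m p n * ?g p else 0))"
      by (simp add: sum_subtractf)
    finally show ?thesis by (simp add: T_def sum_divide_distrib)
  qed
  then have "(\<Sum>n\<in>upto_real x. real (cadd g n) * (real (cadd g n) - 1) / real n) = (\<Sum>n\<in>upto_real x. \<Sum>p\<in>?P. \<Sum>r\<in>?P. T p r n)"
    by (intro sum.cong refl)
  also have "\<dots> = (\<Sum>p\<in>?P. \<Sum>r\<in>?P. \<Sum>n\<in>upto_real x. T p r n)"
    by (subst sum.swap) (rule sum.cong[OF refl], rule sum.swap)
  also have "\<dots> \<le> (\<Sum>p\<in>?P. \<Sum>r\<in>?P. 8 * L * (?g p / real p * (?g r / real r)) + (if p = r then 2 * L * (?g p * (?g p - 1) / real p) else 0))"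
  proof (intro sum_mono)
    fix p r assume pr: "p \<in> ?P" "r \<in> ?P"
    then have prime: "prime p" "prime r" by (auto simp: primes_le_def)
    show "(\<Sum>n\<in>upto_real x. T p r n) \<le> 8 * L * (?g p / real p * (?g r / real r)) + (if p = r then 2 * L * (?g p * (?g p - 1) / real p) else 0)"
    proof (cases "p = r")
      case False
      have "(\<Sum>n\<in>upto_real x. T p r n) = ?g p * ?g r * (\<Sum>n\<in>upto_real x. ?m p n * ?m r n / real n)"
        using False by (simp add: T_def sum_distrib_left mult_ac)
      also have "\<dots> \<le> ?g p * ?g r * (4 * L / (real p * real r))"
        by (intro mult_left_mono moment_multiplicity_mixed[OF x L prime False]) auto
      also have "\<dots> \<le> ?g p * ?g r * (8 * L / (real p * real r))"
        using L0 by (intro mult_left_mono divide_right_mono) auto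
      finally show ?thesis using False by (simp add: mult_ac)
    next
      case True
      have gg: "?g p * (?g p - 1) \<ge> 0" by (cases "g p") auto
      have "(\<Sum>n\<in>upto_real x. T p r n) = (\<Sum>n\<in>upto_real x. ?g p * ?g p * (?m p n * (?m p n - 1) / real n) + ?g p * (?g p - 1) * (?m p n / real n))"
        using True by (intro sum.cong refl) (simp add: T_def upto_real_def field_simps)
      also have "\<dots> = ?g p * ?g p * (\<Sum>n\<in>upto_real x. ?m p n * (?m p n - 1) / real n) + ?g p * (?g p - 1) * (\<Sum>n\<in>upto_real x. ?m p n / real n)"
        by (simp add: sum.distrib sum_distrib_left)
      also have "\<dots> \<le> ?g p * ?g p * (8 * L / (real p * real p)) + ?g p * (?g p - 1) * (2 * L / real p)"
        by (intro add_mono mult_left_mono moment_multiplicity_factorial[OF x L prime(1)] moment_multiplicity[OF x L prime(1)] gg) auto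
      finally show ?thesis using True by (simp add: mult_ac)
    qed
  qed
  also have "\<dots> = 8 * L * (\<Sum>p\<in>?P. ?g p / real p)\<^sup>2 + 2 * L * (\<Sum>p\<in>?P. ?g p * (?g p - 1) / real p)"
  proof -
    have "(\<Sum>p\<in>?P. \<Sum>r\<in>?P. 8 * L * (a p * a r) + (if p = r then b p else 0)) = 8 * L * (\<Sum>p\<in>?P. a p)\<^sup>2 + (\<Sum>p\<in>?P. b p)"
      for a b :: "nat \<Rightarrow> real"
    proof -
      have "(\<Sum>p\<in>?P. \<Sum>r\<in>?P. 8 * L * (a p * a r)) = 8 * L * (\<Sum>p\<in>?P. a p)\<^sup>2"
        unfolding power2_eq_square sum_product by (simp only: sum_distrib_left)
      then show ?thesis by (simp add: sum.distrib)
    qed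
    from this[of "\<lambda>p. ?g p / real p" "\<lambda>p. 2 * L * (?g p * (?g p - 1) / real p)"] show ?thesis
      by (simp only: sum_distrib_left)
  qed
  finally show ?thesis .
qed

text \<open>Forgetting that p is prime costs logarithmic factors only, which is affordable because
  the final saving is a power of x.\<close>

lemma sum_shifted_primes_le:
  fixes f :: "nat \<Rightarrow> real"
  assumes "\<And>n. f n \<ge> 0"
  shows "(\<Sum>p\<in>primes_le x. f (p - 1) / real p) \<le> (\<Sum>n\<in>upto_real x. f n / real n)"
proof -
  have "(\<Sum>p\<in>primes_le x. f (p - 1) / real p) \<le> (\<Sum>p\<in>primes_le x. f (p - 1) / real (p - 1))"
  proof (rule sum_mono)
    fix p assume "p \<in> primes_le x"
    then have "p \<ge> 2" by (rule primes_le_ge_2)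
    then show "f (p - 1) / real p \<le> f (p - 1) / real (p - 1)"
      using assms by (intro divide_left_mono) auto
  qed
  also have "\<dots> = (\<Sum>n\<in>(\<lambda>p. p - 1) ` primes_le x. f n / real n)"
    by (subst sum.reindex) (auto simp: inj_on_def dest!: primes_le_ge_2)
  also have "\<dots> \<le> (\<Sum>n\<in>upto_real x. f n / real n)"
  proof (rule sum_mono2)
    show "(\<lambda>p. p - 1) ` primes_le x \<subseteq> upto_real x"
    proof clarify
      fix p assume p: "p \<in> primes_le x"
      then show "p - 1 \<in> upto_real x" using primes_le_ge_2[OF p] by (auto simp: primes_le_def upto_real_def)
    qed
  qed (use assms in auto)
  finally show ?thesis .
qed

text \<open>A pair of chains ending in n either uses two prime factors of n, counted with
  multiplicity, and contributes the square of a first moment of order 1/q; or it uses a single one,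
  p, and is a pair of chains ending in p - 1. Powers of L are wasted freely.\<close>

lemma chain_count_moments:
  assumes x: "x \<ge> 1" and L: "L = 1 + ln x" and q: "prime q"
  shows "(\<Sum>n\<in>upto_real x. real (chain_count q j n) / real n) \<le> (2 * L) ^ (j + 1) / real q \<and>
     (\<Sum>n\<in>upto_real x. real (chain_count q j n) * (real (chain_count q j n) - 1) / real n) \<le> (8 * L) ^ (2 * j + 1) / (real q)\<^sup>2"
proof (induction j)
  case 0
  let ?g = "\<lambda>p. if p = q then 1 else 0 :: nat"
  have L0: "L \<ge> 0" using x by (simp add: L)
  have q0: "real q > 0" using q by (simp add: prime_gt_0_nat)
  have H1: "(\<Sum>p\<in>primes_le x. real (?g p) / real p) \<le> 1 / real q"
    by (simp add: if_distrib[of "\<lambda>a. real a / _"] sum.delta cong: if_cong)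
  have H2: "(\<Sum>p\<in>primes_le x. real (?g p) * (real (?g p) - 1) / real p) = 0"
    by (intro sum.neutral) auto
  have H0: "0 \<le> (\<Sum>p\<in>primes_le x. real (?g p) / real p)" by (intro sum_nonneg) auto
  have "2 * L * (\<Sum>p\<in>primes_le x. real (?g p) / real p) \<le> 2 * L * (1 / real q)"
    using L0 by (intro mult_left_mono H1) auto
  moreover have "8 * L * (\<Sum>p\<in>primes_le x. real (?g p) / real p)\<^sup>2 \<le> 8 * L * (1 / real q)\<^sup>2"
    using L0 by (intro mult_left_mono power_mono H1 H0) auto
  ultimately show ?case
    using first_moment_cadd[OF x L, of ?g] second_moment_cadd[OF x L, of ?g] H2
    by (simp add: power_one_over)
next
  case (Suc j)
  let ?f = "chain_count q j" and ?g = "\<lambda>p. chain_count q j (p - 1)"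
  define S where "S = (\<Sum>n\<in>upto_real x. real (?f n) / real n)"
  define T where "T = (\<Sum>n\<in>upto_real x. real (?f n) * (real (?f n) - 1) / real n)"
  have L1: "L \<ge> 1" using x by (simp add: L)
  have q0: "real q > 0" using q by (simp add: prime_gt_0_nat)
  have IH: "S \<le> (2 * L) ^ (j + 1) / real q" "T \<le> (8 * L) ^ (2 * j + 1) / (real q)\<^sup>2" using Suc by (auto simp: S_def T_def)
  have H1: "(\<Sum>p\<in>primes_le x. real (?g p) / real p) \<le> S"
    unfolding S_def by (rule sum_shifted_primes_le) simp
  have H2: "(\<Sum>p\<in>primes_le x. real (?g p) * (real (?g p) - 1) / real p) \<le> T"
    unfolding T_def
  proof (rule sum_shifted_primes_le[of "\<lambda>n. real (?f n) * (real (?f n) - 1)"])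
    fix n show "0 \<le> real (?f n) * (real (?f n) - 1)" by (cases "?f n") auto
  qed
  have H0: "0 \<le> (\<Sum>p\<in>primes_le x. real (?g p) / real p)" by (intro sum_nonneg) auto
  have "(\<Sum>n\<in>upto_real x. real (cadd ?g n) / real n) \<le> 2 * L * (\<Sum>p\<in>primes_le x. real (?g p) / real p)"
    by (rule first_moment_cadd[OF x L])
  also have "\<dots> \<le> 2 * L * ((2 * L) ^ (j + 1) / real q)"
    using H1 IH L1 by (intro mult_left_mono) auto
  finally have 1: "(\<Sum>n\<in>upto_real x. real (cadd ?g n) / real n) \<le> (2 * L) ^ (Suc j + 1) / real q" by simp
  have "(\<Sum>n\<in>upto_real x. real (cadd ?g n) * (real (cadd ?g n) - 1) / real n) \<le>
    8 * L * (\<Sum>p\<in>primes_le x. real (?g p) / real p)\<^sup>2 + 2 * L * (\<Sum>p\<in>primes_le x. real (?g p) * (real (?g p) - 1) / real p)"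
    by (rule second_moment_cadd[OF x L])
  also have "\<dots> \<le> 8 * L * ((2 * L) ^ (j + 1) / real q)\<^sup>2 + 2 * L * ((8 * L) ^ (2 * j + 1) / (real q)\<^sup>2)"
    using H0 H1 H2 IH L1 by (intro add_mono mult_left_mono power_mono) auto
  also have "\<dots> = (8 * L * (2 * L) ^ (2 * (j + 1)) + 2 * L * (8 * L) ^ (2 * j + 1)) / (real q)\<^sup>2"
  proof -
    have "((2 * L) ^ (j + 1))\<^sup>2 = (2 * L) ^ (2 * (j + 1))" by (metis power_mult mult.commute)
    then show ?thesis by (simp only: power_divide add_divide_distrib times_divide_eq_right)
  qed
  also have "\<dots> \<le> (8 * L) ^ (2 * Suc j + 1) / (real q)\<^sup>2"
  proof (rule divide_right_mono)
    \<comment> \<open>In terms of K each of the two summands is at most half of the target K^(2 j +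
      3).\<close>
    define K where "K = 8 * L"
    have K: "K \<ge> 8" using L1 by (simp add: K_def)
    have K2: "2 * L = K / 4" by (simp add: K_def)
    have "(K / 4) ^ (2 * (j + 1)) = K ^ (2 * (j + 1)) / 4 ^ (2 * (j + 1))" by (rule power_divide)
    also have "\<dots> \<le> K ^ (2 * (j + 1)) / 2"
      using K self_le_power[of "4::real" "2 * (j + 1)"] by (intro divide_left_mono) auto
    finally have "K * (K / 4) ^ (2 * (j + 1)) \<le> K * (K ^ (2 * (j + 1)) / 2)"
      using K by (intro mult_left_mono) auto
    also have "\<dots> = K ^ (2 * Suc j + 1) / 2" by simp
    finally have a: "K * (K / 4) ^ (2 * (j + 1)) \<le> K ^ (2 * Suc j + 1) / 2" .
    have "K / 4 * K ^ (2 * j + 1) \<le> K * K / 2 * K ^ (2 * j + 1)"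
      using K by (intro mult_right_mono) (auto simp: field_simps)
    also have "\<dots> = K ^ (2 * Suc j + 1) / 2" by simp
    finally have b: "K / 4 * K ^ (2 * j + 1) \<le> K ^ (2 * Suc j + 1) / 2" .
    show "8 * L * (2 * L) ^ (2 * (j + 1)) + 2 * L * (8 * L) ^ (2 * j + 1) \<le> (8 * L) ^ (2 * Suc j + 1)"
      unfolding K_def[symmetric] K2 using a b by linarith
  qed simp
  finally show ?case using 1 by simp
qed

lemma sum_inverse_squares_le:
  assumes "finite A" "\<And>q. q \<in> A \<Longrightarrow> y < real q" "y \<ge> 1"
  shows "(\<Sum>q\<in>A. 1 / (real q)\<^sup>2) \<le> 2 / y"
proof -
  define m where "m = nat \<lfloor>y\<rfloor>"
  have m: "m \<ge> 1" "real m \<le> y" "y < real m + 1" unfolding m_def using assms(3) by linarith+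
  have tel: "(\<Sum>q\<in>{m<..m + k}. 1 / (real q)\<^sup>2) \<le> 1 / real m - 1 / real (m + k)" for k
  proof (induction k)
    case (Suc k)
    let ?a = "real (m + k)"
    have a: "?a \<ge> 1" using m by simp
    have "{m<..m + Suc k} = insert (Suc (m + k)) {m<..m + k}" by auto
    then have "(\<Sum>q\<in>{m<..m + Suc k}. 1 / (real q)\<^sup>2) = 1 / (?a + 1)\<^sup>2 + (\<Sum>q\<in>{m<..m + k}. 1 / (real q)\<^sup>2)"
      by (simp add: add.commute)
    also have "1 / (?a + 1)\<^sup>2 \<le> 1 / (?a * (?a + 1))"
      using a by (intro divide_left_mono) (auto simp: power2_eq_square)
    also have "1 / (?a * (?a + 1)) = 1 / ?a - 1 / (?a + 1)" using a by (simp add: field_simps)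
    finally show ?case using Suc by (simp add: add.commute)
  qed simp
  obtain k where k: "\<And>q. q \<in> A \<Longrightarrow> q \<le> k" using assms(1) by (meson finite_nat_set_iff_bounded_le)
  have "A \<subseteq> {m<..m + k}"
  proof
    fix q assume "q \<in> A"
    then have "real m < real q" using assms(2) m by fastforce
    then show "q \<in> {m<..m + k}" using k[OF \<open>q \<in> A\<close>] by simp
  qed
  then have "(\<Sum>q\<in>A. 1 / (real q)\<^sup>2) \<le> (\<Sum>q\<in>{m<..m + k}. 1 / (real q)\<^sup>2)" by (intro sum_mono2) auto
  also have "\<dots> \<le> 1 / real m - 1 / real (m + k)" by (rule tel)
  also have "\<dots> \<le> 1 / real m" by simp
  also have "\<dots> \<le> 2 / y"
  proof -
    have "1 \<le> real m" using m by simp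
    then have "y \<le> 2 * real m" using m by linarith
    then show ?thesis using \<open>1 \<le> real m\<close> assms(3) by (simp add: field_simps)
  qed
  finally show ?thesis .
qed

text \<open>An exceptional n has chain count at least 2 for some prime q > y and some i < k. The
  inequalities 1 \<le> x / n and 1 \<le> c (c - 1) for such a count c turn the weighted factorial
  moment into a cardinality bound, and \<Sum> 1/q^2 over q > y supplies the factor 2 / y.\<close>

theorem Phi_count_approx:
  assumes x: "x \<ge> 1" and y: "y \<ge> 1"
  shows "Phi_count k x y \<le> card (gen_set (level_primes k y) x)"
    and "real (card (gen_set (level_primes k y) x)) \<le> real (Phi_count k x y) + x * (real k * (8 * (1 + ln x)) ^ (2 * k) * (2 / y))"
proof -
  define L where "L = 1 + ln x"
  have L1: "L \<ge> 1" using x by (simp add: L_def)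
  define G where "G = gen_set (level_primes k y) x"
  define F where "F = {n :: nat. 1 \<le> n \<and> real n \<le> x \<and> (\<forall>p. prime p \<and> p dvd phi_iter k n \<longrightarrow> real p \<le> y)}"
  have PF: "Phi_count k x y = card F" by (simp add: Phi_count_def F_def)
  have FG: "F \<subseteq> G"
    using smooth_phi_iter_imp_level_primes by (auto simp: F_def G_def gen_set_def)
  have finG: "finite G" by (simp add: G_def)
  show "Phi_count k x y \<le> card (gen_set (level_primes k y) x)"
    unfolding PF G_def[symmetric] by (rule card_mono[OF finG FG])
  define R where "R = primes_le x - primes_le y"
  define B where "B i q = {n\<in>upto_real x. chain_count q i n \<ge> 2}" for i q
  have finB: "finite (B i q)" for i q by (simp add: B_def)
  have "G - F \<subseteq> (\<Union>i<k. \<Union>q\<in>R. B i q)"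
  proof
    fix n assume n: "n \<in> G - F"
    then have n1: "n > 0" "real n \<le> x" "\<And>p. prime p \<Longrightarrow> p dvd n \<Longrightarrow> p \<in> level_primes k y"
      by (auto simp: G_def gen_set_def)
    from n obtain q where q: "prime q" "q dvd phi_iter k n" "y < real q"
      by (auto simp: G_def F_def gen_set_def)
    from not_smooth_imp_chain_count[OF n1(1,3) q] obtain i r
      where r: "i < k" "prime r" "y < real r" "chain_count r i n \<ge> 2" by blast
    obtain p where p: "p \<in> prime_factors n" "r \<le> p"
      using chain_count_pos_imp[of r i n] r n1 by auto
    have "p \<le> n" using p n1 by (intro dvd_imp_le) (auto simp: in_prime_factors_iff)
    then have "r \<in> R" using p r n1 by (auto simp: R_def primes_le_def)
    moreover have "n \<in> B i r" using r n1 by (auto simp: B_def upto_real_def)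
    ultimately show "n \<in> (\<Union>i<k. \<Union>q\<in>R. B i q)" using r by blast
  qed
  then have "card (G - F) \<le> card (\<Union>i<k. \<Union>q\<in>R. B i q)"
    by (intro card_mono) (auto simp: finB R_def)
  also have "\<dots> \<le> (\<Sum>i<k. \<Sum>q\<in>R. card (B i q))"
    by (rule order_trans[OF card_UN_le]) (auto simp: R_def intro!: sum_mono card_UN_le)
  finally have "real (card (G - F)) \<le> real (\<Sum>i<k. \<Sum>q\<in>R. card (B i q))" by (rule of_nat_mono)
  also have "\<dots> = (\<Sum>i<k. \<Sum>q\<in>R. real (card (B i q)))" by simp
  also have "\<dots> \<le> (\<Sum>i<k. \<Sum>q\<in>R. x * (8 * L) ^ (2 * k) * (1 / (real q)\<^sup>2))"
  proof (intro sum_mono)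
    fix i q assume i: "i \<in> {..<k}" and q: "q \<in> R"
    have pq: "prime q" using q by (auto simp: R_def primes_le_def)
    let ?c = "\<lambda>n. real (chain_count q i n)"
    have nn: "0 \<le> ?c n * (?c n - 1)" for n by (cases "chain_count q i n") auto
    have "real (card (B i q)) = (\<Sum>n\<in>B i q. 1)" by simp
    also have "\<dots> \<le> (\<Sum>n\<in>B i q. x * (?c n * (?c n - 1) / real n))"
    proof (rule sum_mono)
      fix n assume n: "n \<in> B i q"
      have "2 * 1 \<le> ?c n * (?c n - 1)" using n by (intro mult_mono) (auto simp: B_def)
      then have "1 * 1 \<le> (x / real n) * (?c n * (?c n - 1))"
        using n by (intro mult_mono) (auto simp: B_def upto_real_def)
      then show "1 \<le> x * (?c n * (?c n - 1) / real n)" by simp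
    qed
    also have "\<dots> \<le> (\<Sum>n\<in>upto_real x. x * (?c n * (?c n - 1) / real n))"
      using x by (intro sum_mono2) (auto simp: B_def intro!: divide_nonneg_nonneg mult_nonneg_nonneg[of x] nn)
    also have "\<dots> = x * (\<Sum>n\<in>upto_real x. ?c n * (?c n - 1) / real n)" by (simp add: sum_distrib_left)
    also have "\<dots> \<le> x * ((8 * L) ^ (2 * i + 1) / (real q)\<^sup>2)"
      using x chain_count_moments[OF x L_def pq, of i] by (intro mult_left_mono) auto
    also have "\<dots> \<le> x * ((8 * L) ^ (2 * k) / (real q)\<^sup>2)"
      using x L1 i by (intro mult_left_mono divide_right_mono power_increasing) auto
    finally show "real (card (B i q)) \<le> x * (8 * L) ^ (2 * k) * (1 / (real q)\<^sup>2)" by simp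
  qed
  also have "\<dots> = x * (8 * L) ^ (2 * k) * real k * (\<Sum>q\<in>R. 1 / (real q)\<^sup>2)"
  proof -
    have "(\<Sum>i<k. \<Sum>q\<in>R. c * f q) = c * real k * (\<Sum>q\<in>R. f q)" for c :: real and f
      by (simp add: sum_distrib_left mult_ac)
    then show ?thesis .
  qed
  also have "\<dots> \<le> x * (8 * L) ^ (2 * k) * real k * (2 / y)"
  proof (intro mult_left_mono sum_inverse_squares_le)
    show "y < real q" if "q \<in> R" for q using that by (auto simp: R_def primes_le_def)
  qed (use x L1 y in \<open>auto simp: R_def\<close>)
  finally have "real (card (G - F)) \<le> x * (8 * L) ^ (2 * k) * real k * (2 / y)" .
  moreover have "real (card (G - F)) = real (card G) - real (card F)"
    using card_Diff_subset[OF finite_subset[OF FG finG] FG] card_mono[OF finG FG] by simp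
  ultimately show "real (card (gen_set (level_primes k y) x)) \<le> real (Phi_count k x y) + x * (real k * (8 * (1 + ln x)) ^ (2 * k) * (2 / y))"
    by (simp add: PF G_def L_def mult_ac)
qed

section \<open>The density of admissible primes\<close>

text \<open>Partial summation without evaluating the sums: X - RR g and Y - CC g change from j to j
  + 1 by a partial sum times the decrement of g, so the bound on partial sums carries over step by
  step. At j = m both X and Y are empty, and the factor 2 compensates the term -
  \<open>CC m * g m\<close>.\<close>

lemma abel_transfer:
  fixes r c g :: "nat \<Rightarrow> real"
  assumes g: "\<And>j. m \<le> j \<Longrightarrow> g (Suc j) \<le> g j" "\<And>j. g j \<ge> 0" and c: "\<And>j. c j \<ge> 0"
    and R: "\<And>j. m \<le> j \<Longrightarrow> j \<le> n \<Longrightarrow> \<bar>\<Sum>k\<le>j. r k\<bar> \<le> \<theta> * (\<Sum>k\<le>j. c k)" and mn: "m \<le> n"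
  shows "\<bar>\<Sum>k\<in>{m<..n}. r k * g k\<bar> \<le> \<theta> * ((\<Sum>k\<in>{m<..n}. c k * g k) + 2 * ((\<Sum>k\<le>m. c k) * g m))"
proof -
  define RR where "RR j = (\<Sum>k\<le>j. r k)" for j
  define CC where "CC j = (\<Sum>k\<le>j. c k)" for j
  define X where "X j = (\<Sum>k\<in>{m<..j}. r k * g k)" for j
  define Y where "Y j = (\<Sum>k\<in>{m<..j}. c k * g k)" for j
  have inv: "\<bar>X j - RR j * g j\<bar> \<le> \<theta> * (Y j - CC j * g j + 2 * (CC m * g m))" if "m \<le> j" "j \<le> n" for j
    using that
  proof (induction j rule: dec_induct)
    case base
    have "\<bar>RR m\<bar> * g m \<le> \<theta> * CC m * g m"
      using R[of m] mn g by (intro mult_right_mono) (auto simp: RR_def CC_def)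
    then show ?case using g by (simp add: X_def Y_def abs_mult algebra_simps)
  next
    case (step j)
    have ins: "{m<..Suc j} = insert (Suc j) {m<..j}" using step by auto
    have "X (Suc j) = X j + r (Suc j) * g (Suc j)" "Y (Suc j) = Y j + c (Suc j) * g (Suc j)"
      by (simp_all add: X_def Y_def ins)
    moreover have "RR (Suc j) = RR j + r (Suc j)" "CC (Suc j) = CC j + c (Suc j)" by (simp_all add: RR_def CC_def)
    ultimately have 1: "X (Suc j) - RR (Suc j) * g (Suc j) = (X j - RR j * g j) + RR j * (g j - g (Suc j))"
      and 2: "Y (Suc j) - CC (Suc j) * g (Suc j) = (Y j - CC j * g j) + CC j * (g j - g (Suc j))"
      by (simp_all add: algebra_simps)
    have "\<bar>RR j * (g j - g (Suc j))\<bar> \<le> \<theta> * CC j * (g j - g (Suc j))"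
      unfolding abs_mult using R[of j] step g(1)[of j] by (auto simp: RR_def CC_def intro!: mult_right_mono)
    moreover have "\<bar>X j - RR j * g j\<bar> \<le> \<theta> * (Y j - CC j * g j + 2 * (CC m * g m))" using step by simp
    ultimately have "\<bar>X (Suc j) - RR (Suc j) * g (Suc j)\<bar> \<le> \<theta> * (Y j - CC j * g j + 2 * (CC m * g m)) + \<theta> * CC j * (g j - g (Suc j))"
      unfolding 1 by linarith
    also have "\<dots> = \<theta> * (Y (Suc j) - CC (Suc j) * g (Suc j) + 2 * (CC m * g m))"
      unfolding 2 by (simp add: algebra_simps)
    finally show ?case .
  qed
  have "\<bar>RR n\<bar> * g n \<le> \<theta> * CC n * g n"
    using R[of n] mn g by (intro mult_right_mono) (auto simp: RR_def CC_def)
  then have "\<bar>RR n * g n\<bar> \<le> \<theta> * (CC n * g n)" using g(2)[of n] by (simp add: abs_mult mult.assoc)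
  moreover have "\<theta> * (Y n - CC n * g n + 2 * (CC m * g m)) + \<theta> * (CC n * g n) = \<theta> * (Y n + 2 * (CC m * g m))"
    by (simp add: algebra_simps)
  ultimately have "\<bar>X n\<bar> \<le> \<theta> * (Y n + 2 * (CC m * g m))" using inv[OF mn order_refl] by linarith
  then show ?thesis by (simp add: X_def Y_def CC_def)
qed

lemma ln_div_self_Suc_le:
  assumes "3 \<le> j"
  shows "ln (real (Suc j)) / real (Suc j) \<le> ln (real j) / real j"
proof -
  have j: "real j \<ge> 3" using assms by simp
  have "ln (real (Suc j)) = ln (real j) + ln (1 + 1 / real j)"
  proof -
    have "real (Suc j) = real j * (1 + 1 / real j)" using j by (simp add: field_simps)
    then show ?thesis using j by (simp only:) (subst ln_mult, auto)
  qed
  moreover have "ln (1 + 1 / real j) \<le> 1 / real j" using j by (intro ln_add_one_self_le_self) auto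
  moreover have "1 \<le> ln (real j)"
  proof -
    have "exp 1 \<le> real j" using exp_le j by linarith
    then show ?thesis using j by (subst ln_ge_iff) auto
  qed
  then have "1 / real j \<le> ln (real j) / real j" using j by (intro divide_right_mono) auto
  ultimately have "ln (real (Suc j)) \<le> ln (real j) + ln (real j) / real j" by linarith
  also have "\<dots> = ln (real j) / real j * real (Suc j)" using j by (simp add: field_simps)
  finally show ?thesis by (subst pos_divide_le_eq) auto
qed

lemma density_piece:
  assumes P: "\<And>p. p \<in> P \<Longrightarrow> prime p" and ab: "3 \<le> a" "a \<le> b"
    and dens: "\<And>t. a \<le> t \<Longrightarrow> t \<le> b \<Longrightarrow> \<bar>real (card (P \<inter> primes_le t)) - s * real (prime_pi t)\<bar> \<le> \<theta> * real (prime_pi t)" and th: "\<theta> \<ge> 0"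
  shows "\<bar>(\<Sum>p\<in>P \<inter> (primes_le b - primes_le a). ln (real p) / real p) - s * (\<Sum>p\<in>primes_le b - primes_le a. ln (real p) / real p)\<bar>
    \<le> \<theta> * ((\<Sum>p\<in>primes_le b - primes_le a. ln (real p) / real p) + 20)"
proof -
  define m n where "m = nat \<lfloor>a\<rfloor>" and "n = nat \<lfloor>b\<rfloor>"
  have m: "3 \<le> m" unfolding m_def using ab by (simp add: le_nat_iff le_floor_iff)
  have mn: "m \<le> n" unfolding m_def n_def using ab by (intro nat_mono floor_mono)
  have le_a: "k \<le> m \<longleftrightarrow> real k \<le> a" and le_b: "k \<le> n \<longleftrightarrow> real k \<le> b" for k
    using ab by (simp_all add: m_def n_def le_nat_iff le_floor_iff)
  define c where "c k = (if prime k then 1 else 0 :: real)" for k :: nat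
  define r where "r k = (if k \<in> P then 1 else 0) - s * c k" for k
  define g where "g k = ln (real k) / real k" for k :: nat
  have g0: "g k \<ge> 0" for k by (cases "k = 0") (auto simp: g_def)
  have sc: "(\<Sum>k\<le>j. c k) = real (card (primes_le (real j)))" for j
  proof -
    have "{k\<in>{..j}. prime k} = primes_le (real j)" by (auto simp: primes_le_def)
    then show ?thesis by (simp add: c_def sum.If_cases Int_def)
  qed
  have sr: "(\<Sum>k\<le>j. r k) = real (card (P \<inter> primes_le (real j))) - s * real (card (primes_le (real j)))" for j
  proof -
    have "{k\<in>{..j}. k \<in> P} = P \<inter> primes_le (real j)" using P by (auto simp: primes_le_def)
    then have "(\<Sum>k\<le>j. if k \<in> P then 1 else 0 :: real) = real (card (P \<inter> primes_le (real j)))"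
      by (simp add: sum.If_cases Int_def)
    moreover have "(\<Sum>k\<le>j. r k) = (\<Sum>k\<le>j. if k \<in> P then 1 else 0) - s * (\<Sum>k\<le>j. c k)"
      by (simp add: r_def sum_subtractf sum_distrib_left)
    ultimately show ?thesis by (simp only: sc)
  qed
  have "\<bar>\<Sum>k\<in>{m<..n}. r k * g k\<bar> \<le> \<theta> * ((\<Sum>k\<in>{m<..n}. c k * g k) + 2 * ((\<Sum>k\<le>m. c k) * g m))"
  proof (rule abel_transfer[where m = m and n = n and g = g and r = r and c = c and \<theta> = \<theta>])
    show "g (Suc j) \<le> g j" if "m \<le> j" for j unfolding g_def by (rule ln_div_self_Suc_le) (use m that in auto)
    show "\<bar>\<Sum>k\<le>j. r k\<bar> \<le> \<theta> * (\<Sum>k\<le>j. c k)" if j: "m \<le> j" "j \<le> n" for j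
    proof -
      \<comment> \<open>For j = m = floor a the integer j may lie below a, where no density is
        assumed; there is no prime in between, so a serves instead.\<close>
      define t where "t = max a (real j)"
      have "primes_le t = primes_le (real j)"
      proof (cases "a \<le> real j")
        case False
        then have "j = m" using le_a[of j] j by linarith
        then have "primes_le a = primes_le (real j)"
          unfolding primes_le_def le_a[symmetric] by simp
        then show ?thesis using False by (simp add: t_def max_def)
      qed (simp add: t_def)
      moreover have "a \<le> t" "t \<le> b" using j le_b[of j] ab by (auto simp: t_def)
      ultimately show ?thesis using dens[of t] by (simp add: sr sc prime_pi_eq)
    qed
  qed (auto simp: c_def g0 mn)
  moreover have "{k\<in>{m<..n}. prime k} = primes_le b - primes_le a"
    unfolding primes_le_def le_a[symmetric] le_b[symmetric] by auto
  then have "(\<Sum>k\<in>{m<..n}. c k * g k) = (\<Sum>p\<in>primes_le b - primes_le a. g p)"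
    by (simp add: c_def if_distrib[of "\<lambda>x. x * _"] sum.If_cases Int_def cong: if_cong)
  moreover have "{k\<in>{m<..n}. k \<in> P} = P \<inter> (primes_le b - primes_le a)"
    unfolding primes_le_def le_a[symmetric] le_b[symmetric] using P by auto
  then have "(\<Sum>k\<in>{m<..n}. (if k \<in> P then 1 else 0) * g k) = (\<Sum>p\<in>P \<inter> (primes_le b - primes_le a). g p)"
    by (simp add: if_distrib[of "\<lambda>x. x * _"] sum.If_cases Int_def cong: if_cong)
  moreover have "(\<Sum>k\<in>{m<..n}. r k * g k) = (\<Sum>k\<in>{m<..n}. (if k \<in> P then 1 else 0) * g k) - s * (\<Sum>k\<in>{m<..n}. c k * g k)"
    by (simp add: r_def left_diff_distrib sum_subtractf sum_distrib_left mult.assoc)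
  \<comment> \<open>Chebyshev's bound for \<pi>(m) ln m / m; doubled by the boundary term of partial
    summation it becomes the 20 of the statement.\<close>
  moreover have "(\<Sum>k\<le>m. c k) * g m \<le> 10"
    using prime_pi_le[of "real m"] m by (simp add: sc g_def prime_pi_eq[symmetric] field_simps)
  then have "\<theta> * ((\<Sum>p\<in>primes_le b - primes_le a. g p) + 2 * ((\<Sum>k\<le>m. c k) * g m)) \<le> \<theta> * ((\<Sum>p\<in>primes_le b - primes_le a. g p) + 20)"
    using th by (intro mult_left_mono) (simp_all add: mult.commute)
  ultimately show ?thesis by (simp add: g_def)
qed

text \<open>For v \<le> 1 all primes are present and Mertens suffices, as \<sigma> = 1 there. Beyond
  1 the exponent range is cut into n pieces on which \<sigma> is constant up to \<omega>. As n is
  fixed before y, the bounded errors of the pieces disappear on division by ln y.\<close>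

lemma density_imp_log_weights:
  assumes ker: "vkernel \<sigma>" and cont: "continuous_on {0..} \<sigma>" and U: "U \<ge> 1" and tau: "\<tau> > 0"
  shows "\<exists>e>0. \<forall>\<^sub>F y in at_top. \<forall>P. (\<forall>p\<in>P. prime p) \<longrightarrow> primes_le y \<subseteq> P \<longrightarrow>
     (\<forall>t\<in>{y..y powr U}. \<bar>real (card (P \<inter> primes_le t)) - real (prime_pi t) * \<sigma> (ln t / ln y)\<bar> \<le> e * real (prime_pi t)) \<longrightarrow>
     (\<forall>v\<in>{0..U}. \<bar>(\<Sum>p\<in>P \<inter> primes_le (y powr v). ln (real p) / (real p * ln y)) - integral {0..v} \<sigma>\<bar> \<le> \<tau>)"
proof -
  obtain C where C: "C \<ge> 0" and mert: "\<And>x. x \<ge> 1 \<Longrightarrow> \<bar>(\<Sum>p\<in>primes_le x. ln (real p) / real p) - ln x\<bar> \<le> C"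
    using mertens by blast
  define \<omega> where "\<omega> = min (1/2) (\<tau> / (6 * U))"
  have om: "\<omega> > 0" "\<omega> \<le> 1/2" using tau U by (auto simp: \<omega>_def)
  have "\<omega> \<le> \<tau> / (6 * U)" by (simp add: \<omega>_def)
  then have omU: "3 * (\<omega> * U) \<le> \<tau> / 2" using U by (simp add: field_simps)
  have "uniformly_continuous_on {0..U} \<sigma>"
    by (rule compact_uniformly_continuous) (auto intro: continuous_on_subset[OF cont])
  then obtain \<delta> where del: "\<delta> > 0" "\<And>s s'. s \<in> {0..U} \<Longrightarrow> s' \<in> {0..U} \<Longrightarrow> \<bar>s' - s\<bar> < \<delta> \<Longrightarrow> \<bar>\<sigma> s' - \<sigma> s\<bar> < \<omega>"
    using om unfolding uniformly_continuous_on_def dist_real_def by metis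
  obtain n0 :: nat where n0: "real n0 > U / \<delta>" using reals_Archimedean2 by blast
  define n where "n = Suc n0"
  have n: "real n > 0" "U / real n < \<delta>"
  proof -
    have "U / \<delta> < real n" using n0 by (simp add: n_def)
    then show "U / real n < \<delta>" using del by (simp add: field_simps n_def)
  qed (simp add: n_def)
  \<comment> \<open>Sum of the bounded errors: C from the part up to y, 2 C + 20 per piece from the
    density comparison, whose factor 2 \<omega> is at most 1, and 2 C per piece for the mass of all
    its primes. The remaining losses, proportional to \<omega>, total at most 3 \<omega> U \<le>
    \<tau> / 2.\<close>
  define D where "D = C + real n * (2 * C + 20) + real n * (2 * C)"
  have D: "D \<ge> 0" "C \<le> D" using C by (auto simp: D_def)
  have "\<forall>\<^sub>F y::real in at_top. D / ln y \<le> \<tau> / 2" using tau by real_asymp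
  then have "\<forall>\<^sub>F y in at_top. \<forall>P. (\<forall>p\<in>P. prime p) \<longrightarrow> primes_le y \<subseteq> P \<longrightarrow>
     (\<forall>t\<in>{y..y powr U}. \<bar>real (card (P \<inter> primes_le t)) - real (prime_pi t) * \<sigma> (ln t / ln y)\<bar> \<le> \<omega> * real (prime_pi t)) \<longrightarrow>
     (\<forall>v\<in>{0..U}. \<bar>(\<Sum>p\<in>P \<inter> primes_le (y powr v). ln (real p) / (real p * ln y)) - integral {0..v} \<sigma>\<bar> \<le> \<tau>)"
    using eventually_ge_at_top[of 3]
  proof eventually_elim
    case (elim y)
    have y: "y > 1" "ln y > 0" "y \<ge> 3" using elim by auto
    define l where "l = 1 / ln y"
    have l: "l > 0" "l * ln y = 1" using y by (auto simp: l_def)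
    have Dl: "D * l \<le> \<tau> / 2" using elim by (simp add: l_def)
    show ?case
    proof (intro allI impI ballI)
      fix P v assume P: "\<forall>p\<in>P. prime p" "primes_le y \<subseteq> P" and v: "v \<in> {0..U}"
        and dens: "\<forall>t\<in>{y..y powr U}. \<bar>real (card (P \<inter> primes_le t)) - real (prime_pi t) * \<sigma> (ln t / ln y)\<bar> \<le> \<omega> * real (prime_pi t)"
      define M where "M s = (\<Sum>p\<in>primes_le (y powr s). ln (real p) / real p)" for s
      define A where "A s = (\<Sum>p\<in>P \<inter> primes_le (y powr s). ln (real p) / real p)" for s
      define K where "K s = integral {0..s} \<sigma>" for s
      have Mb: "\<bar>M s - s * ln y\<bar> \<le> C" if "s \<ge> 0" for s
        using mert[of "y powr s"] y that by (simp add: M_def ln_powr ge_one_powr_ge_zero)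
      have small: "\<bar>A s * l - K s\<bar> \<le> C * l" if s: "s \<in> {0..1}" for s
      proof -
        have "y powr s \<le> y" using powr_mono[of s 1 y] s y by simp
        then have "P \<inter> primes_le (y powr s) = primes_le (y powr s)" using P primes_le_mono by blast
        then have AM: "A s = M s" by (simp add: A_def M_def)
        have "K s = integral {0..s} (\<lambda>_. 1 :: real)" unfolding K_def
          by (rule integral_cong) (use s vkernelD(3)[OF ker] in auto)
        then have "K s = s" using s by simp
        then have "A s * l - K s = M s * l - s * (l * ln y)" using l by (simp add: AM)
        also have "\<dots> = (M s - s * ln y) * l" by (simp add: algebra_simps)
        finally have "A s * l - K s = (M s - s * ln y) * l" .
        then have "\<bar>A s * l - K s\<bar> = \<bar>M s - s * ln y\<bar> * l" using l by (simp add: abs_mult)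
        also have "\<dots> \<le> C * l" using Mb[of s] s l by (intro mult_right_mono) auto
        finally show ?thesis .
      qed
      have "\<bar>A v * l - K v\<bar> \<le> \<tau>"
      proof (cases "v \<le> 1")
        case True
        have "\<bar>A v * l - K v\<bar> \<le> C * l" using small[of v] True v by auto
        also have "\<dots> \<le> D * l" using D l by (intro mult_right_mono) auto
        finally show ?thesis using Dl tau by linarith
      next
        case False
        define h where "h = (v - 1) / real n"
        have h: "h \<ge> 0" "real n * h = v - 1" "h \<le> U / real n"
          using False n v by (auto simp: h_def intro!: divide_right_mono)
        define s where "s i = 1 + h * real i" for i
        have s_Suc: "s (Suc i) = s i + h" for i by (simp add: s_def algebra_simps)
        have s_ge: "1 \<le> s i" for i using h by (simp add: s_def)
        have s_le: "s i \<le> v" if "i \<le> n" for i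
        proof -
          have "h * real i \<le> h * real n" using h that by (intro mult_left_mono) auto
          then show ?thesis using h by (simp add: s_def mult.commute)
        qed
        define E where "E = (\<omega> + \<omega>) * (h + (2 * C + 20) * l) + \<omega> * h + 2 * C * l"
        have main: "\<bar>A (s i) * l - K (s i)\<bar> \<le> C * l + real i * E" if "i \<le> n" for i
          using that
        proof (induction i)
          case 0
          then show ?case using small[of 1] by (simp add: s_def)
        next
          case (Suc i)
          let ?x = "s i" and ?z = "s (Suc i)"
          let ?a = "y powr ?x" and ?b = "y powr ?z"
          have xz: "1 \<le> ?x" "?x \<le> ?z" "?z \<le> U" "?z - ?x = h"
            using s_ge[of i] s_le[OF Suc.prems] s_Suc[of i] h v by auto
          have ya: "y \<le> ?a" using powr_mono[of 1 ?x y] xz y by simp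
          have ab: "?a \<le> ?b" using xz y by simp
          have split: "primes_le ?b = primes_le ?a \<union> (primes_le ?b - primes_le ?a)" using primes_le_mono[OF ab] by auto
          define dM where "dM = (\<Sum>p\<in>primes_le ?b - primes_le ?a. ln (real p) / real p)"
          define dA where "dA = (\<Sum>p\<in>P \<inter> (primes_le ?b - primes_le ?a). ln (real p) / real p)"
          have dM: "M ?z = M ?x + dM" unfolding M_def dM_def
            by (subst split, rule sum.union_disjoint) auto
          have dA: "A ?z = A ?x + dA"
          proof -
            have "P \<inter> primes_le ?b = (P \<inter> primes_le ?a) \<union> (P \<inter> (primes_le ?b - primes_le ?a))"
              using primes_le_mono[OF ab] by auto
            then show ?thesis unfolding A_def dA_def by (simp only:) (rule sum.union_disjoint, auto)
          qed
          have dMb: "\<bar>dM - h * ln y\<bar> \<le> 2 * C"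
          proof -
            have "?z * ln y = ?x * ln y + h * ln y" using xz by (simp add: algebra_simps s_Suc)
            then show ?thesis using Mb[of ?x] Mb[of ?z] xz dM by linarith
          qed
          have piece: "\<bar>dA - \<sigma> ?x * dM\<bar> \<le> (\<omega> + \<omega>) * (dM + 20)"
            unfolding dA_def dM_def
          proof (rule density_piece)
            show "prime p" if "p \<in> P" for p using P that by auto
            show "3 \<le> ?a" using ya y by linarith
            show "?a \<le> ?b" by fact
            show "\<omega> + \<omega> \<ge> 0" using om by simp
            fix t assume t: "?a \<le> t" "t \<le> ?b"
            have t0: "t > 0" using t ya y by linarith
            have bU: "?b \<le> y powr U" using xz y by simp
            have lt: "?x \<le> ln t / ln y" "ln t / ln y \<le> ?z"
            proof -
              have "ln ?a \<le> ln t" "ln t \<le> ln ?b" using t t0 y by (subst ln_le_cancel_iff; simp)+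
              then show "?x \<le> ln t / ln y" "ln t / ln y \<le> ?z" using y by (auto simp: ln_powr field_simps)
            qed
            have "\<bar>\<sigma> (ln t / ln y) - \<sigma> ?x\<bar> < \<omega>"
              by (rule del(2)) (use lt xz h n in auto)
            then have "\<bar>\<sigma> (ln t / ln y) - \<sigma> ?x\<bar> * real (prime_pi t) \<le> \<omega> * real (prime_pi t)"
              by (intro mult_right_mono) auto
            moreover have "\<bar>\<sigma> (ln t / ln y) - \<sigma> ?x\<bar> * real (prime_pi t) = \<bar>\<sigma> ?x * real (prime_pi t) - real (prime_pi t) * \<sigma> (ln t / ln y)\<bar>"
            proof -
              have "\<bar>\<sigma> ?x * real (prime_pi t) - real (prime_pi t) * \<sigma> (ln t / ln y)\<bar> = \<bar>(\<sigma> ?x - \<sigma> (ln t / ln y)) * real (prime_pi t)\<bar>"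
                by (simp add: algebra_simps)
              then show ?thesis by (simp add: abs_mult abs_minus_commute)
            qed
            moreover have "\<bar>real (card (P \<inter> primes_le t)) - real (prime_pi t) * \<sigma> (ln t / ln y)\<bar> \<le> \<omega> * real (prime_pi t)"
              using dens t ya bU by auto
            ultimately show "\<bar>real (card (P \<inter> primes_le t)) - \<sigma> ?x * real (prime_pi t)\<bar> \<le> (\<omega> + \<omega>) * real (prime_pi t)"
              using abs_diff_le_add[of "real (card (P \<inter> primes_le t))" "real (prime_pi t) * \<sigma> (ln t / ln y)" "\<omega> * real (prime_pi t)" "\<sigma> ?x * real (prime_pi t)" "\<omega> * real (prime_pi t)"]
              by (simp add: distrib_right)
          qed
          have sig: "0 \<le> \<sigma> ?x" "\<sigma> ?x \<le> 1" using vkernelD(1,2)[OF ker] by auto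
          have p1: "\<bar>dA * l - \<sigma> ?x * h\<bar> \<le> (\<omega> + \<omega>) * (h + (2 * C + 20) * l) + 2 * C * l"
          proof -
            have "\<bar>dA - \<sigma> ?x * (h * ln y)\<bar> \<le> (\<omega> + \<omega>) * (h * ln y + (2 * C + 20)) + 2 * C"
            proof -
              have "(\<omega> + \<omega>) * (dM + 20) \<le> (\<omega> + \<omega>) * (h * ln y + (2 * C + 20))"
                using dMb om by (intro mult_left_mono) auto
              moreover have "\<bar>\<sigma> ?x * (dM - h * ln y)\<bar> \<le> 1 * (2 * C)"
                unfolding abs_mult using sig dMb by (intro mult_mono) auto
              moreover have "\<sigma> ?x * (dM - h * ln y) = \<sigma> ?x * dM - \<sigma> ?x * (h * ln y)" by (rule right_diff_distrib)
              ultimately show ?thesis using piece by linarith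
            qed
            then have "\<bar>dA - \<sigma> ?x * (h * ln y)\<bar> * l \<le> ((\<omega> + \<omega>) * (h * ln y + (2 * C + 20)) + 2 * C) * l"
              using l by (intro mult_right_mono) auto
            moreover have "\<bar>dA - \<sigma> ?x * (h * ln y)\<bar> * l = \<bar>dA * l - \<sigma> ?x * h * (l * ln y)\<bar>"
            proof -
              have "dA * l - \<sigma> ?x * h * (l * ln y) = (dA - \<sigma> ?x * (h * ln y)) * l" by (simp add: algebra_simps)
              then show ?thesis using l by (simp add: abs_mult)
            qed
            moreover have "((\<omega> + \<omega>) * (h * ln y + (2 * C + 20)) + 2 * C) * l = (\<omega> + \<omega>) * (h * (l * ln y) + (2 * C + 20) * l) + 2 * C * l"
              by (simp add: algebra_simps)
            ultimately show ?thesis using l by simp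
          qed
          have dK: "K ?z = K ?x + integral {?x..?z} \<sigma>" unfolding K_def
            using xz by (intro Henstock_Kurzweil_Integration.integral_combine[symmetric] vkernel_integrable[OF ker]) auto
          have p2: "\<bar>integral {?x..?z} \<sigma> - \<sigma> ?x * h\<bar> \<le> \<omega> * h"
          proof -
            have ki: "\<sigma> integrable_on {?x..?z}" by (rule vkernel_integrable[OF ker]) (use xz in auto)
            have "integral {?x..?z} (\<lambda>_. \<sigma> ?x) = \<sigma> ?x * h" using xz by (simp add: mult.commute)
            then have "integral {?x..?z} \<sigma> - \<sigma> ?x * h = integral {?x..?z} (\<lambda>t. \<sigma> t - \<sigma> ?x)"
              using ki by (subst Henstock_Kurzweil_Integration.integral_diff) auto
            also have "norm \<dots> \<le> integral {?x..?z} (\<lambda>_. \<omega>)"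
            proof (rule integral_norm_bound_integral)
              show "(\<lambda>t. \<sigma> t - \<sigma> ?x) integrable_on {?x..?z}" using ki by (intro Henstock_Kurzweil_Integration.integrable_diff) auto
              fix t assume "t \<in> {?x..?z}"
              then have "\<bar>\<sigma> t - \<sigma> ?x\<bar> < \<omega>" by (intro del(2)) (use xz h n in auto)
              then show "norm (\<sigma> t - \<sigma> ?x) \<le> \<omega>" by simp
            qed auto
            finally show ?thesis using xz by (simp add: mult.commute)
          qed
          have "A ?z * l = A ?x * l + dA * l" by (simp add: dA distrib_right)
          then have "\<bar>A ?z * l - K ?z\<bar> \<le> C * l + real i * E + E"
            using Suc p1 p2 dK unfolding E_def by linarith
          then show ?case by (simp add: algebra_simps)
        qed
        have sn: "s n = v" using h by (simp add: s_def mult.commute)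
        have "real n * E = (\<omega> + \<omega>) * (real n * h + real n * (2 * C + 20) * l) + \<omega> * (real n * h) + real n * (2 * C) * l"
          by (simp add: E_def algebra_simps)
        also have "\<dots> \<le> (\<omega> + \<omega>) * U + 1 * (real n * (2 * C + 20) * l) + \<omega> * U + real n * (2 * C) * l"
        proof -
          have "(\<omega> + \<omega>) * (real n * h) \<le> (\<omega> + \<omega>) * U" "\<omega> * (real n * h) \<le> \<omega> * U"
            using om h v by (auto intro!: mult_left_mono)
          moreover have "(\<omega> + \<omega>) * (real n * (2 * C + 20) * l) \<le> 1 * (real n * (2 * C + 20) * l)"
            using om C l by (intro mult_right_mono) auto
          ultimately show ?thesis unfolding distrib_left by linarith
        qed
        finally have "C * l + real n * E \<le> 3 * (\<omega> * U) + D * l" by (simp add: D_def algebra_simps)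
        then show ?thesis using main[of n] omU Dl sn by simp
      qed
      moreover have "(\<Sum>p\<in>P \<inter> primes_le (y powr v). ln (real p) / (real p * ln y)) = A v * l"
        by (simp add: A_def l_def sum_divide_distrib)
      ultimately show "\<bar>(\<Sum>p\<in>P \<inter> primes_le (y powr v). ln (real p) / (real p * ln y)) - integral {0..v} \<sigma>\<bar> \<le> \<tau>"
        by (simp add: K_def)
    qed
  qed
  with om show ?thesis by blast
qed


section \<open>Induction on the level\<close>

definition level_asymp :: "nat \<Rightarrow> bool" where
  "level_asymp k \<longleftrightarrow> (\<forall>U\<ge>1. \<forall>e>0. \<forall>\<^sub>F y in at_top. \<forall>v\<in>{1..U}.
     \<bar>real (card (gen_set (level_primes k y) (y powr v))) / y powr v - sigma_fun k v\<bar> \<le> e)"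

lemma integral_indicator_01: "v \<ge> 0 \<Longrightarrow> integral {0..v} (indicator {0..1}) = min v (1::real)"
proof -
  assume v: "v \<ge> 0"
  have "integral {0..v} (indicator {0..1}) = integral {0..v} (\<lambda>t. if t \<in> {0..1} then 1 else 0 :: real)"
    by (rule integral_cong) (auto simp: indicator_def)
  also have "\<dots> = integral ({0..1} \<inter> {0..v}) (\<lambda>_. 1)" by (rule integral_restrict_Int)
  also have "{0..1} \<inter> {0..v} = {0..min v 1}" by auto
  also have "integral {0..min v 1} (\<lambda>_. 1 :: real) = min v 1" using v by simp
  finally show ?thesis .
qed

text \<open>Dickman's theorem: for P = \<open>primes_le y\<close> the cumulative weight up to y^v
  is, by Mertens, min v 1 up to O(1 / ln y), and this is the integral of the indicator
  kernel.\<close>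

lemma level_asymp_0: "level_asymp 0"
  unfolding level_asymp_def
proof (intro allI impI)
  fix U e :: real assume U: "U \<ge> 1" and e: "e > 0"
  obtain C where C: "C \<ge> 0" and mert: "\<And>x. x \<ge> 1 \<Longrightarrow> \<bar>(\<Sum>p\<in>primes_le x. ln (real p) / real p) - ln x\<bar> \<le> C"
    using mertens by blast
  obtain \<tau> where tau: "\<tau> > 0" and ev: "\<forall>\<^sub>F y in at_top. \<forall>P. primes_le y \<subseteq> P \<longrightarrow>
      (\<forall>v\<in>{0..U}. \<bar>(\<Sum>p\<in>P \<inter> primes_le (y powr v). ln (real p) / (real p * ln y)) - integral {0..v} (indicator {0..1})\<bar> \<le> \<tau>) \<longrightarrow>
      (\<forall>v\<in>{1..U}. \<bar>real (card (gen_set P (y powr v))) / y powr v - sigma_fun 0 v\<bar> \<le> e)"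
    using mean_value[OF vkernel_sigma_kernel[of 0] vsol_sigma_fun[of 0] U e] by auto
  have "\<forall>\<^sub>F y::real in at_top. C / ln y \<le> \<tau>" using tau by real_asymp
  with ev show "\<forall>\<^sub>F y in at_top. \<forall>v\<in>{1..U}. \<bar>real (card (gen_set (level_primes 0 y) (y powr v))) / y powr v - sigma_fun 0 v\<bar> \<le> e"
    using eventually_ge_at_top[of 3]
  proof eventually_elim
    case (elim y)
    have y: "y > 1" "ln y > 0" using elim by auto
    have "\<bar>(\<Sum>p\<in>primes_le y \<inter> primes_le (y powr v). ln (real p) / (real p * ln y)) - integral {0..v} (indicator {0..1})\<bar> \<le> \<tau>"
      if v: "v \<in> {0..U}" for v
    proof -
      let ?w = "min v 1"
      have "primes_le y \<inter> primes_le (y powr v) = primes_le (y powr ?w)"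
      proof (cases "v \<le> 1")
        case True
        then have "y powr v \<le> y" using powr_mono[of v 1 y] y by simp
        then show ?thesis using True primes_le_mono by (auto simp: min_def)
      next
        case False
        then have "y \<le> y powr v" using powr_mono[of 1 v y] y by simp
        then show ?thesis using False primes_le_mono y by (auto simp: min_def)
      qed
      then have "(\<Sum>p\<in>primes_le y \<inter> primes_le (y powr v). ln (real p) / (real p * ln y)) - integral {0..v} (indicator {0..1})
          = (\<Sum>p\<in>primes_le (y powr ?w). ln (real p) / real p) / ln y - ?w"
        using v integral_indicator_01[of v] by (simp add: sum_divide_distrib)
      also have "\<dots> = ((\<Sum>p\<in>primes_le (y powr ?w). ln (real p) / real p) - ln (y powr ?w)) / ln y"
        using y by (simp add: ln_powr diff_divide_distrib)
      finally have "\<bar>(\<Sum>p\<in>primes_le y \<inter> primes_le (y powr v). ln (real p) / (real p * ln y)) - integral {0..v} (indicator {0..1})\<bar>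
          = \<bar>(\<Sum>p\<in>primes_le (y powr ?w). ln (real p) / real p) - ln (y powr ?w)\<bar> / ln y" using y by simp
      also have "\<dots> \<le> C / ln y"
        using y v by (intro divide_right_mono mert) (auto simp: ge_one_powr_ge_zero)
      also have "\<dots> \<le> \<tau>" using elim by simp
      finally show ?thesis .
    qed
    then show ?case using elim by simp
  qed
qed

lemma level_asymp_Suc:
  assumes EH: "\<And>\<epsilon>::real. \<epsilon> > 0 \<Longrightarrow>
      (\<lambda>x::real. \<Sum>d\<in>{1..nat \<lfloor>x powr (1 - \<epsilon>)\<rfloor>}.
          \<bar>real (prime_pi_ap1 x d) - real (prime_pi x) / real (totient d)\<bar>)
        \<in> o[at_top](\<lambda>x. real (prime_pi x))"
    and IH: "level_asymp k"
  shows "level_asymp (Suc k)"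
  unfolding level_asymp_def
proof (intro allI impI)
  fix U0 e :: real assume "U0 \<ge> 1" and e: "e > 0"
  \<comment> \<open>\<open>transference\<close> asks for U > 1, while U0 = 1 has to be covered as
    well.\<close>
  define U where "U = U0 + 1"
  have U: "U \<ge> 1" "U > 1" "U0 \<le> U" using \<open>U0 \<ge> 1\<close> by (auto simp: U_def)
  have sol: "vsol (sigma_fun k) (sigma_fun (Suc k))" using vsol_sigma_fun[of "Suc k"] by simp
  obtain \<tau> where tau: "\<tau> > 0" and ev1: "\<forall>\<^sub>F y in at_top. \<forall>P. primes_le y \<subseteq> P \<longrightarrow>
      (\<forall>v\<in>{0..U}. \<bar>(\<Sum>p\<in>P \<inter> primes_le (y powr v). ln (real p) / (real p * ln y)) - integral {0..v} (sigma_fun k)\<bar> \<le> \<tau>) \<longrightarrow>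
      (\<forall>v\<in>{1..U}. \<bar>real (card (gen_set P (y powr v))) / y powr v - sigma_fun (Suc k) v\<bar> \<le> e)"
    using mean_value[OF vkernel_sigma_fun sol U(1) e] by blast
  obtain e' where e': "e' > 0" and ev2: "\<forall>\<^sub>F y in at_top. \<forall>P. (\<forall>p\<in>P. prime p) \<longrightarrow> primes_le y \<subseteq> P \<longrightarrow>
     (\<forall>t\<in>{y..y powr U}. \<bar>real (card (P \<inter> primes_le t)) - real (prime_pi t) * sigma_fun k (ln t / ln y)\<bar> \<le> e' * real (prime_pi t)) \<longrightarrow>
     (\<forall>v\<in>{0..U}. \<bar>(\<Sum>p\<in>P \<inter> primes_le (y powr v). ln (real p) / (real p * ln y)) - integral {0..v} (sigma_fun k)\<bar> \<le> \<tau>)"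
    using density_imp_log_weights[OF vkernel_sigma_fun vsolD(1)[OF vsol_sigma_fun] U(1) tau] by blast
  have e2: "e' / 2 > 0" using e' by simp
  obtain t0 where t0: "\<And>t Q. t \<ge> t0 \<Longrightarrow> (\<forall>q\<in>Q. prime q \<and> t powr (1 / U) < real q) \<Longrightarrow>
    \<bar>real (card {p\<in>primes_le t. \<forall>q\<in>Q. \<not> q dvd (p - 1)}) -
      real (prime_pi t) * (real (card {n. 1 \<le> n \<and> real n \<le> t \<and> (\<forall>q\<in>Q. \<not> q dvd n)}) / t)\<bar> \<le> e' / 2 * real (prime_pi t)"
    using transference[OF EH U(2) e2] unfolding eventually_at_top_linorder by blast
  have ev3: "\<forall>\<^sub>F y in at_top. \<forall>v\<in>{1..U}.
     \<bar>real (card (gen_set (level_primes k y) (y powr v))) / y powr v - sigma_fun k v\<bar> \<le> e' / 2"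
    using IH U e2 unfolding level_asymp_def by blast
  show "\<forall>\<^sub>F y in at_top. \<forall>v\<in>{1..U0}. \<bar>real (card (gen_set (level_primes (Suc k) y) (y powr v))) / y powr v - sigma_fun (Suc k) v\<bar> \<le> e"
    using ev1 ev2 ev3 eventually_ge_at_top[of "max 3 t0"]
  proof eventually_elim
    case (elim y)
    have y: "y > 1" "ln y > 0" "y \<ge> t0" using elim by auto
    let ?P = "level_primes (Suc k) y"
    have PP: "\<forall>p\<in>?P. prime p" by simp
    have sub: "primes_le y \<subseteq> ?P" by (rule primes_le_subset_level_primes)
    have "\<bar>real (card (?P \<inter> primes_le t)) - real (prime_pi t) * sigma_fun k (ln t / ln y)\<bar> \<le> e' * real (prime_pi t)"
      if t: "t \<in> {y..y powr U}" for t
    proof -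
      \<comment> \<open>All members of \<open>Q\<close> exceed y \<ge> t^(1/U), since
        \<open>level_primes k y\<close> contains the primes up to y. That p - 1 avoids
        \<open>Q\<close> means p \<in> \<open>level_primes (Suc k) y\<close>, while the n \<le> t
        avoiding \<open>Q\<close> form \<open>gen_set (level_primes k y) t\<close>, whose size the
        induction hypothesis gives.\<close>
      define Q where "Q = {q. prime q \<and> q \<notin> level_primes k y}"
      define v where "v = ln t / ln y"
      have tpos: "t > 0" using t y by auto
      have yv: "y powr v = t" using y tpos by (simp add: v_def powr_def)
      have "y powr 1 \<le> y powr v" "y powr v \<le> y powr U" using t yv y by auto
      then have v: "v \<in> {1..U}" using y by (simp only: powr_le_cancel_iff atLeastAtMost_iff)
      have Qy: "t powr (1 / U) < real q" if "q \<in> Q" for q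
      proof -
        have "\<not> real q \<le> y" using that primes_le_subset_level_primes[of y k] by (auto simp: Q_def primes_le_def)
        moreover have "t powr (1 / U) \<le> y"
        proof -
          have "t powr (1 / U) \<le> (y powr U) powr (1 / U)" using t tpos U by (intro powr_mono2) auto
          also have "\<dots> = y" using y U by (simp add: powr_powr)
          finally show ?thesis .
        qed
        ultimately show ?thesis by linarith
      qed
      have set1: "{p\<in>primes_le t. \<forall>q\<in>Q. \<not> q dvd (p - 1)} = ?P \<inter> primes_le t"
        by (auto simp: Q_def primes_le_def)
      have set2: "{n. 1 \<le> n \<and> real n \<le> t \<and> (\<forall>q\<in>Q. \<not> q dvd n)} = gen_set (level_primes k y) t"
        by (auto simp: Q_def gen_set_def)
      have tr: "\<bar>real (card (?P \<inter> primes_le t)) - real (prime_pi t) * (real (card (gen_set (level_primes k y) t)) / t)\<bar> \<le> e' / 2 * real (prime_pi t)"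
        unfolding set1[symmetric] set2[symmetric] by (rule t0) (use y t Qy in \<open>auto simp: Q_def\<close>)
      have "\<bar>real (card (gen_set (level_primes k y) t)) / t - sigma_fun k v\<bar> \<le> e' / 2"
        using elim(3) v yv by force
      then have "real (prime_pi t) * \<bar>sigma_fun k v - real (card (gen_set (level_primes k y) t)) / t\<bar> \<le> real (prime_pi t) * (e' / 2)"
        by (intro mult_left_mono) (auto simp: abs_minus_commute)
      moreover have "real (prime_pi t) * \<bar>sigma_fun k v - real (card (gen_set (level_primes k y) t)) / t\<bar>
        = \<bar>real (prime_pi t) * sigma_fun k v - real (prime_pi t) * (real (card (gen_set (level_primes k y) t)) / t)\<bar>"
      proof -
        have "\<bar>real (prime_pi t) * sigma_fun k v - real (prime_pi t) * c\<bar> = real (prime_pi t) * \<bar>sigma_fun k v - c\<bar>" for c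
          by (simp add: abs_mult flip: right_diff_distrib)
        then show ?thesis by (simp only:)
      qed
      ultimately have "\<bar>real (prime_pi t) * sigma_fun k v - real (prime_pi t) * (real (card (gen_set (level_primes k y) t)) / t)\<bar> \<le> real (prime_pi t) * (e' / 2)"
        by simp
      with tr have "\<bar>real (card (?P \<inter> primes_le t)) - real (prime_pi t) * sigma_fun k v\<bar> \<le> e' / 2 * real (prime_pi t) + real (prime_pi t) * (e' / 2)"
        by (rule abs_diff_le_add)
      then show ?thesis by (simp add: v_def field_simps)
    qed
    then have "\<forall>v\<in>{0..U}. \<bar>(\<Sum>p\<in>?P \<inter> primes_le (y powr v). ln (real p) / (real p * ln y)) - integral {0..v} (sigma_fun k)\<bar> \<le> \<tau>"
      using elim(2) PP sub by blast
    then have "\<forall>v\<in>{1..U}. \<bar>real (card (gen_set ?P (y powr v))) / y powr v - sigma_fun (Suc k) v\<bar> \<le> e"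
      using elim(1) sub by blast
    then show ?case using U by auto
  qed
qed

lemma Phi_count_asymp:
  assumes EH: "\<And>\<epsilon>::real. \<epsilon> > 0 \<Longrightarrow>
      (\<lambda>x::real. \<Sum>d\<in>{1..nat \<lfloor>x powr (1 - \<epsilon>)\<rfloor>}.
          \<bar>real (prime_pi_ap1 x d) - real (prime_pi x) / real (totient d)\<bar>)
        \<in> o[at_top](\<lambda>x. real (prime_pi x))"
    and U: "U > 1" and e: "e > 0"
  shows "\<forall>\<^sub>F x in at_top. \<forall>u\<in>{1..U}.
            \<bar>real (Phi_count k x (x powr (1 / u))) - x * sigma_fun k u\<bar> \<le> e * (x * sigma_fun k u)"
proof -
  have lev: "level_asymp k"
    by (induction k) (use level_asymp_0 level_asymp_Suc[OF EH] in auto)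
  have "continuous_on {1..U} (sigma_fun k)"
    by (rule continuous_on_subset[OF vsolD(1)[OF vsol_sigma_fun]]) auto
  then obtain m where m: "m \<in> {1..U}" "\<And>u. u \<in> {1..U} \<Longrightarrow> sigma_fun k m \<le> sigma_fun k u"
    using continuous_attains_inf[of "{1..U}" "sigma_fun k"] U by auto
  \<comment> \<open>The minimum of \<sigma> over the compact range is positive and turns the
    absolute error of \<open>level_asymp\<close> into a relative one.\<close>
  define c where "c = sigma_fun k m"
  have c: "c > 0" unfolding c_def
    by (rule vsol_pos[OF vkernel_sigma_kernel vsol_sigma_fun]) (use m in auto)
  have ec: "e * c / 2 > 0" using e c by simp
  have "\<forall>\<^sub>F y in at_top. \<forall>v\<in>{1..U}. \<bar>real (card (gen_set (level_primes k y) (y powr v))) / y powr v - sigma_fun k v\<bar> \<le> e * c / 2"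
    by (rule lev[unfolded level_asymp_def, rule_format]) (use U ec in auto)
  then obtain y0 where y0: "\<And>y v. y \<ge> y0 \<Longrightarrow> v \<in> {1..U} \<Longrightarrow> \<bar>real (card (gen_set (level_primes k y) (y powr v))) / y powr v - sigma_fun k v\<bar> \<le> e * c / 2"
    unfolding eventually_at_top_linorder by blast
  have U0: "1 / U > 0" using U by simp
  have ev1: "\<forall>\<^sub>F x::real in at_top. x powr (1 / U) \<ge> y0" using U0 by real_asymp
  \<comment> \<open>The bound for the exceptional n is largest at the smallest y, namely x^(1/U),
    and even there a power of log x loses against a power of x; so the estimate is uniform in
    u.\<close>
  have "((\<lambda>x::real. real k * (8 * (1 + ln x)) ^ (2 * k) * (2 / x powr (1 / U))) \<longlongrightarrow> 0) at_top" using U0 by real_asymp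
  from order_tendstoD(2)[OF this ec]
  have ev2: "\<forall>\<^sub>F x::real in at_top. real k * (8 * (1 + ln x)) ^ (2 * k) * (2 / x powr (1 / U)) < e * c / 2" .
  show ?thesis
    using ev1 ev2 eventually_ge_at_top[of 1]
  proof eventually_elim
    case (elim x)
    show ?case
    proof
      fix u assume u: "u \<in> {1..U}"
      define y where "y = x powr (1 / u)"
      have x1: "x \<ge> 1" using elim by simp
      have y1: "y \<ge> 1" using x1 u by (simp add: y_def ge_one_powr_ge_zero)
      have yU: "x powr (1 / U) \<le> y" unfolding y_def using x1 u by (intro powr_mono divide_left_mono) auto
      have yu: "y powr u = x" using x1 u by (simp add: y_def powr_powr)
      have "\<bar>real (card (gen_set (level_primes k y) x)) / x - sigma_fun k u\<bar> \<le> e * c / 2"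
        using y0[of y u] yU elim u yu by simp
      then have "x * \<bar>real (card (gen_set (level_primes k y) x)) / x - sigma_fun k u\<bar> \<le> x * (e * c / 2)"
        using x1 by (intro mult_left_mono) auto
      moreover have "x * \<bar>real (card (gen_set (level_primes k y) x)) / x - sigma_fun k u\<bar> = \<bar>real (card (gen_set (level_primes k y) x)) - x * sigma_fun k u\<bar>"
      proof -
        have "real (card (gen_set (level_primes k y) x)) - x * sigma_fun k u = x * (real (card (gen_set (level_primes k y) x)) / x - sigma_fun k u)"
          using x1 by (simp add: right_diff_distrib)
        then show ?thesis using x1 by (simp add: abs_mult)
      qed
      ultimately have 1: "\<bar>real (card (gen_set (level_primes k y) x)) - x * sigma_fun k u\<bar> \<le> x * (e * c / 2)" by simp
      have "real k * (8 * (1 + ln x)) ^ (2 * k) * (2 / y) \<le> real k * (8 * (1 + ln x)) ^ (2 * k) * (2 / x powr (1 / U))"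
        using yU x1 y1 by (intro mult_left_mono divide_left_mono) auto
      then have "x * (real k * (8 * (1 + ln x)) ^ (2 * k) * (2 / y)) \<le> x * (e * c / 2)"
        using elim x1 by (intro mult_left_mono) auto
      then have "\<bar>real (Phi_count k x y) - x * sigma_fun k u\<bar> \<le> x * (e * c / 2) + x * (e * c / 2)"
        using Phi_count_approx[OF x1 y1, of k] 1 by linarith
      also have "\<dots> = e * (x * c)" by (simp add: algebra_simps)
      also have "\<dots> \<le> e * (x * sigma_fun k u)"
        using m(2)[OF u] x1 e by (intro mult_left_mono) (auto simp: c_def)
      finally show "\<bar>real (Phi_count k x (x powr (1 / u))) - x * sigma_fun k u\<bar> \<le> e * (x * sigma_fun k u)"
        by (simp add: y_def)
    qed
  qed
qed

theorem theorem2: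
  fixes U :: real and k :: nat
  assumes EH: "\<And>\<epsilon>::real. \<epsilon> > 0 \<Longrightarrow>
      (\<lambda>x::real. \<Sum>d\<in>{1..nat \<lfloor>x powr (1 - \<epsilon>)\<rfloor>}.
          \<bar>real (prime_pi_ap1 x d) - real (prime_pi x) / real (totient d)\<bar>)
        \<in> o[at_top](\<lambda>x. real (prime_pi x))"
    and U: "U > 1"
  shows "(\<forall>e>0. \<forall>\<^sub>F x in at_top. \<forall>u\<in>{1..U}.
            \<bar>real (Phi_count k x (x powr (1 / u))) - x * sigma_fun k u\<bar>
              \<le> e * (x * sigma_fun k u))
       \<and> (\<forall>j\<ge>1. \<exists>\<delta>::real \<Rightarrow> real. (\<delta> \<longlongrightarrow> 0) at_top \<and>
            (\<forall>\<^sub>F u in at_top. sigma_fun j u =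
               ((1 + \<delta> u) / (iter_log j u * iter_log (Suc j) u)) powr u))"
  using Phi_count_asymp[OF EH U] sigma_asymptotics by auto

end
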